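(* For every integer $d\ge 1$ and all real numbers $\alpha\ge 0$, $\rho>0$ there exists a constant $c_d=c_d(\alpha,\rho)>0$, depending only on $d,\alpha,\rho$, such that the following holds. Let $n$ be a positive integer, let $J=(J_{ij})_{i,j\le n}$ be a real symmetric matrix with vanishing diagonal satisfying $\max_{i\le n}\sum_{j=1}^n|J_{ij}|\le 1-\rho$ (Dobrushin condition), and let $h=(h_i)_{i\le n}\in\mathbb{R}^n$ satisfy $\max_{i\le n}|h_i|\le\alpha$. Let $\mu$ be the probability measure on $\{-1,1\}^n$ whose density with respect to the uniform distribution is $$\mu(\sigma)=\frac1Z\exp\Big(\frac12\sum_{i,j=1}^nJ_{ij}\sigma_i\sigma_j-\sum_{i=1}^nh_i\sigma_i\Big),\qquad \sigma\in\{-1,1\}^n,$$ where $Z$ is the normalizing constant, and let $X$ be a random vector with law $\mu$. Then for every tetrahedral polynomial $f$ in $n$ variables of degree $d$ and every $t>0$, $$\mathbb{P}\big(|f(X)-\mathbb{E}f(X)|\ge t\big)\le 2\exp\Big(-c_d\min_{1\le k\le d}\ \min_{\mathcal{I}\in P_k}\Big(\frac{t}{\|\mathbb{E}\nabla^kf(X)\|_{\mathcal{I}}}\Big)^{2/|\mathcal{I}|}\Big).$$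
   Context: A tetrahedral polynomial is a real polynomial in $x_1,\dots,x_n$ which is affine with respect to each variable separately. Every function $f\colon\{-1,1\}^n\to\mathbb{R}$ is represented uniquely by such a polynomial, and $\nabla^kf$ denotes the usual $k$-th derivative on $\mathbb{R}^n$ of this polynomial, i.e. the $k$-indexed matrix $\big(\frac{\partial^k f}{\partial x_{i_1}\cdots\partial x_{i_k}}\big)_{i_1,\dots,i_k\in[n]}$, where $[n]=\{1,\dots,n\}$; $\mathbb{E}\nabla^kf(X)$ is the entrywise expectation. $P_k$ is the set of partitions of $[k]=\{1,\dots,k\}$ into nonempty pairwise disjoint sets, and $|\mathcal{I}|$ is the number of blocks of the partition $\mathcal{I}$. For $\mathbf{i}=(i_1,\dots,i_k)\in[n]^k$ and $I\subseteq[k]$ write $\mathbf{i}_I=(i_j)_{j\in I}$. For $\mathcal{I}=\{I_1,\dots,I_m\}\in P_k$ and a $k$-indexed real matrix $A=(a_{\mathbf{i}})_{\mathbf{i}\in[n]^k}$, $$\|A\|_{\mathcal{I}}=\sup\Big\{\sum_{\mathbf{i}\in[n]^k}a_{\mathbf{i}}\prod_{l=1}^m x^{(l)}_{\mathbf{i}_{I_l}}\colon\ \|x^{(l)}\|_2\le1,\ 1\le l\le m\Big\},$$ where $x^{(l)}=(x^{(l)}_{\mathbf{j}})_{\mathbf{j}\in[n]^{I_l}}$ ranges over real arrays indexed by $[n]^{I_l}$ and $\|x^{(l)}\|_2=\big(\sum_{\mathbf{j}}(x^{(l)}_{\mathbf{j}})^2\big)^{1/2}$. By convention $t/0=+\infty$.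 *)

theory Defs
  imports "HOL-Probability.Probability" "HOL-Library.Poly_Mapping" "HOL-Library.Disjoint_Sets"
begin

text \<open>
  Coordinates are indexed by \<open>{1..n}\<close>, and points of \<open>\<real>\<^sup>n\<close> are functions \<open>nat \<Rightarrow> real\<close> of which only
  the values on \<open>{1..n}\<close> matter, so that \<open>n\<close> may be quantified inside a formula.
\<close>

subsection \<open>Tetrahedral polynomials and their derivatives\<close>

text \<open>Monomials are exponent vectors \<open>nat \<Rightarrow>\<^sub>0 nat\<close>; a polynomial maps monomials to coefficients.\<close>

type_synonym real_mpoly = "(nat \<Rightarrow>\<^sub>0 nat) \<Rightarrow>\<^sub>0 real"

definition mpoly_eval :: "real_mpoly \<Rightarrow> (nat \<Rightarrow> real) \<Rightarrow> real" where
  "mpoly_eval p x = (\<Sum>m\<in>Poly_Mapping.keys p. Poly_Mapping.lookup p m * (\<Prod>i\<in>Poly_Mapping.keys m. x i ^ Poly_Mapping.lookup m i))"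

text \<open>The total degree; the zero polynomial gets degree 0.\<close>

definition mpoly_degree :: "real_mpoly \<Rightarrow> nat" where
  "mpoly_degree p = Max (insert 0 ((\<lambda>m. \<Sum>i\<in>Poly_Mapping.keys m. Poly_Mapping.lookup m i) ` Poly_Mapping.keys p))"

text \<open>A polynomial in \<open>x\<^sub>1, \<dots>, x\<^sub>n\<close> of degree at most one in each variable separately.\<close>

definition tetrahedral :: "nat \<Rightarrow> real_mpoly \<Rightarrow> bool" where
  "tetrahedral n p \<longleftrightarrow> (\<forall>m\<in>Poly_Mapping.keys p. Poly_Mapping.keys m \<subseteq> {1..n} \<and> (\<forall>i. Poly_Mapping.lookup m i \<le> 1))"

definition partial_deriv :: "nat \<Rightarrow> ((nat \<Rightarrow> real) \<Rightarrow> real) \<Rightarrow> (nat \<Rightarrow> real) \<Rightarrow> real" where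
  "partial_deriv i F x = deriv (\<lambda>s. F (x(i := s))) (x i)"

text \<open>
  A \<open>k\<close>-indexed matrix is a function on multi-indices \<open>\<iota> \<in> {1..k} \<rightarrow>\<^sub>E {1..n}\<close>. The entry of \<open>\<nabla>\<^sup>k F\<close> at \<open>\<iota>\<close>
  is \<open>\<partial>\<^sup>k F / \<partial>x\<^bsub>\<iota> 1\<^esub> \<dots> \<partial>x\<^bsub>\<iota> k\<^esub>\<close>.
\<close>

definition nabla :: "nat \<Rightarrow> ((nat \<Rightarrow> real) \<Rightarrow> real) \<Rightarrow> (nat \<Rightarrow> real) \<Rightarrow> (nat \<Rightarrow> nat) \<Rightarrow> real" where
  "nabla k F x \<iota> = foldr (\<lambda>j. partial_deriv (\<iota> j)) [1..<Suc k] F x"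

subsection \<open>Norms indexed by partitions\<close>

definition partitions :: "nat \<Rightarrow> nat set set set" where
  "partitions k = {\<I>. partition_on {1..k} \<I>}"

text \<open>
  The arrays are indexed by the blocks themselves: \<open>x I\<close> is the array on \<open>[n]\<^sup>I = I \<rightarrow>\<^sub>E {1..n}\<close>.
\<close>

definition partition_norm ::
  "nat \<Rightarrow> nat \<Rightarrow> nat set set \<Rightarrow> ((nat \<Rightarrow> nat) \<Rightarrow> real) \<Rightarrow> real" where
  "partition_norm n k \<I> A =
     (SUP x \<in> {x :: nat set \<Rightarrow> (nat \<Rightarrow> nat) \<Rightarrow> real. \<forall>I\<in>\<I>. L2_set (x I) (I \<rightarrow>\<^sub>E {1..n}) \<le> 1}.
        \<Sum>\<iota> \<in> {1..k} \<rightarrow>\<^sub>E {1..n}. A \<iota> * (\<Prod>I\<in>\<I>. x I (restrict \<iota> I)))"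

subsection \<open>The Ising model\<close>

definition cube :: "nat \<Rightarrow> (nat \<Rightarrow> real) set" where
  "cube n = {1..n} \<rightarrow>\<^sub>E {-1, 1}"

definition ising_weight ::
  "nat \<Rightarrow> (nat \<Rightarrow> nat \<Rightarrow> real) \<Rightarrow> (nat \<Rightarrow> real) \<Rightarrow> (nat \<Rightarrow> real) \<Rightarrow> real" where
  "ising_weight n J h \<sigma> =
     exp (1/2 * (\<Sum>i\<in>{1..n}. \<Sum>j\<in>{1..n}. J i j * \<sigma> i * \<sigma> j) - (\<Sum>i\<in>{1..n}. h i * \<sigma> i))"

definition ising_Z :: "nat \<Rightarrow> (nat \<Rightarrow> nat \<Rightarrow> real) \<Rightarrow> (nat \<Rightarrow> real) \<Rightarrow> real" where
  "ising_Z n J h = (\<integral>\<sigma>. ising_weight n J h \<sigma> \<partial>uniform_count_measure (cube n))"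

definition ising ::
  "nat \<Rightarrow> (nat \<Rightarrow> nat \<Rightarrow> real) \<Rightarrow> (nat \<Rightarrow> real) \<Rightarrow> (nat \<Rightarrow> real) measure" where
  "ising n J h = density (uniform_count_measure (cube n))
     (\<lambda>\<sigma>. ennreal (ising_weight n J h \<sigma> / ising_Z n J h))"

definition mean_nabla ::
  "(nat \<Rightarrow> real) measure \<Rightarrow> nat \<Rightarrow> ((nat \<Rightarrow> real) \<Rightarrow> real) \<Rightarrow> (nat \<Rightarrow> nat) \<Rightarrow> real" where
  "mean_nabla M k F \<iota> = (\<integral>\<sigma>. nabla k F \<sigma> \<iota> \<partial>M)"

subsection \<open>Extended real powers and exponentials\<close>

text \<open>
  Division on \<^typ>\<open>ereal\<close> satisfies \<open>ereal t / 0 = \<infinity>\<close> for \<open>t > 0\<close>. The power below is meant for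
  nonnegative base and positive exponent.
\<close>

definition ereal_powr :: "ereal \<Rightarrow> real \<Rightarrow> ereal" where
  "ereal_powr x p = (if x = \<infinity> then \<infinity> else ereal (real_of_ereal x powr p))"

definition ereal_exp :: "ereal \<Rightarrow> ereal" where
  "ereal_exp x = (if x = \<infinity> then \<infinity> else if x = -\<infinity> then 0 else ereal (exp (real_of_ereal x)))"

end

theory Submission
  imports Defs
begin

text \<open>
  Two ingredients are combined. The first is the moment inequality
  \<open>\<parallel>f - \<E>f\<parallel>\<^sub>p \<le> C \<surd>p \<parallel>|\<nabla>f|\<parallel>\<^sub>p\<close> for the Ising measure and \<open>p\<close> a power of two. It follows from a
  logarithmic Sobolev type inequality, proved by Marton's induction: averaging the chain rule of the
  entropy over the site that is revealed first leaves the one-site marginals, which are controlled by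
  the total covariance of the spins with the density, and this covariance contracts along the Glauber
  dynamics under the Dobrushin condition.

  The second replaces Latala's estimate for Gaussian chaoses. The Euclidean norm \<open>|\<nabla>f|\<close> is dominated by
  moments of a random directional derivative \<open>\<Sum>\<theta>\<^sub>i \<partial>\<^sub>i f\<close>, which is a polynomial of smaller degree, so that
  one can iterate. The random direction contracts the tensors \<open>\<E>\<nabla>\<^sup>k f\<close>, and the partition norms of the
  contracted tensors are bounded by a variational (PAC-Bayes) argument instead of chaining: the test
  arrays \<open>x\<close> in the supremum are replaced by random arrays of mean \<open>x\<close>, which changes nothing on average
  because the form is multilinear, costs relative entropy of order \<open>p\<close>, and produces exactly the norms
  of the coarser partitions as variances. All random directions are averages of \<open>p\<close> signs, so that
  only finite sums occur.
\<close>

subsection \<open>Conditional expectations on the cube\<close>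

text \<open>The two ingredients fit together because their powers of \<open>p\<close> cancel: the
  moment inequality costs \<open>sqrt p\<close> for each degree, while an average of
  \<open>p\<close> fair signs has size \<open>1 / sqrt p\<close>, so each contraction gives the
  factor back. The induction therefore carries the hypothesis
  \<open>sqrt p ^ card I * norm \<le> B\<close>, which is the exponent of the tail bound solved for
  the norm. Exponents are dyadic since every comparison is made by squaring: Jensen and the change
  of measure rest on Cauchy-Schwarz, and the entropy inequality is used only to pass from exponent
  \<open>q\<close> to \<open>2 * q\<close>. The obstacle in the second ingredient is that a supremum
  over arrays must be dominated by one random variable that does not depend on the array. This is
  achieved by subtracting from the linear form its own log-Laplace bound, so that for each fixed
  array the exponential has mean at most 1 over the random direction. The external field enters only
  through \<gamma> = tanh (1 + \<alpha>) < 1, which keeps the one-site conditional laws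
  nondegenerate.\<close>

lemma finite_cube [simp]: "finite (cube n)"
  unfolding cube_def by (intro finite_PiE) auto

lemma cube_upd: "y \<in> cube n \<Longrightarrow> i \<in> {1..n} \<Longrightarrow> s \<in> {-1, 1} \<Longrightarrow> y(i := s) \<in> cube n"
  unfolding cube_def by (auto simp: PiE_iff extensional_def)

lemma cube_spin: "y \<in> cube n \<Longrightarrow> i \<in> {1..n} \<Longrightarrow> y i = 1 \<or> y i = -1"
  unfolding cube_def by (auto simp: PiE_iff)

text \<open>Half the jump across coordinate \<open>i\<close>: for a function affine in that
  coordinate this is its partial derivative, so the argument never has to leave the cube.\<close>

definition dif :: "nat \<Rightarrow> ((nat \<Rightarrow> real) \<Rightarrow> real) \<Rightarrow> (nat \<Rightarrow> real) \<Rightarrow> real" where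
  "dif i f y = (f (y(i := 1)) - f (y(i := -1))) / 2"

lemma dif_upd [simp]: "dif i f (y(i := s)) = dif i f y"
  by (simp add: dif_def)

lemma dif_sum: "dif i (\<lambda>x. \<Sum>j\<in>A. c j * u j x) y = (\<Sum>j\<in>A. c j * dif i (u j) y)"
  by (simp add: dif_def sum_subtractf[symmetric] sum_divide_distrib algebra_simps diff_divide_distrib)

locale spin_system =
  fixes n :: nat and w :: "(nat \<Rightarrow> real) \<Rightarrow> real"
  assumes w_pos: "\<And>y. y \<in> cube n \<Longrightarrow> w y > 0"
begin

definition cl :: "nat set \<Rightarrow> (nat \<Rightarrow> real) \<Rightarrow> (nat \<Rightarrow> real) set" where
  "cl S y = {x \<in> cube n. \<forall>i. i \<notin> S \<longrightarrow> x i = y i}"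

text \<open>Conditional expectation given the spins outside \<open>S\<close>. Thus
  \<open>cexp {1..n}\<close> is the plain mean and \<open>cexp {i}\<close> the heat-bath update of
  site \<open>i\<close>.\<close>

definition cexp :: "nat set \<Rightarrow> ((nat \<Rightarrow> real) \<Rightarrow> real) \<Rightarrow> (nat \<Rightarrow> real) \<Rightarrow> real" where
  "cexp S g y = (\<Sum>x\<in>cl S y. w x * g x) / (\<Sum>x\<in>cl S y. w x)"

lemma finite_cl [simp]: "finite (cl S y)"
  by (simp add: cl_def)

lemma cl_cube: "x \<in> cl S y \<Longrightarrow> x \<in> cube n"
  by (simp add: cl_def)

lemma cl_refl: "y \<in> cube n \<Longrightarrow> y \<in> cl S y"
  by (simp add: cl_def)

lemma cl_sym: "y \<in> cube n \<Longrightarrow> x \<in> cl S y \<Longrightarrow> y \<in> cl S x"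
  by (simp add: cl_def)

lemma cl_eq: "x \<in> cl S y \<Longrightarrow> cl S x = cl S y"
  by (auto simp add: cl_def)

lemma cl_trans: "T \<subseteq> S \<Longrightarrow> x \<in> cl S y \<Longrightarrow> \<rho> \<in> cl T x \<Longrightarrow> \<rho> \<in> cl S y"
  by (auto simp add: cl_def)

lemma wsum_pos: "y \<in> cube n \<Longrightarrow> (\<Sum>x\<in>cl S y. w x) > 0"
  by (intro sum_pos) (auto intro: w_pos dest: cl_cube cl_refl)

lemma cexp_cong: "(\<And>x. x \<in> cl S y \<Longrightarrow> f x = g x) \<Longrightarrow> cexp S f y = cexp S g y"
  unfolding cexp_def by (simp cong: sum.cong)

lemma cexp_cl: "x \<in> cl S y \<Longrightarrow> cexp S g x = cexp S g y"
  by (simp add: cexp_def cl_eq)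

lemma cexp_const [simp]: "y \<in> cube n \<Longrightarrow> cexp S (\<lambda>_. c) y = c"
  using wsum_pos[of y S] by (simp add: cexp_def sum_distrib_right[symmetric])

lemma cexp_add: "cexp S (\<lambda>x. f x + g x) y = cexp S f y + cexp S g y"
  by (simp add: cexp_def sum.distrib algebra_simps add_divide_distrib)

lemma cexp_cmult: "cexp S (\<lambda>x. c * g x) y = c * cexp S g y"
  by (simp add: cexp_def sum_distrib_left mult.left_commute)

lemma cexp_cmult2: "cexp S (\<lambda>x. g x * c) y = cexp S g y * c"
  using cexp_cmult[of S c g y] by (simp add: mult.commute)

lemma cexp_cdiv: "cexp S (\<lambda>x. g x / c) y = cexp S g y / c"
  using cexp_cmult[of S "1/c" g y] by simp

lemma cexp_minus: "cexp S (\<lambda>x. - g x) y = - cexp S g y"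
  using cexp_cmult[of S "-1" g y] by simp

lemma cexp_diff: "cexp S (\<lambda>x. f x - g x) y = cexp S f y - cexp S g y"
  using cexp_add[of S f "\<lambda>x. - g x" y] by (simp add: cexp_minus)

lemma cexp_zero [simp]: "cexp S (\<lambda>_. 0) y = 0"
  by (simp add: cexp_def)

lemma cexp_sum: "cexp S (\<lambda>x. \<Sum>j\<in>A. u j x) y = (\<Sum>j\<in>A. cexp S (u j) y)"
  by (induction A rule: infinite_finite_induct) (simp_all add: cexp_add)

lemma cexp_mono:
  assumes "y \<in> cube n" "\<And>x. x \<in> cl S y \<Longrightarrow> f x \<le> g x"
  shows "cexp S f y \<le> cexp S g y"
  unfolding cexp_def using assms w_pos wsum_pos[of y S]
  by (intro divide_right_mono sum_mono mult_left_mono) (auto dest: cl_cube intro: less_imp_le)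

lemma cexp_nonneg: "y \<in> cube n \<Longrightarrow> (\<And>x. x \<in> cl S y \<Longrightarrow> 0 \<le> g x) \<Longrightarrow> 0 \<le> cexp S g y"
  using cexp_mono[of y S "\<lambda>_. 0" g] by simp

lemma cexp_abs: "y \<in> cube n \<Longrightarrow> \<bar>cexp S g y\<bar> \<le> cexp S (\<lambda>x. \<bar>g x\<bar>) y"
  using cexp_mono[of y S g "\<lambda>x. \<bar>g x\<bar>"] cexp_mono[of y S "\<lambda>x. - g x" "\<lambda>x. \<bar>g x\<bar>"]
  by (simp add: cexp_minus abs_le_iff)

lemma cexp_eq_0_iff:
  assumes "y \<in> cube n" "\<And>x. x \<in> cl S y \<Longrightarrow> 0 \<le> g x"
  shows "cexp S g y = 0 \<longleftrightarrow> (\<forall>x\<in>cl S y. g x = 0)"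
proof -
  have "cexp S g y = 0 \<longleftrightarrow> (\<Sum>x\<in>cl S y. w x * g x) = 0"
    using wsum_pos[OF assms(1), of S] by (simp add: cexp_def)
  also have "\<dots> \<longleftrightarrow> (\<forall>x\<in>cl S y. w x * g x = 0)"
    using assms by (intro sum_nonneg_eq_0_iff) (auto intro!: mult_nonneg_nonneg less_imp_le[OF w_pos] dest: cl_cube)
  also have "\<dots> \<longleftrightarrow> (\<forall>x\<in>cl S y. g x = 0)"
    using w_pos cl_cube by force
  finally show ?thesis .
qed

lemma cexp_Cauchy_Schwarz:
  assumes "y \<in> cube n"
  shows "(cexp S (\<lambda>x. f x * g x) y)\<^sup>2 \<le> cexp S (\<lambda>x. (f x)\<^sup>2) y * cexp S (\<lambda>x. (g x)\<^sup>2) y"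
proof -
  have *: "(\<Sum>x\<in>cl S y. (sqrt (w x) * f x) * (sqrt (w x) * g x))\<^sup>2 \<le>
     (\<Sum>x\<in>cl S y. (sqrt (w x) * f x)\<^sup>2) * (\<Sum>x\<in>cl S y. (sqrt (w x) * g x)\<^sup>2)"
    by (rule Cauchy_Schwarz_ineq_sum)
  have w: "x \<in> cl S y \<Longrightarrow> sqrt (w x) * sqrt (w x) = w x" for x
    using w_pos[OF cl_cube] by (simp add: less_imp_le)
  have a: "\<And>x. x \<in> cl S y \<Longrightarrow> (sqrt (w x) * f x) * (sqrt (w x) * g x) = w x * (f x * g x)"
    using w by (metis mult.assoc mult.left_commute)
  have b: "\<And>x f. x \<in> cl S y \<Longrightarrow> (sqrt (w x) * f x)\<^sup>2 = w x * (f x)\<^sup>2"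
    using w by (simp add: power2_eq_square algebra_simps)
  have "(\<Sum>x\<in>cl S y. w x * (f x * g x))\<^sup>2 \<le> (\<Sum>x\<in>cl S y. w x * (f x)\<^sup>2) * (\<Sum>x\<in>cl S y. w x * (g x)\<^sup>2)"
    using * by (simp add: a b cong: sum.cong)
  then show ?thesis
    using wsum_pos[OF assms, of S]
    by (simp add: cexp_def power_divide divide_right_mono power2_eq_square)
qed

lemma cexp_square_le: "y \<in> cube n \<Longrightarrow> (cexp S g y)\<^sup>2 \<le> cexp S (\<lambda>x. (g x)\<^sup>2) y"
  using cexp_Cauchy_Schwarz[of y S g "\<lambda>_. 1"] by simp

text \<open>Double counting: the classes of \<open>T\<close> partition each class of
  \<open>S\<close>, and the normalization of \<open>cexp T\<close> is constant on each of
  them.\<close>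

lemma cexp_tower:
  assumes "T \<subseteq> S"
  shows "cexp S (cexp T g) y = cexp S g y"
proof -
  let ?C = "cl S y" and ?Z = "\<lambda>x. \<Sum>\<rho>\<in>cl T x. w \<rho>"
  have sub: "x \<in> ?C \<Longrightarrow> cl T x \<subseteq> ?C" for x
    using cl_trans[OF assms] by blast
  have "(\<Sum>x\<in>?C. w x * cexp T g x) = (\<Sum>x\<in>?C. \<Sum>\<rho>\<in>cl T x. w x * w \<rho> * g \<rho> / ?Z x)"
    by (simp add: cexp_def sum_distrib_left sum_divide_distrib mult.assoc)
  also have "\<dots> = (\<Sum>x\<in>?C. \<Sum>\<rho>\<in>?C. if \<rho> \<in> cl T x then w x * w \<rho> * g \<rho> / ?Z x else 0)"
    by (intro sum.cong refl sum.mono_neutral_cong_left) (use sub in auto)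
  also have "\<dots> = (\<Sum>\<rho>\<in>?C. \<Sum>x\<in>?C. if \<rho> \<in> cl T x then w x * w \<rho> * g \<rho> / ?Z x else 0)"
    by (rule sum.swap)
  also have "\<dots> = (\<Sum>\<rho>\<in>?C. \<Sum>x\<in>?C. if x \<in> cl T \<rho> then w x * (w \<rho> * g \<rho> / ?Z \<rho>) else 0)"
  proof (intro sum.cong refl)
    fix \<rho> x assume "\<rho> \<in> ?C" "x \<in> ?C"
    then have "\<rho> \<in> cl T x \<longleftrightarrow> x \<in> cl T \<rho>" using cl_sym cl_cube by blast
    moreover have "?Z x = ?Z \<rho>" if "x \<in> cl T \<rho>" using cl_eq[OF that] by simp
    ultimately show "(if \<rho> \<in> cl T x then w x * w \<rho> * g \<rho> / ?Z x else 0) =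
        (if x \<in> cl T \<rho> then w x * (w \<rho> * g \<rho> / ?Z \<rho>) else 0)"
      by (simp add: mult.assoc)
  qed
  also have "\<dots> = (\<Sum>\<rho>\<in>?C. \<Sum>x\<in>cl T \<rho>. w x * (w \<rho> * g \<rho> / ?Z \<rho>))"
    by (intro sum.cong refl sum.mono_neutral_cong_right) (use sub in auto)
  also have "\<dots> = (\<Sum>\<rho>\<in>?C. w \<rho> * g \<rho>)"
  proof (intro sum.cong refl)
    fix \<rho> assume "\<rho> \<in> ?C"
    then have "?Z \<rho> > 0" using wsum_pos cl_cube by blast
    then show "(\<Sum>x\<in>cl T \<rho>. w x * (w \<rho> * g \<rho> / ?Z \<rho>)) = w \<rho> * g \<rho>"
      by (subst sum_distrib_right[symmetric]) simp
  qed
  finally show ?thesis by (simp add: cexp_def)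
qed

lemma cexp_pull:
  assumes "\<And>x. x \<in> cl S y \<Longrightarrow> u x = u y"
  shows "cexp S (\<lambda>x. u x * g x) y = u y * cexp S g y"
  using cexp_cong[of S y "\<lambda>x. u x * g x" "\<lambda>x. u y * g x"] assms by (simp add: cexp_cmult)

text \<open>A spin takes two values, so this conditional mean determines its whole law given the
  other spins.\<close>

definition bm :: "nat \<Rightarrow> (nat \<Rightarrow> real) \<Rightarrow> real" where
  "bm i = cexp {i} (\<lambda>x. x i)"

lemma cl_single:
  assumes "y \<in> cube n" "i \<in> {1..n}"
  shows "cl {i} y = {y(i := 1), y(i := -1)}"
proof -
  have "x \<in> {y(i := 1), y(i := -1)}" if "x \<in> cl {i} y" for x
  proof -
    have "x i = 1 \<or> x i = -1" using that cube_spin assms(2) by (auto simp: cl_def)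
    moreover have "x = y(i := x i)" using that by (auto simp: cl_def)
    ultimately show ?thesis by (metis insertCI)
  qed
  moreover have "y(i := 1) \<in> cl {i} y" "y(i := -1) \<in> cl {i} y"
    using cube_upd assms by (auto simp: cl_def)
  ultimately show ?thesis by blast
qed

lemma cl_upd: "y \<in> cube n \<Longrightarrow> i \<in> {1..n} \<Longrightarrow> s \<in> {-1,1} \<Longrightarrow> y(i := s) \<in> cl {i} y"
  by (auto simp: cl_single)

lemma cexp_single:
  assumes "y \<in> cube n" "i \<in> {1..n}"
  shows "cexp {i} g y = (g (y(i := 1)) + g (y(i := -1))) / 2 + bm i y * dif i g y"
proof -
  let ?p = "y(i := 1)" and ?m = "y(i := -1)"
  have ne: "?p \<noteq> ?m" by (metis fun_upd_same one_neq_neg_one)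
  have pos: "w ?p + w ?m > 0"
    using w_pos cube_upd[OF assms] by (simp add: add_pos_pos)
  have e: "cexp {i} h y = (w ?p * h ?p + w ?m * h ?m) / (w ?p + w ?m)" for h
    using ne by (simp add: cexp_def cl_single[OF assms])
  have b: "bm i y = (w ?p - w ?m) / (w ?p + w ?m)"
    unfolding bm_def by (subst e) simp
  show ?thesis
    unfolding e b dif_def using pos by (simp add: field_simps)
qed

text \<open>On two points every function is affine in the spin, so a covariance is the spin variance
  \<open>1 - bm^2\<close> times the two slopes.\<close>

lemma dif_mult_bm:
  assumes "y \<in> cube n" "i \<in> {1..n}"
  shows "cexp {i} (\<lambda>x. (u x - cexp {i} u x) * g x) y = (1 - (bm i y)\<^sup>2) * dif i u y * dif i g y"
proof -
  have c: "cexp {i} u (y(i := s)) = cexp {i} u y" if "s \<in> {-1,1}" for s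
    using cexp_cl[OF cl_upd[OF assms that]] .
  show ?thesis
    unfolding cexp_single[OF assms, of "\<lambda>x. (u x - cexp {i} u x) * g x"]
    by (simp add: c dif_def) (simp add: cexp_single[OF assms] dif_def field_simps power2_eq_square)
qed

end

subsection \<open>Transport of covariances under the Dobrushin condition\<close>

text \<open>Splitting each coefficient as \<open>sqrt c * sqrt c\<close> and applying Cauchy-Schwarz
  column by column uses one bound on the column sums and one on the row sums.\<close>

lemma Schur_test_L2:
  fixes c :: "nat \<Rightarrow> nat \<Rightarrow> real"
  assumes "finite S" "\<And>i j. i \<in> S \<Longrightarrow> j \<in> S \<Longrightarrow> 0 \<le> c i j"
    "\<And>i. i \<in> S \<Longrightarrow> (\<Sum>j\<in>S. c i j) \<le> K" "\<And>j. j \<in> S \<Longrightarrow> (\<Sum>i\<in>S. c i j) \<le> K"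
    "0 \<le> K"
  shows "L2_set (\<lambda>j. \<Sum>i\<in>S. c i j * a i) S \<le> K * L2_set a S"
proof -
  have 1: "(\<Sum>i\<in>S. c i j * a i)\<^sup>2 \<le> K * (\<Sum>i\<in>S. c i j * (a i)\<^sup>2)" if "j \<in> S" for j
  proof -
    have "(\<Sum>i\<in>S. c i j * a i)\<^sup>2 = (\<Sum>i\<in>S. sqrt (c i j) * (sqrt (c i j) * a i))\<^sup>2"
      using assms(2) that by (intro arg_cong[where f = "\<lambda>x. x\<^sup>2"] sum.cong refl) (simp flip: mult.assoc)
    also have "\<dots> \<le> (\<Sum>i\<in>S. (sqrt (c i j))\<^sup>2) * (\<Sum>i\<in>S. (sqrt (c i j) * a i)\<^sup>2)"
      by (rule Cauchy_Schwarz_ineq_sum)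
    also have "\<dots> = (\<Sum>i\<in>S. c i j) * (\<Sum>i\<in>S. c i j * (a i)\<^sup>2)"
      using assms(2) that by (simp add: power_mult_distrib cong: sum.cong)
    also have "\<dots> \<le> K * (\<Sum>i\<in>S. c i j * (a i)\<^sup>2)"
      using assms that by (intro mult_right_mono sum_nonneg mult_nonneg_nonneg) auto
    finally show ?thesis .
  qed
  have "(\<Sum>j\<in>S. (\<Sum>i\<in>S. c i j * a i)\<^sup>2) \<le> (\<Sum>j\<in>S. K * (\<Sum>i\<in>S. c i j * (a i)\<^sup>2))"
    by (intro sum_mono 1)
  also have "\<dots> = K * (\<Sum>i\<in>S. (\<Sum>j\<in>S. c i j) * (a i)\<^sup>2)"
    by (subst sum_distrib_left[symmetric], subst sum.swap) (simp add: sum_distrib_right)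
  also have "\<dots> \<le> K * (\<Sum>i\<in>S. K * (a i)\<^sup>2)"
    using assms by (intro mult_left_mono sum_mono mult_right_mono) auto
  also have "\<dots> = K\<^sup>2 * (\<Sum>i\<in>S. (a i)\<^sup>2)"
    by (simp add: sum_distrib_left power2_eq_square mult.assoc)
  finally have "sqrt (\<Sum>j\<in>S. (\<Sum>i\<in>S. c i j * a i)\<^sup>2) \<le> sqrt (K\<^sup>2 * (\<Sum>i\<in>S. (a i)\<^sup>2))"
    by (rule real_sqrt_le_mono)
  then show ?thesis using assms(5) by (simp add: L2_set_def real_sqrt_mult)
qed

text \<open>\<open>c i j\<close> bounds the influence of spin \<open>j\<close> on the law of spin
  \<open>i\<close>. Symmetry turns the row condition into the column condition that the Schur test
  also needs.\<close>

locale dobrushin = spin_system +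
  fixes c :: "nat \<Rightarrow> nat \<Rightarrow> real" and \<rho> \<gamma> :: real
  assumes c_nonneg: "\<And>i j. 0 \<le> c i j"
    and c_sym: "\<And>i j. i \<in> {1..n} \<Longrightarrow> j \<in> {1..n} \<Longrightarrow> c i j = c j i"
    and c_row: "\<And>i. i \<in> {1..n} \<Longrightarrow> (\<Sum>j\<in>{1..n}. c i j) \<le> 1 - \<rho>"
    and \<rho>_pos: "0 < \<rho>" and \<rho>_le: "\<rho> \<le> 1" and \<gamma>_less: "\<gamma> < 1" and \<gamma>_nonneg: "0 \<le> \<gamma>"
    and bm_lip: "\<And>y i j. y \<in> cube n \<Longrightarrow> i \<in> {1..n} \<Longrightarrow> j \<in> {1..n} \<Longrightarrow> i \<noteq> j \<Longrightarrow> \<bar>dif j (bm i) y\<bar> \<le> c i j"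
    and bm_bound: "\<And>y i. y \<in> cube n \<Longrightarrow> i \<in> {1..n} \<Longrightarrow> \<bar>bm i y\<bar> \<le> \<gamma>"
begin

text \<open>One-site Fisher information, the discrete form of \<open>g'^2 / g\<close>; its sum over
  sites is the right-hand side of the entropy inequality.\<close>

definition gam :: "nat \<Rightarrow> ((nat \<Rightarrow> real) \<Rightarrow> real) \<Rightarrow> (nat \<Rightarrow> real) \<Rightarrow> real" where
  "gam i g y = (dif i g y)\<^sup>2 / cexp {i} g y"

definition cov :: "nat set \<Rightarrow> ((nat \<Rightarrow> real) \<Rightarrow> real) \<Rightarrow> ((nat \<Rightarrow> real) \<Rightarrow> real) \<Rightarrow> (nat \<Rightarrow> real) \<Rightarrow> real" where
  "cov S u g y = cexp S (\<lambda>x. u x * g x) y - cexp S u y * cexp S g y"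

lemma dif_cexp_same: "y \<in> cube n \<Longrightarrow> j \<in> {1..n} \<Longrightarrow> dif j (cexp {j} u) y = 0"
  by (simp add: dif_def cexp_cl[OF cl_upd])

text \<open>Flipping spin \<open>j\<close> has two effects on the average over spin
  \<open>i\<close>: the averaged values move, which costs a convex combination of slopes in
  direction \<open>j\<close>, and the weights move by \<open>\<beta>\<close>, which multiplies the
  slope in direction \<open>i\<close>.\<close>

lemma dif_cexp_le:
  assumes y: "y \<in> cube n" and i: "i \<in> {1..n}" and j: "j \<in> {1..n}" and "i \<noteq> j"
    and ai: "\<And>x. x \<in> cube n \<Longrightarrow> \<bar>dif i u x\<bar> \<le> ai"
    and aj: "\<And>x. x \<in> cube n \<Longrightarrow> \<bar>dif j u x\<bar> \<le> aj"
  shows "\<bar>dif j (cexp {i} u) y\<bar> \<le> aj + c i j * ai"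
proof -
  let ?p = "y(j := 1)" and ?m = "y(j := -1)"
  have pm: "?p \<in> cube n" "?m \<in> cube n" using cube_upd[OF y j] by auto
  define b where "b = (bm i ?p + bm i ?m) / 2"
  define \<beta> where "\<beta> = dif j (bm i) y"
  have b: "bm i ?p = b + \<beta>" "bm i ?m = b - \<beta>" by (auto simp: b_def \<beta>_def dif_def field_simps)
  have b1: "\<bar>b\<bar> \<le> 1"
  proof -
    have "\<bar>bm i ?p + bm i ?m\<bar> \<le> 2"
      using bm_bound[OF pm(1) i] bm_bound[OF pm(2) i] \<gamma>_less by linarith
    then show ?thesis by (simp add: b_def)
  qed
  have tw: "y(j := s, i := t) = y(i := t, j := s)" for s t
    using \<open>i \<noteq> j\<close> by (simp add: fun_upd_twist)
  define D where "D t = dif j u (y(i := t))" for t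
  have D: "\<bar>D t\<bar> \<le> aj" if "t \<in> {-1,1}" for t
    unfolding D_def by (intro aj cube_upd y i that)
  have eq: "dif j (cexp {i} u) y = (1 + b) / 2 * D 1 + (1 - b) / 2 * D (-1) + \<beta> * ((dif i u ?p + dif i u ?m) / 2)"
    unfolding dif_def[of j "cexp {i} u"] cexp_single[OF pm(1) i] cexp_single[OF pm(2) i] b D_def
    unfolding dif_def tw by (simp add: field_simps)
  have "\<bar>(1 + b) / 2 * D 1\<bar> \<le> (1 + b) / 2 * aj" "\<bar>(1 - b) / 2 * D (-1)\<bar> \<le> (1 - b) / 2 * aj"
    using b1 D[of 1] D[of "-1"] by (auto simp: abs_mult intro!: mult_left_mono)
  moreover have "\<bar>\<beta> * ((dif i u ?p + dif i u ?m) / 2)\<bar> \<le> c i j * ai"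
    unfolding abs_mult
    using bm_lip[OF y i j \<open>i \<noteq> j\<close>] ai[OF pm(1)] ai[OF pm(2)] c_nonneg
    by (intro mult_mono) (auto simp: \<beta>_def)
  moreover have "(1 + b) / 2 * aj + (1 - b) / 2 * aj = aj" by (simp add: field_simps)
  ultimately show ?thesis unfolding eq by linarith
qed

lemma osc_le:
  assumes "finite S" "S \<subseteq> {1..n}" "y \<in> cube n" "x \<in> cl S y"
    and "\<And>i x. i \<in> S \<Longrightarrow> x \<in> cube n \<Longrightarrow> \<bar>dif i u x\<bar> \<le> a i"
  shows "\<bar>u x - u y\<bar> \<le> 2 * (\<Sum>i\<in>S. a i)"
  using assms
proof (induction S arbitrary: x rule: finite_induct)
  case empty
  then have "x = y" by (auto simp: cl_def)
  then show ?case by simp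
next
  case (insert i S)
  have x: "x \<in> cube n" using insert cl_cube by blast
  have i: "i \<in> {1..n}" using insert by auto
  have s: "y i \<in> {-1, 1}" "x i \<in> {-1, 1}" using cube_spin insert x i by blast+
  let ?t = "x(i := y i)"
  have "?t \<in> cl S y" using insert.prems(3) cube_upd[OF x i s(1)] by (auto simp: cl_def)
  then have "\<bar>u ?t - u y\<bar> \<le> 2 * (\<Sum>i\<in>S. a i)"
    using insert by auto
  moreover have "\<bar>u x - u ?t\<bar> \<le> 2 * \<bar>dif i u x\<bar>"
  proof (cases "x i = y i")
    case True
    then have "?t = x" by auto
    then show ?thesis by simp
  next
    case False
    have "u x = u (x(i := x i))" by simp
    then show ?thesis using False s unfolding dif_def by fastforce
  qed
  moreover have "\<bar>dif i u x\<bar> \<le> a i" using insert x by auto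
  ultimately show ?case using insert by simp
qed


lemma gam_nonneg: "(\<And>x. x \<in> cube n \<Longrightarrow> 0 \<le> g x) \<Longrightarrow> y \<in> cube n \<Longrightarrow> 0 \<le> gam i g y"
  unfolding gam_def by (rule divide_nonneg_nonneg[OF zero_le_power2 cexp_nonneg]) (blast dest: cl_cube)+

text \<open>The quotient in \<open>gam\<close> has the default value 0 when its denominator
  vanishes. This is harmless: a nonnegative \<open>g\<close> of conditional mean 0 vanishes at both
  points, so the slope is 0 too.\<close>

lemma abs_dif_eq:
  assumes g: "\<And>x. x \<in> cube n \<Longrightarrow> 0 \<le> g x" and y: "y \<in> cube n" and i: "i \<in> {1..n}"
  shows "\<bar>dif i g y\<bar> = sqrt (cexp {i} g y) * sqrt (gam i g y)"
proof (cases "cexp {i} g y = 0")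
  case True
  then have "g (y(i := 1)) = 0" "g (y(i := -1)) = 0"
    using cexp_eq_0_iff[OF y, of "{i}" g] g cl_cube by (auto simp: cl_single[OF y i])
  then show ?thesis using True by (simp add: dif_def)
next
  case False
  then have "cexp {i} g y * gam i g y = (dif i g y)\<^sup>2" by (simp add: gam_def)
  then show ?thesis by (metis real_sqrt_abs real_sqrt_mult)
qed

text \<open>Subtracting the one-site conditional mean of \<open>u\<close> leaves a one-site
  covariance with \<open>g\<close>, hence a product of slopes; \<open>abs_dif_eq\<close> and
  Cauchy-Schwarz then split off the Fisher information.\<close>

lemma cexp_gradient_le:
  assumes S: "S \<subseteq> {1..n}" "i \<in> S" and y: "y \<in> cube n"
    and g: "\<And>x. x \<in> cube n \<Longrightarrow> 0 \<le> g x"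
    and a: "\<And>x. x \<in> cube n \<Longrightarrow> \<bar>dif i u x\<bar> \<le> ai"
  shows "\<bar>cexp S (\<lambda>x. (u x - cexp {i} u x) * g x) y\<bar> \<le> ai * (sqrt (cexp S g y) * sqrt (cexp S (gam i g) y))"
proof -
  have i: "i \<in> {1..n}" "{i} \<subseteq> S" using S by auto
  have "cexp S (\<lambda>x. (u x - cexp {i} u x) * g x) y = cexp S (cexp {i} (\<lambda>x. (u x - cexp {i} u x) * g x)) y"
    by (rule cexp_tower[OF i(2), symmetric])
  also have "\<dots> = cexp S (\<lambda>x. (1 - (bm i x)\<^sup>2) * dif i u x * dif i g x) y"
    by (intro cexp_cong dif_mult_bm i(1)) (auto dest: cl_cube)
  finally have "\<bar>cexp S (\<lambda>x. (u x - cexp {i} u x) * g x) y\<bar> \<le> cexp S (\<lambda>x. \<bar>(1 - (bm i x)\<^sup>2) * dif i u x * dif i g x\<bar>) y"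
    using cexp_abs[OF y, of S "\<lambda>x. (1 - (bm i x)\<^sup>2) * dif i u x * dif i g x"] by simp
  also have "\<dots> \<le> cexp S (\<lambda>x. ai * \<bar>dif i g x\<bar>) y"
  proof (rule cexp_mono[OF y])
    fix x assume "x \<in> cl S y"
    then have x: "x \<in> cube n" by (rule cl_cube)
    have "\<bar>bm i x\<bar> \<le> 1" using bm_bound[OF x i(1)] \<gamma>_less by linarith
    then have "(bm i x)\<^sup>2 \<le> 1" by (simp add: abs_square_le_1)
    then have "\<bar>1 - (bm i x)\<^sup>2\<bar> \<le> 1" by simp
    then have "\<bar>1 - (bm i x)\<^sup>2\<bar> * \<bar>dif i u x\<bar> \<le> 1 * ai"
      using a[OF x] by (intro mult_mono) auto
    then show "\<bar>(1 - (bm i x)\<^sup>2) * dif i u x * dif i g x\<bar> \<le> ai * \<bar>dif i g x\<bar>"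
      by (simp add: abs_mult mult_right_mono)
  qed
  also have "\<dots> = ai * cexp S (\<lambda>x. \<bar>dif i g x\<bar>) y" by (rule cexp_cmult)
  also have "cexp S (\<lambda>x. \<bar>dif i g x\<bar>) y \<le> sqrt (cexp S g y * cexp S (gam i g) y)"
  proof (rule real_le_rsqrt)
    have "cexp S (\<lambda>x. \<bar>dif i g x\<bar>) y = cexp S (\<lambda>x. sqrt (cexp {i} g x) * sqrt (gam i g x)) y"
      by (intro cexp_cong abs_dif_eq g i(1)) (auto dest: cl_cube)
    then have "(cexp S (\<lambda>x. \<bar>dif i g x\<bar>) y)\<^sup>2 = (cexp S (\<lambda>x. sqrt (cexp {i} g x) * sqrt (gam i g x)) y)\<^sup>2"
      by simp
    also have "\<dots> \<le> cexp S (\<lambda>x. (sqrt (cexp {i} g x))\<^sup>2) y * cexp S (\<lambda>x. (sqrt (gam i g x))\<^sup>2) y"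
      by (rule cexp_Cauchy_Schwarz[OF y])
    also have "cexp S (\<lambda>x. (sqrt (cexp {i} g x))\<^sup>2) y = cexp S (cexp {i} g) y"
    proof (rule cexp_cong)
      fix x assume "x \<in> cl S y"
      then have "x \<in> cube n" by (rule cl_cube)
      then have "0 \<le> cexp {i} g x" by (rule cexp_nonneg) (rule g, erule cl_cube)
      then show "(sqrt (cexp {i} g x))\<^sup>2 = cexp {i} g x" by simp
    qed
    also have "cexp S (\<lambda>x. (sqrt (gam i g x))\<^sup>2) y = cexp S (gam i g) y"
    proof (rule cexp_cong)
      fix x assume "x \<in> cl S y"
      then have "0 \<le> gam i g x" using gam_nonneg[of g x i] g cl_cube by simp
      then show "(sqrt (gam i g x))\<^sup>2 = gam i g x" by simp
    qed
    finally show "(cexp S (\<lambda>x. \<bar>dif i g x\<bar>) y)\<^sup>2 \<le> cexp S g y * cexp S (gam i g) y"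
      by (simp add: cexp_tower[OF i(2)])
  qed
  finally show ?thesis
    using a[OF y] by (simp add: real_sqrt_mult mult_left_mono)
qed

text \<open>One step of the Glauber dynamics: a uniformly chosen site of \<open>S\<close> is
  resampled.\<close>

definition avg :: "nat set \<Rightarrow> ((nat \<Rightarrow> real) \<Rightarrow> real) \<Rightarrow> (nat \<Rightarrow> real) \<Rightarrow> real" where
  "avg S u x = (\<Sum>i\<in>S. cexp {i} u x) / real (card S)"

lemma dif_avg_le:
  assumes S: "finite S" "S \<subseteq> {1..n}" "j \<in> S" and y: "y \<in> cube n"
    and a: "\<And>i x. i \<in> S \<Longrightarrow> x \<in> cube n \<Longrightarrow> \<bar>dif i u x\<bar> \<le> a i"
  shows "\<bar>dif j (avg S u) y\<bar> \<le> (1 - 1 / real (card S)) * a j + (\<Sum>i\<in>S. c i j * a i) / real (card S)"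
proof -
  have m: "card S \<ge> 1" using S by (simp add: Suc_le_eq card_gt_0_iff) blast
  have a0: "0 \<le> a i" if "i \<in> S" for i using a[OF that y] by linarith
  have "dif j (avg S u) y = (\<Sum>i\<in>S. dif j (cexp {i} u) y) / real (card S)"
    unfolding avg_def dif_def by (simp add: sum_subtractf sum_divide_distrib[symmetric] diff_divide_distrib)
  also have "\<bar>\<dots>\<bar> \<le> (\<Sum>i\<in>S. \<bar>dif j (cexp {i} u) y\<bar>) / real (card S)"
    by (simp add: divide_right_mono)
  also have "(\<Sum>i\<in>S. \<bar>dif j (cexp {i} u) y\<bar>) \<le> (\<Sum>i\<in>S. (if i = j then 0 else a j) + c i j * a i)"
  proof (rule sum_mono)
    fix i assume i: "i \<in> S"
    show "\<bar>dif j (cexp {i} u) y\<bar> \<le> (if i = j then 0 else a j) + c i j * a i"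
    proof (cases "i = j")
      case True
      then show ?thesis using S y c_nonneg[of i j] a0[OF i] dif_cexp_same[of y j u] by auto
    next
      case False
      have "i \<in> {1..n}" "j \<in> {1..n}" using S i by blast+
      then show ?thesis using dif_cexp_le[OF y _ _ False, of u "a i" "a j"] S(3) i a False by simp
    qed
  qed
  also have "\<dots> = (real (card S) - 1) * a j + (\<Sum>i\<in>S. c i j * a i)"
  proof -
    have "(\<Sum>i\<in>S. if i = j then 0 else a j) = (\<Sum>i\<in>S - {j}. a j)"
      by (rule sum.mono_neutral_cong_right) (use S in auto)
    also have "\<dots> = (real (card S) - 1) * a j"
      using S m by (simp add: card_Diff_singleton of_nat_diff)
    finally show ?thesis by (simp add: sum.distrib)
  qed
  finally have "\<bar>dif j (avg S u) y\<bar> \<le> ((real (card S) - 1) * a j + (\<Sum>i\<in>S. c i j * a i)) / real (card S)"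
    by (simp add: divide_right_mono)
  also have "\<dots> = (1 - 1 / real (card S)) * a j + (\<Sum>i\<in>S. c i j * a i) / real (card S)"
    using m by (simp add: add_divide_distrib diff_divide_distrib left_diff_distrib)
  finally show ?thesis .
qed

end

section \<open>Covariance bounds from the contraction of the Glauber dynamics\<close>

context dobrushin
begin

text \<open>The slope bounds evolve under the matrix \<open>(1 - 1/m) * id + c/m\<close> with
  \<open>m = card S\<close>; the Schur test gives \<open>c\<close> norm at most
  \<open>1 - \<rho>\<close>, which leaves a gain of \<open>\<rho> / m\<close> per step.\<close>

lemma L2_avg_le:
  assumes S: "finite S" "S \<subseteq> {1..n}" "S \<noteq> {}" and a: "\<And>i. i \<in> S \<Longrightarrow> 0 \<le> a i"
  shows "L2_set (\<lambda>j. (1 - 1 / real (card S)) * a j + (\<Sum>i\<in>S. c i j * a i) / real (card S)) S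
    \<le> (1 - \<rho> / real (card S)) * L2_set a S"
proof -
  have m: "real (card S) \<ge> 1" using S by (simp add: Suc_le_eq card_gt_0_iff)
  have row: "(\<Sum>j\<in>S. c i j) \<le> 1 - \<rho>" if "i \<in> S" for i
    using sum_mono2[OF _ S(2), of "c i"] c_nonneg c_row[of i] S that by fastforce
  have col: "(\<Sum>i\<in>S. c i j) \<le> 1 - \<rho>" if "j \<in> S" for j
  proof -
    have "(\<Sum>i\<in>S. c i j) = (\<Sum>i\<in>S. c j i)" by (intro sum.cong refl c_sym) (use S that in auto)
    then show ?thesis using row[OF that] by simp
  qed
  have "L2_set (\<lambda>j. (1 - 1 / real (card S)) * a j + (1 / real (card S)) * (\<Sum>i\<in>S. c i j * a i)) S
    \<le> L2_set (\<lambda>j. (1 - 1 / real (card S)) * a j) S + L2_set (\<lambda>j. (1 / real (card S)) * (\<Sum>i\<in>S. c i j * a i)) S"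
    by (rule L2_set_triangle_ineq)
  also have "\<dots> = (1 - 1 / real (card S)) * L2_set a S + (1 / real (card S)) * L2_set (\<lambda>j. \<Sum>i\<in>S. c i j * a i) S"
    using m by (subst (1 2) L2_set_right_distrib) auto
  also have "\<dots> \<le> (1 - 1 / real (card S)) * L2_set a S + (1 / real (card S)) * ((1 - \<rho>) * L2_set a S)"
    using S row col c_nonneg \<rho>_le by (intro add_left_mono mult_left_mono Schur_test_L2) auto
  also have "\<dots> = (1 - \<rho> / real (card S)) * L2_set a S"
    using m by (simp add: field_simps)
  finally show ?thesis by simp
qed

text \<open>The covariance is telescoped along the dynamics. A single step changes it by an amount
  of order \<open>1/m\<close>, and the slopes contract by \<open>1 - \<rho> / m\<close>, so the
  geometric series sums to a bound with \<open>1 / \<rho>\<close> and no power of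
  \<open>m\<close>.\<close>

lemma cov_le:
  assumes S: "finite S" "S \<subseteq> {1..n}" "S \<noteq> {}" and y: "y \<in> cube n"
    and g: "\<And>x. x \<in> cube n \<Longrightarrow> 0 \<le> g x"
    and a: "\<And>i x. i \<in> S \<Longrightarrow> x \<in> cube n \<Longrightarrow> \<bar>dif i u x\<bar> \<le> a i"
  shows "\<bar>cov S u g y\<bar> \<le> sqrt (cexp S g y) * sqrt (\<Sum>i\<in>S. cexp S (gam i g) y) / \<rho> * L2_set a S"
proof -
  define m where "m = real (card S)"
  have m: "m \<ge> 1" using S by (simp add: m_def Suc_le_eq card_gt_0_iff)
  define G where "G = cexp S g y"
  define e where "e i = sqrt (cexp S (gam i g) y)" for i
  have g0: "0 \<le> cexp S (gam i g) y" for i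
    using gam_nonneg[of g _ i] g cl_cube by (intro cexp_nonneg y) auto
  have G0: "0 \<le> G" unfolding G_def using g cl_cube by (intro cexp_nonneg y) auto
  have e: "L2_set e S = sqrt (\<Sum>i\<in>S. cexp S (gam i g) y)"
    unfolding L2_set_def e_def using g0 by simp
  define q where "q = 1 - \<rho> / m"
  have q: "0 \<le> q" "q < 1" using m \<rho>_pos \<rho>_le by (auto simp: q_def field_simps)
  \<comment> \<open>\<open>L\<close> is the fixed point of the recursion, \<open>L * (1 - q)\<close>
    being the increment of one step. \<open>L0\<close> only has to bound the covariance crudely,
    since its weight \<open>q ^ N\<close> tends to 0.\<close>
  define L where "L = sqrt G * L2_set e S / \<rho>"
  define L0 where "L0 = 4 * G * sqrt m"
  have iter: "\<bar>cov S u g y\<bar> \<le> (L + q ^ N * L0) * L2_set a S"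
    if "\<And>i x. i \<in> S \<Longrightarrow> x \<in> cube n \<Longrightarrow> \<bar>dif i u x\<bar> \<le> a i" for N u a
    using that
  proof (induction N arbitrary: u a)
    case (0 u a)
    have a0: "0 \<le> a i" if "i \<in> S" for i using 0[OF that y] by linarith
    have osc: "\<bar>u x - u y\<bar> \<le> 2 * (\<Sum>i\<in>S. a i)" if "x \<in> cl S y" for x
      using osc_le[OF S(1,2) y that] 0 by blast
    have "cov S u g y = cexp S (\<lambda>x. (u x - u y) * g x) y - cexp S (\<lambda>x. u x - u y) y * G"
      unfolding cov_def G_def by (simp add: left_diff_distrib cexp_diff cexp_cmult y)
    moreover have "\<bar>cexp S (\<lambda>x. (u x - u y) * g x) y\<bar> \<le> 2 * (\<Sum>i\<in>S. a i) * G"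
    proof -
      have "\<bar>cexp S (\<lambda>x. (u x - u y) * g x) y\<bar> \<le> cexp S (\<lambda>x. \<bar>(u x - u y) * g x\<bar>) y"
        by (rule cexp_abs[OF y])
      also have "\<dots> \<le> cexp S (\<lambda>x. 2 * (\<Sum>i\<in>S. a i) * g x) y"
        using osc g cl_cube by (intro cexp_mono[OF y]) (auto simp: abs_mult intro!: mult_right_mono)
      finally show ?thesis by (simp add: cexp_cmult G_def)
    qed
    moreover have "\<bar>cexp S (\<lambda>x. u x - u y) y * G\<bar> \<le> 2 * (\<Sum>i\<in>S. a i) * G"
    proof -
      have "\<bar>cexp S (\<lambda>x. u x - u y) y\<bar> \<le> cexp S (\<lambda>x. \<bar>u x - u y\<bar>) y"
        by (rule cexp_abs[OF y])
      also have "\<dots> \<le> cexp S (\<lambda>x. 2 * (\<Sum>i\<in>S. a i)) y"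
        using osc by (intro cexp_mono[OF y]) auto
      finally show ?thesis using G0 y by (simp add: abs_mult mult_right_mono)
    qed
    ultimately have "\<bar>cov S u g y\<bar> \<le> 4 * G * (\<Sum>i\<in>S. a i)" by (simp add: algebra_simps)
    also have "(\<Sum>i\<in>S. a i) \<le> sqrt m * L2_set a S"
      using L2_set_mult_ineq[of "\<lambda>_. 1" a S] a0 by (simp add: L2_set_def m_def)
    finally have "\<bar>cov S u g y\<bar> \<le> 4 * G * (sqrt m * L2_set a S)" using G0 by (simp add: mult_left_mono)
    also have "\<dots> \<le> (L + L0) * L2_set a S"
      using G0 \<rho>_pos by (simp add: L0_def L_def algebra_simps)
    finally show ?case by simp
  next
    case (Suc N u a)
    define a' where "a' j = (1 - 1 / real (card S)) * a j + (\<Sum>i\<in>S. c i j * a i) / real (card S)" for j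
    have a0: "0 \<le> a i" if "i \<in> S" for i using Suc.prems[OF that y] by linarith
    have IH: "\<bar>cov S (avg S u) g y\<bar> \<le> (L + q ^ N * L0) * L2_set a' S"
      by (rule Suc.IH, unfold a'_def, rule dif_avg_le) (use S Suc.prems in auto)
    also have "\<dots> \<le> (L + q ^ N * L0) * (q * L2_set a S)"
      unfolding a'_def q_def m_def using L2_avg_le[OF S a0] G0 \<rho>_pos q m
      by (intro mult_left_mono) (auto simp: L_def L0_def q_def m_def)
    finally have 1: "\<bar>cov S (avg S u) g y\<bar> \<le> (L + q ^ N * L0) * (q * L2_set a S)" .
    have tow: "cexp S (avg S u) y = cexp S u y"
    proof -
      have "cexp S (avg S u) y = (\<Sum>i\<in>S. cexp S (cexp {i} u) y) / m"
        unfolding avg_def m_def by (simp add: cexp_cdiv cexp_sum)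
      also have "\<dots> = (\<Sum>i\<in>S. cexp S u y) / m"
        by (intro arg_cong[where f = "\<lambda>x. x / m"] sum.cong refl cexp_tower) auto
      also have "\<dots> = cexp S u y" using m by (simp add: m_def)
      finally show ?thesis .
    qed
    have "cov S u g y - cov S (avg S u) g y = cexp S (\<lambda>x. (u x - avg S u x) * g x) y"
      unfolding cov_def tow by (simp add: left_diff_distrib cexp_diff)
    also have "(\<lambda>x. (u x - avg S u x) * g x) = (\<lambda>x. (\<Sum>i\<in>S. (u x - cexp {i} u x) * g x) / m)"
    proof
      fix x
      have "(\<Sum>i\<in>S. (u x - cexp {i} u x) * g x) = (m * u x - (\<Sum>i\<in>S. cexp {i} u x)) * g x"
        by (simp add: sum_distrib_right[symmetric] sum_subtractf m_def)
      then show "(u x - avg S u x) * g x = (\<Sum>i\<in>S. (u x - cexp {i} u x) * g x) / m"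
        using m by (simp add: avg_def m_def[symmetric] field_simps)
    qed
    also have "cexp S (\<lambda>x. (\<Sum>i\<in>S. (u x - cexp {i} u x) * g x) / m) y = (\<Sum>i\<in>S. cexp S (\<lambda>x. (u x - cexp {i} u x) * g x) y) / m"
      by (simp add: cexp_cdiv cexp_sum)
    finally have "\<bar>cov S u g y - cov S (avg S u) g y\<bar> \<le> (\<Sum>i\<in>S. \<bar>cexp S (\<lambda>x. (u x - cexp {i} u x) * g x) y\<bar>) / m"
      using m by (simp add: divide_right_mono)
    also have "\<dots> \<le> (\<Sum>i\<in>S. a i * (sqrt G * e i)) / m"
      using m unfolding G_def e_def
      by (intro divide_right_mono sum_mono cexp_gradient_le S y g Suc.prems) auto
    also have "(\<Sum>i\<in>S. a i * (sqrt G * e i)) = sqrt G * (\<Sum>i\<in>S. \<bar>a i\<bar> * \<bar>e i\<bar>)"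
      using a0 g0 by (simp add: sum_distrib_left e_def mult.left_commute)
    also have "\<dots> / m \<le> sqrt G * (L2_set a S * L2_set e S) / m"
      using m G0 by (intro divide_right_mono mult_left_mono L2_set_mult_ineq) auto
    also have "\<dots> = L * (1 - q) * L2_set a S"
      using m \<rho>_pos by (simp add: L_def q_def)
    finally have "\<bar>cov S u g y\<bar> \<le> L * (1 - q) * L2_set a S + (L + q ^ N * L0) * (q * L2_set a S)"
      using 1 by linarith
    also have "\<dots> = (L + q ^ Suc N * L0) * L2_set a S" by (simp add: algebra_simps)
    finally show ?case .
  qed
  have "(\<lambda>N. (L + q ^ N * L0) * L2_set a S) \<longlonglongrightarrow> (L + 0 * L0) * L2_set a S"
    using q by (intro tendsto_intros LIMSEQ_realpow_zero) auto
  then have "\<bar>cov S u g y\<bar> \<le> (L + 0 * L0) * L2_set a S"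
    by (rule LIMSEQ_le_const) (use iter[of u a] a in auto)
  then show ?thesis by (simp add: L_def G_def e)
qed

text \<open>Duality: \<open>cov_le\<close> is applied to the linear function whose coefficients are
  the covariances themselves. Its covariance with \<open>g\<close> is their sum of squares, and one
  norm cancels.\<close>

lemma sum_cov_le:
  assumes S: "finite S" "S \<subseteq> {1..n}" and y: "y \<in> cube n"
    and g: "\<And>x. x \<in> cube n \<Longrightarrow> 0 \<le> g x"
  shows "(\<Sum>i\<in>S. (cov S (\<lambda>x. x i) g y)\<^sup>2) \<le> cexp S g y * (\<Sum>i\<in>S. cexp S (gam i g) y) / \<rho>\<^sup>2"
proof (cases "S = {}")
  case False
  define k where "k i = cov S (\<lambda>x. x i) g y" for i
  define u where "u x = (\<Sum>i\<in>S. k i * x i)" for x :: "nat \<Rightarrow> real"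
  have du: "dif i u x = k i" if "i \<in> S" for i x
  proof -
    have "dif i u x = (\<Sum>j\<in>S. k j * dif i (\<lambda>x. x j) x)"
      unfolding u_def by (rule dif_sum)
    also have "\<dots> = (\<Sum>j\<in>S. if j = i then k j else 0)"
      by (intro sum.cong refl) (auto simp: dif_def)
    also have "\<dots> = k i" using S that by (simp add: sum.delta)
    finally show ?thesis .
  qed
  have "cov S u g y = (\<Sum>i\<in>S. k i * cov S (\<lambda>x. x i) g y)"
    unfolding cov_def u_def
    by (simp add: sum_distrib_right cexp_sum cexp_cmult mult.assoc right_diff_distrib sum_subtractf)
  then have cu: "cov S u g y = (L2_set k S)\<^sup>2"
    by (simp add: k_def L2_set_def sum_nonneg power2_eq_square)
  define X where "X = sqrt (cexp S g y) * sqrt (\<Sum>i\<in>S. cexp S (gam i g) y) / \<rho>"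
  have g0: "0 \<le> (\<Sum>i\<in>S. cexp S (gam i g) y)"
    using gam_nonneg[of g] g cl_cube by (intro cexp_nonneg sum_nonneg y) auto
  have G0: "0 \<le> cexp S g y" using g cl_cube by (intro cexp_nonneg y) auto
  have "\<bar>cov S u g y\<bar> \<le> X * L2_set (\<lambda>i. \<bar>k i\<bar>) S"
    unfolding X_def by (rule cov_le[OF S False y g]) (auto simp: du)
  also have "L2_set (\<lambda>i. \<bar>k i\<bar>) S = L2_set k S" by (simp add: L2_set_def)
  finally have "L2_set k S * L2_set k S \<le> X * L2_set k S" by (simp add: cu power2_eq_square)
  moreover have "0 \<le> X" using g0 G0 \<rho>_pos by (simp add: X_def)
  ultimately have "L2_set k S \<le> X"
    by (metis L2_set_nonneg le_less mult_le_cancel_right_pos)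
  then have "(L2_set k S)\<^sup>2 \<le> X\<^sup>2" by (intro power_mono) auto
  moreover have "(L2_set k S)\<^sup>2 = (\<Sum>i\<in>S. (k i)\<^sup>2)" by (simp add: L2_set_def sum_nonneg)
  moreover have "X\<^sup>2 = cexp S g y * (\<Sum>i\<in>S. cexp S (gam i g) y) / \<rho>\<^sup>2"
    using g0 G0 by (simp add: X_def power_divide power_mult_distrib)
  ultimately show ?thesis by (simp add: k_def)
qed simp

end

subsection \<open>Entropy tensorization and moment bounds\<close>

text \<open>With \<open>s = sqrt x\<close>, the bound \<open>ln s \<ge> 1 - 1/s\<close> produces the
  square \<open>(s - 1)^2\<close>; the range of \<open>x\<close> serves to bound
  \<open>(s + 1)^2\<close> by 8.\<close>

lemma x_ln_x_ge:
  fixes x :: real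
  assumes "0 < x" "x \<le> 3"
  shows "(x - 1) + (x - 1)\<^sup>2 / 8 \<le> x * ln x"
proof -
  define s where "s = sqrt x"
  have s: "s > 0" "s\<^sup>2 = x" using assms by (auto simp: s_def)
  have "ln (1 / s) \<le> 1 / s - 1" using s by (intro ln_le_minus_one) auto
  then have l: "1 - 1 / s \<le> ln s" using s by (simp add: ln_div)
  have "x * ln x = 2 * s\<^sup>2 * ln s" using s by (simp flip: s(2) add: ln_realpow)
  moreover have "2 * s\<^sup>2 * (1 - 1 / s) \<le> 2 * s\<^sup>2 * ln s" using l by (intro mult_left_mono) auto
  moreover have "2 * s\<^sup>2 * (1 - 1 / s) = (x - 1) + (s - 1)\<^sup>2"
    using s(1) by (simp flip: s(2) add: field_simps power2_eq_square)
  moreover have "(x - 1)\<^sup>2 / 8 \<le> (s - 1)\<^sup>2"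
  proof -
    have "(x - 1)\<^sup>2 = (s + 1)\<^sup>2 * (s - 1)\<^sup>2"
      by (simp flip: s(2) add: power2_eq_square algebra_simps)
    also have "\<dots> \<le> 8 * (s - 1)\<^sup>2"
    proof (rule mult_right_mono)
      have "0 \<le> (s - 1)\<^sup>2" by simp
      also have "(s - 1)\<^sup>2 = x + 1 - 2 * s" by (simp flip: s(2) add: power2_eq_square algebra_simps)
      finally have "2 * s \<le> x + 1" by simp
      moreover have "(s + 1)\<^sup>2 = x + 1 + 2 * s" by (simp flip: s(2) add: power2_eq_square algebra_simps)
      ultimately show "(s + 1)\<^sup>2 \<le> 8" using assms(2) by linarith
    qed simp
    finally show ?thesis by simp
  qed
  ultimately show ?thesis by linarith
qed

lemma abs_power_diff_le:
  fixes a b :: real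
  assumes "\<bar>a\<bar> \<le> h" "\<bar>b\<bar> \<le> h"
  shows "\<bar>a ^ p - b ^ p\<bar> \<le> real p * h ^ (p - 1) * \<bar>a - b\<bar>"
proof -
  have "\<bar>\<Sum>i<p. b ^ (p - Suc i) * a ^ i\<bar> \<le> (\<Sum>i<p. h ^ (p - 1))"
  proof (rule order.trans[OF sum_abs sum_mono])
    fix i assume i: "i \<in> {..<p}"
    have "\<bar>b ^ (p - Suc i) * a ^ i\<bar> \<le> h ^ (p - Suc i) * h ^ i"
      unfolding abs_mult power_abs using assms by (intro mult_mono power_mono) (auto intro: order.trans[OF abs_ge_zero])
    also have "\<dots> = h ^ (p - 1)" using i by (simp flip: power_add)
    finally show "\<bar>b ^ (p - Suc i) * a ^ i\<bar> \<le> h ^ (p - 1)" .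
  qed
  then have "\<bar>a - b\<bar> * \<bar>\<Sum>i<p. b ^ (p - Suc i) * a ^ i\<bar> \<le> \<bar>a - b\<bar> * (real p * h ^ (p - 1))"
    by (intro mult_left_mono) auto
  then show ?thesis by (simp add: power_diff_sumr2 abs_mult mult.commute)
qed

text \<open>Stands in for Hoelder's inequality once both factors are normalized; the price is a
  factor 2.\<close>

lemma mult_power_le_add_powers:
  fixes x y :: real
  assumes "0 \<le> x" "0 \<le> y"
  shows "x * y ^ q \<le> x ^ Suc q + y ^ Suc q"
proof (cases "x \<le> y")
  case True
  then have "x * y ^ q \<le> y * y ^ q" using assms by (intro mult_right_mono) auto
  moreover have "0 \<le> x ^ Suc q" using assms by simp
  ultimately show ?thesis by simp
next
  case False
  then have "x * y ^ q \<le> x * x ^ q" using assms by (intro mult_left_mono power_mono) auto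
  moreover have "0 \<le> y ^ Suc q" using assms by simp
  ultimately show ?thesis by simp
qed

section \<open>Entropy inequality by tensorization\<close>

context dobrushin
begin

definition ent :: "nat set \<Rightarrow> ((nat \<Rightarrow> real) \<Rightarrow> real) \<Rightarrow> (nat \<Rightarrow> real) \<Rightarrow> real" where
  "ent S g y = cexp S (\<lambda>x. g x * ln (g x)) y - cexp S g y * ln (cexp S g y)"

lemma ent_chain:
  assumes "T \<subseteq> S"
  shows "ent S g y = ent S (cexp T g) y + cexp S (ent T g) y"
proof -
  have "cexp S (ent T g) y = cexp S (\<lambda>x. g x * ln (g x)) y - cexp S (\<lambda>x. cexp T g x * ln (cexp T g x)) y"
    unfolding ent_def cexp_diff using cexp_tower[OF assms] by simp
  then show ?thesis by (simp add: ent_def cexp_tower[OF assms])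
qed

text \<open>Entropy is at most chi-square divergence: \<open>ln t \<le> t - 1\<close> at
  \<open>t = M x / m\<close>. A vanishing mean is consistent with the default values of
  \<open>ln 0\<close> and of the quotient.\<close>

lemma ent_le_variance:
  assumes y: "y \<in> cube n" and M: "\<And>x. x \<in> cl S y \<Longrightarrow> 0 \<le> M x"
  shows "ent S M y \<le> cov S M M y / cexp S M y"
proof (cases "cexp S M y = 0")
  case True
  then have "cexp S (\<lambda>x. M x * ln (M x)) y = cexp S (\<lambda>x. 0) y"
    using cexp_eq_0_iff[OF y M] by (intro cexp_cong) auto
  then show ?thesis using True by (simp add: ent_def)
next
  case False
  define m where "m = cexp S M y"
  have m: "m > 0" using False cexp_nonneg[of y S M, OF y M] by (simp add: m_def)
  have "ent S M y = cexp S (\<lambda>x. M x * ln (M x) - M x * ln m) y"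
    by (simp add: ent_def cexp_diff cexp_cmult2 m_def)
  also have "\<dots> \<le> cexp S (\<lambda>x. M x * M x / m - M x) y"
  proof (rule cexp_mono[OF y])
    fix x assume "x \<in> cl S y"
    then consider "M x = 0" | "M x > 0" using M by force
    then show "M x * ln (M x) - M x * ln m \<le> M x * M x / m - M x"
    proof cases
      case 2
      then have "ln (M x) - ln m \<le> M x / m - 1"
        using m ln_le_minus_one[of "M x / m"] by (simp add: ln_div)
      from mult_left_mono[OF this, of "M x"] 2 show ?thesis by (simp add: algebra_simps)
    qed simp
  qed
  also have "\<dots> = cov S M M y / m"
    using m by (simp add: cexp_diff cexp_cdiv cov_def m_def[symmetric] diff_divide_distrib)
  finally show ?thesis by (simp add: m_def)
qed

text \<open>The marginal of \<open>g\<close> on site \<open>i\<close> is affine in the spin,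
  \<open>A + x i * B\<close>. If \<open>m\<close> is the mean spin, its variance is
  \<open>B^2 * (1 - m^2)\<close> and the covariance of the spin with \<open>g\<close> is
  \<open>B * (1 - m^2)\<close>; finally \<open>m^2 \<le> \<gamma>^2\<close>.\<close>

lemma cov_marginal_le:
  assumes S: "S \<subseteq> {1..n}" and i: "i \<in> S" and y: "y \<in> cube n"
  shows "cov S (cexp (S - {i}) g) (cexp (S - {i}) g) y \<le> (cov S (\<lambda>x. x i) g y)\<^sup>2 / (1 - \<gamma>\<^sup>2)"
proof -
  define T where "T = S - {i}"
  have T: "T \<subseteq> S" by (auto simp: T_def)
  have iV: "i \<in> {1..n}" using S i by auto
  define M where "M = cexp T g"
  define A where "A = (M (y(i := 1)) + M (y(i := -1))) / 2"
  define B where "B = dif i M y"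
  have spin: "x i = 1 \<or> x i = -1" if "x \<in> cl S y" for x
    using cube_spin[OF cl_cube[OF that] iV] .
  have M: "M x = A + x i * B" if "x \<in> cl S y" for x
  proof -
    have "x \<in> cl T (y(i := x i))"
      using that by (auto simp: cl_def T_def)
    then have "M x = M (y(i := x i))" unfolding M_def by (rule cexp_cl)
    then show ?thesis using spin[OF that] by (auto simp: A_def B_def dif_def field_simps)
  qed
  define m where "m = cexp S (\<lambda>x. x i) y"
  have EM: "cexp S M y = A + B * m"
  proof -
    have "cexp S M y = cexp S (\<lambda>x. A + x i * B) y" by (rule cexp_cong) (rule M)
    then show ?thesis using y by (simp add: cexp_add cexp_cmult2 m_def)
  qed
  have EMM: "cexp S (\<lambda>x. M x * M x) y = A\<^sup>2 + B\<^sup>2 + 2 * A * B * m"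
  proof -
    have "cexp S (\<lambda>x. M x * M x) y = cexp S (\<lambda>x. (A\<^sup>2 + B\<^sup>2) + x i * (2 * A * B)) y"
    proof (rule cexp_cong)
      fix x assume x: "x \<in> cl S y"
      show "M x * M x = A\<^sup>2 + B\<^sup>2 + x i * (2 * A * B)"
        using spin[OF x] unfolding M[OF x] by (auto simp: power2_eq_square algebra_simps)
    qed
    then show ?thesis using y by (simp add: cexp_add cexp_cmult2 m_def)
  qed
  have xg: "cexp S (\<lambda>x. x i * g x) y = A * m + B"
  proof -
    have "cexp S (\<lambda>x. x i * g x) y = cexp S (cexp T (\<lambda>x. x i * g x)) y"
      by (rule cexp_tower[OF T, symmetric])
    also have "\<dots> = cexp S (\<lambda>x. x i * M x) y"
      unfolding M_def by (intro cexp_cong cexp_pull) (auto simp: cl_def T_def)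
    also have "\<dots> = cexp S (\<lambda>x. x i * A + B) y"
    proof (rule cexp_cong)
      fix x assume x: "x \<in> cl S y"
      show "x i * M x = x i * A + B" using spin[OF x] unfolding M[OF x] by (auto simp: algebra_simps)
    qed
    finally show ?thesis using y by (simp add: cexp_add cexp_cmult2 m_def)
  qed
  have Eg: "cexp S g y = A + B * m" using EM cexp_tower[OF T, of g y] by (simp add: M_def)
  have c1: "cov S M M y = B\<^sup>2 * (1 - m\<^sup>2)"
    unfolding cov_def EM EMM by (simp add: power2_eq_square algebra_simps)
  have c2: "cov S (\<lambda>x. x i) g y = B * (1 - m\<^sup>2)"
    unfolding cov_def xg Eg m_def[symmetric] by (simp add: power2_eq_square algebra_simps)
  have "m = cexp S (bm i) y" unfolding m_def bm_def using i by (subst cexp_tower) auto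
  also have "\<bar>\<dots>\<bar> \<le> cexp S (\<lambda>x. \<bar>bm i x\<bar>) y" by (rule cexp_abs[OF y])
  also have "\<dots> \<le> cexp S (\<lambda>x. \<gamma>) y" by (intro cexp_mono y bm_bound iV cl_cube)
  finally have "\<bar>m\<bar> \<le> \<gamma>" using y by simp
  then have "\<bar>m\<bar>\<^sup>2 \<le> \<gamma>\<^sup>2" by (intro power_mono) auto
  then have "m\<^sup>2 \<le> \<gamma>\<^sup>2" by simp
  moreover have \<gamma>2: "\<gamma>\<^sup>2 < 1" using \<gamma>_less \<gamma>_nonneg by (simp add: abs_square_less_1)
  ultimately have "B\<^sup>2 * (1 - m\<^sup>2) * (1 - \<gamma>\<^sup>2) \<le> B\<^sup>2 * (1 - m\<^sup>2) * (1 - m\<^sup>2)"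
    by (intro mult_left_mono) auto
  then have "B\<^sup>2 * (1 - m\<^sup>2) * (1 - \<gamma>\<^sup>2) \<le> (B * (1 - m\<^sup>2))\<^sup>2"
    by (simp add: power_mult_distrib power2_eq_square[of "1 - m\<^sup>2"] mult.assoc)
  then have "B\<^sup>2 * (1 - m\<^sup>2) \<le> (B * (1 - m\<^sup>2))\<^sup>2 / (1 - \<gamma>\<^sup>2)"
    using \<gamma>2 by (subst pos_le_divide_eq) auto
  then show ?thesis using c1 c2 by (simp add: M_def T_def)
qed

text \<open>\<open>1 - \<gamma>^2\<close> comes from the one-site marginals and
  \<open>\<rho>^2\<close> from \<open>sum_cov_le\<close>; the dimension does not enter.\<close>

definition LS :: real where "LS = 1 / ((1 - \<gamma>\<^sup>2) * \<rho>\<^sup>2)"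

lemma \<gamma>2_less: "\<gamma>\<^sup>2 < 1" using \<gamma>_less \<gamma>_nonneg by (simp add: abs_square_less_1)

lemma LS_pos: "LS > 0" using \<gamma>2_less \<rho>_pos by (simp add: LS_def)

text \<open>The chain rule is summed over the \<open>m\<close> choices of the first site. All
  marginal terms together cost one full sum of Fisher informations, by \<open>sum_cov_le\<close>,
  and each site is present in \<open>m - 1\<close> of the remainders. The total is \<open>m\<close>
  full sums, so the constant does not grow in the induction.\<close>

lemma ent_tensorization:
  assumes "finite S" "S \<subseteq> {1..n}" "y \<in> cube n"
    and g: "\<And>x. x \<in> cube n \<Longrightarrow> 0 \<le> g x"
  shows "ent S g y \<le> LS * (\<Sum>i\<in>S. cexp S (gam i g) y)"
  using assms(1-3)
proof (induction "card S" arbitrary: S y)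
  case 0
  then have [simp]: "S = {}" by simp
  have "cl {} y = {y}" using 0 by (auto simp: cl_def)
  then have "cexp {} h y = h y" for h using w_pos[of y] 0 by (simp add: cexp_def)
  then show ?case by (simp add: ent_def)
next
  case (Suc k)
  note S = Suc.prems(1,2) and y = Suc.prems(3)
  let ?m = "real (card S)" and ?R = "\<Sum>j\<in>S. cexp S (gam j g) y"
  have m: "?m = real k + 1" using Suc.hyps(2) by simp
  have G: "0 \<le> cexp S g y" using g cl_cube by (intro cexp_nonneg y) auto
  have R: "0 \<le> ?R" using gam_nonneg[of g] g cl_cube by (intro sum_nonneg cexp_nonneg y) auto
  have one: "ent S g y \<le> (cov S (\<lambda>x. x i) g y)\<^sup>2 / (1 - \<gamma>\<^sup>2) / cexp S g y + LS * (\<Sum>j\<in>S - {i}. cexp S (gam j g) y)"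
    if i: "i \<in> S" for i
  proof -
    let ?T = "S - {i}"
    have T: "?T \<subseteq> S" by auto
    have M0: "0 \<le> cexp ?T g x" if "x \<in> cl S y" for x
      using g cl_cube that by (intro cexp_nonneg) blast+
    have "ent S (cexp ?T g) y \<le> cov S (cexp ?T g) (cexp ?T g) y / cexp S (cexp ?T g) y"
      by (rule ent_le_variance[OF y M0])
    also have "\<dots> \<le> (cov S (\<lambda>x. x i) g y)\<^sup>2 / (1 - \<gamma>\<^sup>2) / cexp S g y"
      unfolding cexp_tower[OF T] by (intro divide_right_mono cov_marginal_le S i y G)
    finally have 1: "ent S (cexp ?T g) y \<le> (cov S (\<lambda>x. x i) g y)\<^sup>2 / (1 - \<gamma>\<^sup>2) / cexp S g y" .
    have "cexp S (ent ?T g) y \<le> cexp S (\<lambda>x. LS * (\<Sum>j\<in>?T. cexp ?T (gam j g) x)) y"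
    proof (rule cexp_mono[OF y])
      fix x assume "x \<in> cl S y"
      then have "x \<in> cube n" by (rule cl_cube)
      moreover have "k = card ?T" "finite ?T" "?T \<subseteq> {1..n}"
        using Suc.hyps(2) S i by (simp_all add: card_Diff_singleton subset_iff)
      ultimately show "ent ?T g x \<le> LS * (\<Sum>j\<in>?T. cexp ?T (gam j g) x)"
        by (intro Suc.hyps(1))
    qed
    also have "\<dots> = LS * (\<Sum>j\<in>?T. cexp S (gam j g) y)"
      by (simp add: cexp_cmult cexp_sum cexp_tower[OF T])
    finally show ?thesis using 1 ent_chain[OF T, of g y] by linarith
  qed
  have "?m * ent S g y = (\<Sum>i\<in>S. ent S g y)" by simp
  also have "\<dots> \<le> (\<Sum>i\<in>S. (cov S (\<lambda>x. x i) g y)\<^sup>2 / (1 - \<gamma>\<^sup>2) / cexp S g y + LS * (\<Sum>j\<in>S - {i}. cexp S (gam j g) y))"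
    by (intro sum_mono one)
  also have "\<dots> = (\<Sum>i\<in>S. (cov S (\<lambda>x. x i) g y)\<^sup>2) / (1 - \<gamma>\<^sup>2) / cexp S g y + LS * (\<Sum>i\<in>S. ?R - cexp S (gam i g) y)"
    using S by (simp add: sum.distrib sum_divide_distrib sum_distrib_left sum_diff1)
  also have "(\<Sum>i\<in>S. ?R - cexp S (gam i g) y) = real k * ?R"
    by (simp add: sum_subtractf m algebra_simps)
  also have "(\<Sum>i\<in>S. (cov S (\<lambda>x. x i) g y)\<^sup>2) / (1 - \<gamma>\<^sup>2) / cexp S g y \<le> LS * ?R"
  proof (cases "cexp S g y = 0")
    case True
    then show ?thesis using R LS_pos by simp
  next
    case False
    have "(\<Sum>i\<in>S. (cov S (\<lambda>x. x i) g y)\<^sup>2) / (1 - \<gamma>\<^sup>2) / cexp S g y \<le> (cexp S g y * ?R / \<rho>\<^sup>2) / (1 - \<gamma>\<^sup>2) / cexp S g y"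
      using \<gamma>2_less by (intro divide_right_mono sum_cov_le S y g G) auto
    also have "\<dots> = LS * ?R" using False by (simp add: LS_def)
    finally show ?thesis .
  qed
  finally have "?m * ent S g y \<le> ?m * (LS * ?R)" by (simp add: m algebra_simps)
  then show ?case using m by simp
qed


section \<open>From entropy to Poincare and moment inequalities\<close>

definition grad :: "nat set \<Rightarrow> ((nat \<Rightarrow> real) \<Rightarrow> real) \<Rightarrow> (nat \<Rightarrow> real) \<Rightarrow> real" where
  "grad S f x = (\<Sum>i\<in>S. (dif i f x)\<^sup>2)"

text \<open>The entropy inequality is linearized at \<open>1 + r * f\<close>, with \<open>r\<close>
  so small that the values stay in \<open>[1/2, 3/2]\<close>. There the entropy is at least
  \<open>r^2 / 8\<close> times the second moment and \<open>gam\<close> at most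
  \<open>2 * r^2\<close> times the squared slope, so \<open>r\<close> cancels.\<close>

lemma Poincare:
  assumes S: "finite S" "S \<subseteq> {1..n}" and y: "y \<in> cube n" and f0: "cexp S f y = 0"
  shows "cexp S (\<lambda>x. (f x)\<^sup>2) y \<le> 16 * LS * cexp S (grad S f) y"
proof -
  define M where "M = 1 + (\<Sum>x\<in>cube n. \<bar>f x\<bar>)"
  have M: "\<bar>f x\<bar> \<le> M" if "x \<in> cube n" for x
    using member_le_sum[OF that, of "\<lambda>x. \<bar>f x\<bar>"] by (simp add: M_def)
  have M1: "M \<ge> 1" by (simp add: M_def sum_nonneg)
  define r where "r = 1 / (2 * M)"
  have r: "r > 0" using M1 by (simp add: r_def)
  have small: "\<bar>r * f x\<bar> \<le> 1 / 2" if "x \<in> cube n" for x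
  proof -
    have "r * \<bar>f x\<bar> \<le> r * M" using M[OF that] r by (intro mult_left_mono) auto
    then show ?thesis using r M1 by (simp add: abs_mult r_def)
  qed
  define g where "g x = 1 + r * f x" for x
  have g: "1 / 2 \<le> g x" "g x \<le> 3 / 2" if "x \<in> cube n" for x
    using small[OF that] by (auto simp: g_def abs_le_iff)
  have Eg: "cexp S g y = 1" unfolding g_def using y by (simp add: cexp_add cexp_cmult f0)
  have "r\<^sup>2 / 8 * cexp S (\<lambda>x. (f x)\<^sup>2) y = cexp S (\<lambda>x. r * f x + r\<^sup>2 / 8 * (f x)\<^sup>2) y"
    by (simp add: cexp_add cexp_cmult f0 cexp_cdiv)
  also have "\<dots> \<le> cexp S (\<lambda>x. g x * ln (g x)) y"
  proof (rule cexp_mono[OF y])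
    fix x assume "x \<in> cl S y"
    then have "x \<in> cube n" by (rule cl_cube)
    from x_ln_x_ge[of "g x"] g[OF this]
    show "r * f x + r\<^sup>2 / 8 * (f x)\<^sup>2 \<le> g x * ln (g x)"
      by (simp add: g_def power_mult_distrib)
  qed
  also have "\<dots> = ent S g y" by (simp add: ent_def Eg)
  also have "\<dots> \<le> LS * (\<Sum>i\<in>S. cexp S (gam i g) y)"
    using g(1) by (intro ent_tensorization S y) (meson divide_nonneg_nonneg order_trans zero_le_numeral zero_le_one)
  also have "\<dots> \<le> LS * (\<Sum>i\<in>S. cexp S (\<lambda>x. 2 * r\<^sup>2 * (dif i f x)\<^sup>2) y)"
  proof (intro mult_left_mono sum_mono cexp_mono y less_imp_le[OF LS_pos])
    fix i x assume "x \<in> cl S y"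
    then have x: "x \<in> cube n" by (rule cl_cube)
    have "cexp {i} (\<lambda>_. 1 / 2) x \<le> cexp {i} g x" by (intro cexp_mono x g cl_cube)
    then have c0: "1 / 2 \<le> cexp {i} g x" using x by simp
    have "dif i g x = r * dif i f x" by (simp add: dif_def g_def algebra_simps)
    then have "gam i g x = r\<^sup>2 * (dif i f x)\<^sup>2 / cexp {i} g x" by (simp add: gam_def power_mult_distrib)
    also have "\<dots> \<le> r\<^sup>2 * (dif i f x)\<^sup>2 / (1 / 2)" using c0 by (intro divide_left_mono) auto
    finally show "gam i g x \<le> 2 * r\<^sup>2 * (dif i f x)\<^sup>2" by simp
  qed
  also have "\<dots> = r\<^sup>2 / 8 * (16 * LS * cexp S (grad S f) y)"
    by (simp add: cexp_cmult grad_def[abs_def] cexp_sum sum_distrib_left mult_ac)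
  finally show ?thesis using r by simp
qed

text \<open>Every one-site conditional probability is \<open>(1 + bm) / 2\<close> or
  \<open>(1 - bm) / 2\<close>, hence at least this number.\<close>

definition \<kappa> :: real where "\<kappa> = (1 - \<gamma>) / 2"

lemma \<kappa>_pos: "\<kappa> > 0" and \<kappa>_le: "\<kappa> \<le> 1" using \<gamma>_less \<gamma>_nonneg by (auto simp: \<kappa>_def)

lemma cexp_single_ge:
  assumes x: "x \<in> cube n" and i: "i \<in> {1..n}" and u: "\<And>x. x \<in> cube n \<Longrightarrow> 0 \<le> u x" and s: "s \<in> {-1, 1}"
  shows "\<kappa> * u (x(i := s)) \<le> cexp {i} u x"
proof -
  have b: "\<bar>bm i x\<bar> \<le> \<gamma>" by (rule bm_bound[OF x i])
  let ?p = "u (x(i := 1))" and ?m = "u (x(i := -1))"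
  have p: "0 \<le> ?p" "0 \<le> ?m" by (intro u cube_upd x i; simp)+
  have e: "cexp {i} u x = (1 + bm i x) / 2 * ?p + (1 - bm i x) / 2 * ?m"
    by (simp add: cexp_single[OF x i] dif_def field_simps)
  have "\<kappa> * ?p \<le> (1 + bm i x) / 2 * ?p" "\<kappa> * ?m \<le> (1 - bm i x) / 2 * ?m"
    using b p by (auto simp: \<kappa>_def intro!: mult_right_mono)
  moreover have "0 \<le> \<kappa> * ?p" "0 \<le> \<kappa> * ?m" using \<kappa>_pos p by auto
  ultimately show ?thesis unfolding e using s by auto
qed

text \<open>There is no chain rule for differences, so the difference of powers is bounded through
  the larger modulus \<open>h\<close>. Since the value of modulus \<open>h\<close> has conditional
  probability at least \<open>\<kappa>\<close>, it can be compared with conditional means both in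
  the denominator and in the remaining power \<open>p - 2\<close>.\<close>

lemma gam_power_le:
  assumes x: "x \<in> cube n" and i: "i \<in> {1..n}" and p: "even p" "2 \<le> p"
  shows "gam i (\<lambda>x. f x ^ p) x \<le> (real p / \<kappa>)\<^sup>2 * cexp {i} (\<lambda>x. (dif i f x)\<^sup>2 * f x ^ (p - 2)) x"
proof -
  let ?a = "f (x(i := 1))" and ?b = "f (x(i := -1))"
  obtain s where s: "s \<in> {-1,1}" "\<bar>?a\<bar> \<le> \<bar>f (x(i := s))\<bar>" "\<bar>?b\<bar> \<le> \<bar>f (x(i := s))\<bar>"
    by (cases "\<bar>?a\<bar> \<le> \<bar>?b\<bar>") (force intro: that[of "-1"] that[of 1])+
  define h where "h = \<bar>f (x(i := s))\<bar>"
  have h: "\<bar>?a\<bar> \<le> h" "\<bar>?b\<bar> \<le> h" "0 \<le> h" using s by (auto simp: h_def)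
  let ?D = "dif i f x" and ?E = "cexp {i} (\<lambda>x. f x ^ p) x"
  have evp: "h ^ p = f (x(i := s)) ^ p" "h ^ (p - 2) = f (x(i := s)) ^ (p - 2)"
    using p by (auto simp: h_def power_even_abs)
  have E: "\<kappa> * h ^ p \<le> ?E" unfolding evp
    by (rule cexp_single_ge[OF x i _ s(1)]) (use p in \<open>simp add: zero_le_even_power\<close>)
  have E2: "\<kappa> * h ^ (p - 2) \<le> cexp {i} (\<lambda>x. f x ^ (p - 2)) x" unfolding evp
    by (rule cexp_single_ge[OF x i _ s(1)]) (use p in \<open>simp add: zero_le_even_power\<close>)
  have "\<bar>dif i (\<lambda>x. f x ^ p) x\<bar> \<le> real p * h ^ (p - 1) * \<bar>?D\<bar>"
    using abs_power_diff_le[OF h(1,2), of p] by (simp add: dif_def)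
  then have d: "(dif i (\<lambda>x. f x ^ p) x)\<^sup>2 \<le> (real p * h ^ (p - 1) * ?D)\<^sup>2"
    using h(3) by (simp add: abs_le_square_iff[symmetric] abs_mult)
  have E0: "0 \<le> ?E" using \<kappa>_pos h by (intro order.trans[OF _ E]) simp
  have "gam i (\<lambda>x. f x ^ p) x \<le> (real p)\<^sup>2 * ?D\<^sup>2 * h ^ (p - 2) / \<kappa>"
  proof (cases "h = 0")
    case True
    then have "dif i (\<lambda>x. f x ^ p) x = 0" using h p by (simp add: dif_def power_0_left)
    then show ?thesis using True \<kappa>_pos by (simp add: gam_def)
  next
    case False
    then have hp: "h > 0" using h by simp
    have "(p - 1) * 2 = (p - 2) + p" using p by simp
    then have "(h ^ (p - 1))\<^sup>2 = h ^ (p - 2) * h ^ p" by (metis power_add power_mult)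
    then have eq: "(real p * h ^ (p - 1) * ?D)\<^sup>2 / (\<kappa> * h ^ p) = (real p)\<^sup>2 * ?D\<^sup>2 * h ^ (p - 2) / \<kappa>"
      using hp by (simp add: power_mult_distrib)
    have "gam i (\<lambda>x. f x ^ p) x \<le> (real p * h ^ (p - 1) * ?D)\<^sup>2 / ?E"
      unfolding gam_def using d E0 by (intro divide_right_mono) auto
    also have "\<dots> \<le> (real p * h ^ (p - 1) * ?D)\<^sup>2 / (\<kappa> * h ^ p)"
      using E \<kappa>_pos hp by (intro divide_left_mono) (auto intro!: mult_pos_pos order.strict_trans2[OF _ E])
    also note eq
    finally show ?thesis .
  qed
  also have "\<dots> = (real p / \<kappa>)\<^sup>2 * (?D\<^sup>2 * (\<kappa> * h ^ (p - 2)))"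
    using \<kappa>_pos by (simp add: power_divide power2_eq_square)
  also have "\<dots> \<le> (real p / \<kappa>)\<^sup>2 * (?D\<^sup>2 * cexp {i} (\<lambda>x. f x ^ (p - 2)) x)"
    by (intro mult_left_mono E2) auto
  also have "?D\<^sup>2 * cexp {i} (\<lambda>x. f x ^ (p - 2)) x = cexp {i} (\<lambda>x. (dif i f x)\<^sup>2 * f x ^ (p - 2)) x"
    by (rule cexp_pull[symmetric]) (auto simp: cl_single[OF x i])
  finally show ?thesis .
qed


text \<open>Jensen for the logarithm under the density proportional to \<open>h^2\<close>. With
  \<open>h = f ^ q\<close> it measures how much the norm of \<open>f\<close> grows from exponent
  \<open>q\<close> to \<open>2 * q\<close>, without differentiating in the exponent.\<close>

lemma ent_power_ge:
  assumes y: "y \<in> cube n" and h: "\<And>x. x \<in> cl S y \<Longrightarrow> 0 \<le> h x"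
    and M: "cexp S h y > 0" and N: "cexp S (\<lambda>x. (h x)\<^sup>2) y > 0"
  shows "cexp S (\<lambda>x. (h x)\<^sup>2) y * ln (cexp S (\<lambda>x. (h x)\<^sup>2) y / (cexp S h y)\<^sup>2) \<le> ent S (\<lambda>x. (h x)\<^sup>2) y"
proof -
  define m where "m = cexp S h y"
  define N where "N = cexp S (\<lambda>x. (h x)\<^sup>2) y"
  have m: "m > 0" and N: "N > 0" using assms by (auto simp: m_def N_def)
  have "cexp S (\<lambda>x. 2 * ((h x)\<^sup>2 - (N / m) * h x) + (h x)\<^sup>2 * ln (N\<^sup>2 / m\<^sup>2)) y \<le> cexp S (\<lambda>x. (h x)\<^sup>2 * ln ((h x)\<^sup>2)) y"
  proof (rule cexp_mono[OF y])
    fix x assume "x \<in> cl S y"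
    then consider "h x = 0" | "h x > 0" using h by force
    then show "2 * ((h x)\<^sup>2 - (N / m) * h x) + (h x)\<^sup>2 * ln (N\<^sup>2 / m\<^sup>2) \<le> (h x)\<^sup>2 * ln ((h x)\<^sup>2)"
    proof cases
      case 2
      have "ln (N / (m * h x)) \<le> N / (m * h x) - 1" using 2 m N by (intro ln_le_minus_one) auto
      then have "1 - N / (m * h x) + (ln N - ln m) \<le> ln (h x)"
        using 2 m N by (simp add: ln_div ln_mult)
      then have "2 * (h x)\<^sup>2 * (1 - N / (m * h x) + (ln N - ln m)) \<le> 2 * (h x)\<^sup>2 * ln (h x)"
        by (intro mult_left_mono) auto
      moreover have "2 * (h x)\<^sup>2 * (1 - N / (m * h x) + (ln N - ln m)) = 2 * ((h x)\<^sup>2 - (N / m) * h x) + 2 * (h x)\<^sup>2 * (ln N - ln m)"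
        using 2 m by (simp add: field_simps power2_eq_square)
      moreover have e: "ln (N\<^sup>2 / m\<^sup>2) = 2 * (ln N - ln m)" "ln ((h x)\<^sup>2) = 2 * ln (h x)"
        using m N 2 by (simp_all add: ln_div ln_realpow)
      ultimately show ?thesis unfolding e by (simp only: mult_ac)
    qed simp
  qed
  moreover have "cexp S (\<lambda>x. 2 * ((h x)\<^sup>2 - (N / m) * h x) + (h x)\<^sup>2 * ln (N\<^sup>2 / m\<^sup>2)) y = N * ln (N\<^sup>2 / m\<^sup>2)"
    unfolding cexp_add cexp_cmult cexp_diff cexp_cmult2 N_def[symmetric] m_def[symmetric] using m by simp
  moreover have "ln (N\<^sup>2 / m\<^sup>2) = ln (N / m\<^sup>2) + ln N"
    using m N by (simp add: ln_div ln_realpow)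
  ultimately show ?thesis
    by (simp add: ent_def N_def[symmetric] m_def[symmetric] algebra_simps)
qed

text \<open>The 8 is \<open>2^2 * 2\<close>: the square of the exponent \<open>2 * q\<close> and the
  factor lost in \<open>mult_power_le_add_powers\<close>.\<close>

definition MC :: real where "MC = 8 * LS / \<kappa>\<^sup>2"

lemma MC_pos: "MC > 0" using LS_pos \<kappa>_pos by (simp add: MC_def)

text \<open>\<open>X\<close> bounds the squared \<open>q\<close>-norm of \<open>f\<close>, and
  \<open>a\<close> is its squared \<open>2q\<close>-norm. The entropy inequality reduces to
  \<open>a * ln (a / X) \<le> MC * q * B \<le> X\<close>, and
  \<open>a - X \<le> a * ln (a / X)\<close> then gives \<open>a \<le> 2 * X\<close>.\<close>

lemma moment_doubling:
  assumes S: "finite S" "S \<subseteq> {1..n}" and y: "y \<in> cube n"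
    and q: "even q" "1 \<le> q" and B: "0 < B" and X: "MC * real q * B \<le> X"
    and G: "cexp S (\<lambda>x. grad S f x ^ q) y \<le> B ^ q"
    and M: "(cexp S (\<lambda>x. f x ^ q) y)\<^sup>2 \<le> X ^ q"
  shows "cexp S (\<lambda>x. f x ^ (2 * q)) y \<le> (2 * X) ^ q"
proof -
  define N where "N = cexp S (\<lambda>x. (f x ^ q)\<^sup>2) y"
  define m where "m = cexp S (\<lambda>x. f x ^ q) y"
  have Nf: "cexp S (\<lambda>x. f x ^ (2 * q)) y = N" by (simp add: N_def power_mult[symmetric] mult.commute)
  have fq: "0 \<le> f x ^ q" for x using q by (simp add: zero_le_even_power)
  have m0: "0 \<le> m" unfolding m_def by (intro cexp_nonneg y fq)
  have N0: "0 \<le> N" unfolding N_def by (intro cexp_nonneg y) simp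
  have X0: "0 < X" using MC_pos q B by (intro order.strict_trans2[OF _ X]) simp
  have "N \<le> (2 * X) ^ q"
  proof (cases "N = 0")
    case True
    then show ?thesis using X0 by simp
  next
    case False
    then have N: "N > 0" using N0 by simp
    have "m \<noteq> 0"
    proof
      assume "m = 0"
      then have "\<forall>x\<in>cl S y. f x ^ q = 0" unfolding m_def using cexp_eq_0_iff[OF y, of S "\<lambda>x. f x ^ q"] fq by simp
      then have "N = cexp S (\<lambda>_. 0) y" unfolding N_def by (intro cexp_cong) simp
      then show False using False by simp
    qed
    then have m: "m > 0" using m0 by simp
    define a where "a = root q N"
    have a: "a > 0" "a ^ q = N" using N q by (auto simp: a_def)
    obtain r where r: "q = Suc r" using q by (cases q) auto
    have "ln (N / X ^ q) \<le> ln (N / m\<^sup>2)"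
      using m N M X0 by (intro ln_mono divide_left_mono) (auto simp: m_def)
    then have "N * ln (N / X ^ q) \<le> N * ln (N / m\<^sup>2)" using N by (intro mult_left_mono) auto
    also have "\<dots> \<le> ent S (\<lambda>x. (f x ^ q)\<^sup>2) y"
      unfolding N_def m_def by (intro ent_power_ge y fq) (use m N in \<open>auto simp: N_def m_def\<close>)
    also have "\<dots> = ent S (\<lambda>x. f x ^ (2 * q)) y" by (simp add: power_mult[symmetric] mult.commute)
    also have "\<dots> \<le> LS * (\<Sum>i\<in>S. cexp S (gam i (\<lambda>x. f x ^ (2 * q))) y)"
      by (intro ent_tensorization S y) (simp add: zero_le_even_power)
    also have "\<dots> \<le> LS * (\<Sum>i\<in>S. cexp S (\<lambda>x. (real (2 * q) / \<kappa>)\<^sup>2 * cexp {i} (\<lambda>x. (dif i f x)\<^sup>2 * f x ^ (2 * q - 2)) x) y)"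
      by (intro mult_left_mono sum_mono cexp_mono y less_imp_le[OF LS_pos] gam_power_le)
         (use S q cl_cube in auto)
    also have "\<dots> = LS * (real (2 * q) / \<kappa>)\<^sup>2 * cexp S (\<lambda>x. grad S f x * ((f x)\<^sup>2) ^ r) y"
    proof -
      have "cexp S (cexp {i} (\<lambda>x. (dif i f x)\<^sup>2 * f x ^ (2 * q - 2))) y = cexp S (\<lambda>x. (dif i f x)\<^sup>2 * f x ^ (2 * q - 2)) y"
        if "i \<in> S" for i using that by (intro cexp_tower) auto
      then have "(\<Sum>i\<in>S. cexp S (\<lambda>x. (real (2 * q) / \<kappa>)\<^sup>2 * cexp {i} (\<lambda>x. (dif i f x)\<^sup>2 * f x ^ (2 * q - 2)) x) y)
        = (\<Sum>i\<in>S. (real (2 * q) / \<kappa>)\<^sup>2 * cexp S (\<lambda>x. (dif i f x)\<^sup>2 * f x ^ (2 * q - 2)) y)"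
        by (simp add: cexp_cmult)
      also have "\<dots> = (real (2 * q) / \<kappa>)\<^sup>2 * cexp S (\<lambda>x. grad S f x * ((f x)\<^sup>2) ^ r) y"
        by (simp add: sum_distrib_left[symmetric] cexp_sum[symmetric] grad_def sum_distrib_right r power_mult[symmetric])
      finally show ?thesis by simp
    qed
    also have "cexp S (\<lambda>x. grad S f x * ((f x)\<^sup>2) ^ r) y \<le> 2 * (B * a ^ r)"
    proof -
      have gr: "0 \<le> grad S f x" for x by (simp add: grad_def sum_nonneg)
      have "cexp S (\<lambda>x. grad S f x * ((f x)\<^sup>2) ^ r) y = B * a ^ r * cexp S (\<lambda>x. (grad S f x / B) * ((f x)\<^sup>2 / a) ^ r) y"
        unfolding cexp_cmult[symmetric] using B a by (simp add: power_divide)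
      also have "\<dots> \<le> B * a ^ r * cexp S (\<lambda>x. (grad S f x / B) ^ q + ((f x)\<^sup>2 / a) ^ q) y"
        unfolding r using B a gr by (intro mult_left_mono cexp_mono y mult_power_le_add_powers) auto
      also have "cexp S (\<lambda>x. (grad S f x / B) ^ q + ((f x)\<^sup>2 / a) ^ q) y = cexp S (\<lambda>x. grad S f x ^ q) y / B ^ q + cexp S (\<lambda>x. ((f x)\<^sup>2) ^ q) y / a ^ q"
        by (simp add: power_divide cexp_add cexp_cdiv)
      also have "(\<lambda>x. ((f x)\<^sup>2) ^ q) = (\<lambda>x. (f x ^ q)\<^sup>2)" by (simp add: power_mult[symmetric] mult.commute)
      also have "cexp S (\<lambda>x. grad S f x ^ q) y / B ^ q + cexp S (\<lambda>x. (f x ^ q)\<^sup>2) y / a ^ q \<le> 1 + 1"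
        using G B N a by (intro add_mono) (auto simp: N_def)
      finally show ?thesis using B a by (simp add: mult_left_mono mult.commute)
    qed
    finally have "N * ln (N / X ^ q) \<le> LS * (real (2 * q) / \<kappa>)\<^sup>2 * (2 * (B * a ^ r))"
      using LS_pos by (simp add: mult_left_mono)
    also have "\<dots> = MC * (real q)\<^sup>2 * B * a ^ r" by (simp add: MC_def power_divide power_mult_distrib)
    also have "N * ln (N / X ^ q) = a ^ r * (a * (real q * ln (a / X)))"
      using a X0 by (simp add: a(2)[symmetric] ln_realpow flip: power_divide) (simp add: r)
    finally have "a ^ r * (a * (real q * ln (a / X))) \<le> a ^ r * (MC * (real q)\<^sup>2 * B)" by (simp add: mult_ac)
    then have "a * (real q * ln (a / X)) \<le> MC * (real q)\<^sup>2 * B" using a by simp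
    then have "real q * (a * ln (a / X)) \<le> real q * (MC * real q * B)" by (simp add: power2_eq_square mult_ac)
    then have "a * ln (a / X) \<le> MC * real q * B" using q by simp
    moreover have "ln (X / a) \<le> X / a - 1" using a X0 by (intro ln_le_minus_one) auto
    then have "a * (1 - X / a) \<le> a * ln (a / X)" using a X0 by (intro mult_left_mono) (auto simp: ln_div)
    then have "a - X \<le> a * ln (a / X)" using a by (simp add: right_diff_distrib)
    ultimately have "a \<le> 2 * X" using X by linarith
    then have "a ^ q \<le> (2 * X) ^ q" using a by (intro power_mono) auto
    then show ?thesis using a by simp
  qed
  then show ?thesis using Nf by simp
qed

text \<open>Each doubling of the exponent doubles the bound for the squared norm, so this bound
  stays linear in the exponent. The start at exponent 2 is the Poincare inequality, and Jensen
  passes the gradient hypothesis down to half the exponent.\<close>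

theorem moment_bound:
  assumes S: "finite S" "S \<subseteq> {1..n}" and y: "y \<in> cube n" and B: "0 < B"
    and f0: "cexp S f y = 0" and G: "cexp S (\<lambda>x. grad S f x ^ (2 ^ j)) y \<le> B ^ (2 ^ j)"
  shows "cexp S (\<lambda>x. f x ^ (2 ^ Suc j)) y \<le> (MC * 2 ^ Suc j * B) ^ (2 ^ j)"
  using G
proof (induction j)
  case 0
  have "cexp S (\<lambda>x. (f x)\<^sup>2) y \<le> 16 * LS * cexp S (grad S f) y" by (rule Poincare[OF S y f0])
  also have "\<dots> \<le> 16 * LS * B" using 0 LS_pos by (intro mult_left_mono) auto
  also have "16 * LS \<le> 2 * MC"
  proof -
    have "\<kappa>\<^sup>2 \<le> 1" using \<kappa>_pos \<kappa>_le by (intro power_le_one) auto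
    then have "8 * LS * \<kappa>\<^sup>2 \<le> 8 * LS * 1" using LS_pos by (intro mult_left_mono) auto
    then show ?thesis using \<kappa>_pos by (simp add: MC_def field_simps)
  qed
  then have "16 * LS * B \<le> 2 * MC * B" using B by (intro mult_right_mono) auto
  finally show ?case by (simp add: mult_ac)
next
  case (Suc j)
  let ?q = "2 ^ Suc j :: nat"
  have gr: "0 \<le> grad S f x" for x by (simp add: grad_def sum_nonneg)
  have "(cexp S (\<lambda>x. grad S f x ^ (2 ^ j)) y)\<^sup>2 \<le> cexp S (\<lambda>x. (grad S f x ^ (2 ^ j))\<^sup>2) y"
    by (rule cexp_square_le[OF y])
  also have "\<dots> \<le> (B ^ 2 ^ j)\<^sup>2" using Suc.prems by (simp add: power_mult[symmetric] mult.commute)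
  finally have "cexp S (\<lambda>x. grad S f x ^ (2 ^ j)) y \<le> B ^ 2 ^ j"
    by (rule power2_le_imp_le) (use B in simp)
  then have IH: "cexp S (\<lambda>x. f x ^ ?q) y \<le> (MC * 2 ^ Suc j * B) ^ (2 ^ j)" by (rule Suc.IH)
  have "cexp S (\<lambda>x. f x ^ (2 * ?q)) y \<le> (2 * (MC * 2 ^ Suc j * B)) ^ ?q"
  proof (rule moment_doubling[OF S y _ _ B _ Suc.prems])
    have "0 \<le> cexp S (\<lambda>x. f x ^ ?q) y" by (intro cexp_nonneg y zero_le_even_power) simp
    then have "(cexp S (\<lambda>x. f x ^ ?q) y)\<^sup>2 \<le> ((MC * 2 ^ Suc j * B) ^ (2 ^ j))\<^sup>2"
      using IH by (intro power_mono)
    then show "(cexp S (\<lambda>x. f x ^ ?q) y)\<^sup>2 \<le> (MC * 2 ^ Suc j * B) ^ ?q"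
      by (simp only: power_mult[symmetric] power_Suc2)
  qed auto
  then show ?case by (simp add: mult_ac)
qed

end

subsection \<open>The Ising model satisfies the Dobrushin condition\<close>

lemma (in spin_system) bm_eq:
  assumes "\<sigma> \<in> cube n" "i \<in> {1..n}"
  shows "bm i \<sigma> = (w (\<sigma>(i := 1)) - w (\<sigma>(i := -1))) / (w (\<sigma>(i := 1)) + w (\<sigma>(i := -1)))"
proof -
  have "\<sigma>(i := 1) \<noteq> \<sigma>(i := -1)" by (metis fun_upd_same one_neq_neg_one)
  then show ?thesis by (simp add: bm_def cexp_def cl_single[OF assms])
qed

lemma tanh_Lipschitz: "\<bar>tanh x - tanh y\<bar> \<le> \<bar>x - y\<bar>" for x y :: real
proof -
  have *: "\<bar>tanh y - tanh x\<bar> \<le> \<bar>y - x\<bar>" if "x < y" for x y :: real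
  proof -
    have "\<exists>z. x < z \<and> z < y \<and> tanh y - tanh x = (y - x) * (1 - tanh z ^ 2)"
      using that by (intro MVT2) (auto intro!: derivative_eq_intros)
    then obtain z where z: "tanh y - tanh x = (y - x) * (1 - tanh z ^ 2)" by blast
    have "\<bar>tanh z\<bar> < 1" by (simp add: abs_less_iff tanh_real_lt_1 tanh_real_gt_neg1)
    then have "(tanh z)\<^sup>2 \<le> 1" by (simp add: abs_square_le_1)
    then have "\<bar>1 - tanh z ^ 2\<bar> \<le> 1" by simp
    then show ?thesis unfolding z abs_mult by (intro mult_left_le) auto
  qed
  show ?thesis using *[of x y] *[of y x] by (cases x y rule: linorder_cases) auto
qed

lemma ising_weight_pos: "ising_weight n J h \<sigma> > 0"
  by (simp add: ising_weight_def)

text \<open>With zero diagonal the energy is affine in spin \<open>i\<close>; the factor 1/2 in it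
  is offset by symmetry, as each pair occurs twice.\<close>

lemma ising_weight_upd:
  assumes i: "i \<in> {1..n}" and sym: "\<forall>i\<in>{1..n}. \<forall>j\<in>{1..n}. J i j = J j i" and diag: "\<forall>i\<in>{1..n}. J i i = 0"
  shows "ising_weight n J h (\<sigma>(i := s)) = ising_weight n J h (\<sigma>(i := 0)) * exp (s * ((\<Sum>j\<in>{1..n}. J i j * \<sigma> j) - h i))"
proof -
  let ?V = "{1..n}"
  let ?z = "\<sigma>(i := 0)"
  define \<delta> where "\<delta> a = (if a = i then s else 0)" for a
  have u: "(\<sigma>(i := s)) a = ?z a + \<delta> a" for a by (simp add: \<delta>_def)
  have \<delta>: "(\<Sum>a\<in>?V. X a * \<delta> a) = X i * s" for X
  proof -
    have "(\<Sum>a\<in>?V. X a * \<delta> a) = (\<Sum>a\<in>?V. if a = i then X a * s else 0)"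
      by (intro sum.cong) (auto simp: \<delta>_def)
    then show ?thesis using i by simp
  qed
  have L: "(\<Sum>b\<in>?V. J i b * ?z b) = (\<Sum>b\<in>?V. J i b * \<sigma> b)"
    by (intro sum.cong refl) (use diag i in auto)
  have "(\<Sum>a\<in>?V. \<Sum>b\<in>?V. J a b * (\<sigma>(i := s)) a * (\<sigma>(i := s)) b)
    = (\<Sum>a\<in>?V. \<Sum>b\<in>?V. J a b * ?z a * ?z b) + (\<Sum>a\<in>?V. \<Sum>b\<in>?V. (J a b * ?z a) * \<delta> b)
      + (\<Sum>a\<in>?V. (\<Sum>b\<in>?V. J a b * ?z b) * \<delta> a) + (\<Sum>a\<in>?V. (\<Sum>b\<in>?V. J a b * \<delta> b) * \<delta> a)"
    unfolding u by (simp add: sum.distrib[symmetric] sum_distrib_right sum_distrib_left algebra_simps del: fun_upd_apply)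
  also have "(\<Sum>a\<in>?V. \<Sum>b\<in>?V. (J a b * ?z a) * \<delta> b) = (\<Sum>a\<in>?V. J i a * ?z a) * s"
    unfolding \<delta> sum_distrib_right by (intro sum.cong refl) (use sym i in metis)
  also have "(\<Sum>a\<in>?V. (\<Sum>b\<in>?V. J a b * \<delta> b) * \<delta> a) = 0"
    unfolding \<delta> using diag i by simp
  also have "(\<Sum>a\<in>?V. (\<Sum>b\<in>?V. J a b * ?z b) * \<delta> a) = (\<Sum>b\<in>?V. J i b * ?z b) * s"
    unfolding \<delta> ..
  finally have 1: "(\<Sum>a\<in>?V. \<Sum>b\<in>?V. J a b * (\<sigma>(i := s)) a * (\<sigma>(i := s)) b)
    = (\<Sum>a\<in>?V. \<Sum>b\<in>?V. J a b * ?z a * ?z b) + 2 * (s * (\<Sum>j\<in>?V. J i j * \<sigma> j))"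
    unfolding L by (simp add: mult.commute)
  have 2: "(\<Sum>a\<in>?V. h a * (\<sigma>(i := s)) a) = (\<Sum>a\<in>?V. h a * ?z a) + s * h i"
    unfolding u using \<delta>[of h] by (simp add: sum.distrib algebra_simps del: fun_upd_apply)
  show ?thesis
    unfolding ising_weight_def 1 2 exp_add[symmetric] by (simp add: algebra_simps del: fun_upd_apply)
qed

locale ising_model =
  fixes n :: nat and J :: "nat \<Rightarrow> nat \<Rightarrow> real" and h :: "nat \<Rightarrow> real" and \<alpha> \<rho> :: real
  assumes n: "n \<ge> 1" and sym: "\<forall>i\<in>{1..n}. \<forall>j\<in>{1..n}. J i j = J j i"
    and diag: "\<forall>i\<in>{1..n}. J i i = 0"
    and row: "(MAX i\<in>{1..n}. \<Sum>j\<in>{1..n}. \<bar>J i j\<bar>) \<le> 1 - \<rho>"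
    and hb: "(MAX i\<in>{1..n}. \<bar>h i\<bar>) \<le> \<alpha>" and \<rho>: "\<rho> > 0" and \<alpha>: "\<alpha> \<ge> 0"
begin

lemma row': "i \<in> {1..n} \<Longrightarrow> (\<Sum>j\<in>{1..n}. \<bar>J i j\<bar>) \<le> 1 - \<rho>"
  by (rule order.trans[OF Max_ge row]) auto

lemma hb': "i \<in> {1..n} \<Longrightarrow> \<bar>h i\<bar> \<le> \<alpha>"
  by (rule order.trans[OF Max_ge hb]) auto

sublocale spin_system n "ising_weight n J h"
  by unfold_locales (rule ising_weight_pos)

definition field :: "nat \<Rightarrow> (nat \<Rightarrow> real) \<Rightarrow> real" where
  "field i \<sigma> = (\<Sum>j\<in>{1..n}. J i j * \<sigma> j) - h i"

lemma bm_tanh: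
  assumes "\<sigma> \<in> cube n" "i \<in> {1..n}"
  shows "bm i \<sigma> = tanh (field i \<sigma>)"
proof -
  let ?w = "ising_weight n J h (\<sigma>(i := 0))"
  have pos: "?w > 0" by (rule ising_weight_pos)
  have "bm i \<sigma> = (?w * (exp (field i \<sigma>) - exp (- field i \<sigma>))) / (?w * (exp (field i \<sigma>) + exp (- field i \<sigma>)))"
    unfolding bm_eq[OF assms] field_def
      ising_weight_upd[OF assms(2) sym diag, where s = 1] ising_weight_upd[OF assms(2) sym diag, where s = "-1"]
    by (simp add: right_diff_distrib distrib_left)
  also have "\<dots> = tanh (field i \<sigma>)"
    using pos by (simp add: tanh_altdef)
  finally show ?thesis .
qed

text \<open>The conditional mean of a spin is \<open>tanh\<close> of its local field. Flipping spin
  \<open>j\<close> moves the field by \<open>2 * J i j\<close>, and \<open>dif\<close> halves this,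
  so 1-Lipschitz continuity gives the influence bound. The field is at most 1 + \<alpha> in
  modulus.\<close>

sublocale dobrushin n "ising_weight n J h" "\<lambda>i j. \<bar>J i j\<bar>" \<rho> "tanh (1 + \<alpha>)"
proof unfold_locales
  have "0 \<le> (\<Sum>j\<in>{1..n}. \<bar>J 1 j\<bar>)" by (rule sum_nonneg) simp
  moreover have "(\<Sum>j\<in>{1..n}. \<bar>J 1 j\<bar>) \<le> 1 - \<rho>" using n by (intro row') simp
  ultimately show "\<rho> \<le> 1" by linarith
  show "0 < \<rho>" by (rule \<rho>)
  show "tanh (1 + \<alpha>) < 1" by (rule tanh_real_lt_1)
  show "0 \<le> tanh (1 + \<alpha>)" using \<alpha> by simp
  show "0 \<le> \<bar>J i j\<bar>" for i j by simp
  show "i \<in> {1..n} \<Longrightarrow> j \<in> {1..n} \<Longrightarrow> \<bar>J i j\<bar> = \<bar>J j i\<bar>" for i j using sym by metis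
  show "i \<in> {1..n} \<Longrightarrow> (\<Sum>j\<in>{1..n}. \<bar>J i j\<bar>) \<le> 1 - \<rho>" for i by (rule row')
next
  fix \<sigma> i j assume \<sigma>: "\<sigma> \<in> cube n" and i: "i \<in> {1..n}" and j: "j \<in> {1..n}" and "i \<noteq> j"
  have "(\<Sum>k\<in>{1..n}. J i k * (\<sigma>(j := 1)) k) - (\<Sum>k\<in>{1..n}. J i k * (\<sigma>(j := -1)) k) = (\<Sum>k\<in>{1..n}. if k = j then 2 * J i k else 0)"
    by (subst sum_subtractf[symmetric], rule sum.cong) auto
  also have "\<dots> = 2 * J i j" using j by simp
  finally have f: "field i (\<sigma>(j := 1)) - field i (\<sigma>(j := -1)) = 2 * J i j" by (simp add: field_def)
  have "dif j (bm i) \<sigma> = (tanh (field i (\<sigma>(j := 1))) - tanh (field i (\<sigma>(j := -1)))) / 2"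
    using cube_upd[OF \<sigma> j] i by (simp add: dif_def bm_tanh)
  moreover have "\<bar>tanh (field i (\<sigma>(j := 1))) - tanh (field i (\<sigma>(j := -1)))\<bar> \<le> \<bar>field i (\<sigma>(j := 1)) - field i (\<sigma>(j := -1))\<bar>"
    by (rule tanh_Lipschitz)
  ultimately show "\<bar>dif j (bm i) \<sigma>\<bar> \<le> \<bar>J i j\<bar>" unfolding f by simp
next
  fix \<sigma> i assume \<sigma>: "\<sigma> \<in> cube n" and i: "i \<in> {1..n}"
  have "\<bar>\<Sum>j\<in>{1..n}. J i j * \<sigma> j\<bar> \<le> (\<Sum>j\<in>{1..n}. \<bar>J i j\<bar>)"
  proof (rule order.trans[OF sum_abs sum_mono])
    fix j assume "j \<in> {1..n}"
    then have "\<bar>\<sigma> j\<bar> = 1" using cube_spin[OF \<sigma>, of j] by auto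
    then show "\<bar>J i j * \<sigma> j\<bar> \<le> \<bar>J i j\<bar>" by (simp add: abs_mult)
  qed
  then have "\<bar>field i \<sigma>\<bar> \<le> 1 + \<alpha>"
    using row'[OF i] hb'[OF i] \<rho> unfolding field_def by linarith
  then have "tanh \<bar>field i \<sigma>\<bar> \<le> tanh (1 + \<alpha>)" by (subst tanh_real_le_iff)
  then show "\<bar>bm i \<sigma>\<bar> \<le> tanh (1 + \<alpha>)" by (simp add: bm_tanh[OF \<sigma> i] tanh_real_abs)
qed

lemma cl_full: "\<sigma> \<in> cube n \<Longrightarrow> cl {1..n} \<sigma> = cube n"
  by (auto simp: cl_def cube_def PiE_iff extensional_def)

text \<open>\<open>cexp\<close> needs a base point; when all coordinates are averaged, any point of
  the cube serves.\<close>

definition ref :: "nat \<Rightarrow> real" where "ref = (\<lambda>i\<in>{1..n}. 1)"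

lemma ref [simp]: "ref \<in> cube n" by (auto simp: ref_def cube_def)

definition mean :: "((nat \<Rightarrow> real) \<Rightarrow> real) \<Rightarrow> real" where
  "mean f = cexp {1..n} f ref"

lemma integral_ising: "(\<integral>\<sigma>. f \<sigma> \<partial>ising n J h) = mean f"
proof -
  let ?U = "uniform_count_measure (cube n)" and ?w = "ising_weight n J h"
  have card: "card (cube n) > 0" using ref finite_cube card_gt_0_iff by blast
  have Z: "ising_Z n J h = (\<Sum>\<sigma>\<in>cube n. ?w \<sigma>) / card (cube n)"
    unfolding ising_Z_def by (rule integral_uniform_count_measure) simp
  have "0 < (\<Sum>\<sigma>\<in>cube n. ?w \<sigma>)"
    using wsum_pos[OF ref, of "{1..n}"] unfolding cl_full[OF ref] .
  then have Z0: "ising_Z n J h > 0" using card by (simp add: Z)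
  have m: "g \<in> borel_measurable ?U" for g :: "(nat \<Rightarrow> real) \<Rightarrow> real"
    by (auto simp: measurable_def uniform_count_measure_def space_point_measure sets_point_measure)
  have "(\<integral>\<sigma>. f \<sigma> \<partial>ising n J h) = (\<integral>\<sigma>. (?w \<sigma> / ising_Z n J h) * f \<sigma> \<partial>?U)"
    unfolding ising_def by (subst integral_density) (use Z0 ising_weight_pos m in \<open>auto simp: less_imp_le\<close>)
  also have "\<dots> = (\<Sum>\<sigma>\<in>cube n. (?w \<sigma> / ising_Z n J h) * f \<sigma>) / card (cube n)"
    by (rule integral_uniform_count_measure) simp
  also have "(\<Sum>\<sigma>\<in>cube n. (?w \<sigma> / ising_Z n J h) * f \<sigma>) = (\<Sum>\<sigma>\<in>cube n. ?w \<sigma> * f \<sigma>) / ising_Z n J h"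
    by (simp add: sum_divide_distrib)
  also have "\<dots> / card (cube n) = mean f"
    using card unfolding mean_def cexp_def cl_full[OF ref] Z by simp
  finally show ?thesis .
qed

lemma prob_ising: "\<P>(\<sigma> in ising n J h. P \<sigma>) = mean (\<lambda>\<sigma>. if P \<sigma> then 1 else 0)"
proof -
  have sp: "space (ising n J h) = cube n" "sets (ising n J h) = Pow (cube n)"
    by (auto simp: ising_def uniform_count_measure_def space_point_measure sets_point_measure)
  have "\<P>(\<sigma> in ising n J h. P \<sigma>) = (\<integral>\<sigma>. indicator {\<sigma> \<in> cube n. P \<sigma>} \<sigma> \<partial>ising n J h)"
    by (simp add: sp Int_absorb2)
  also have "\<dots> = mean (indicator {\<sigma> \<in> cube n. P \<sigma>})" by (rule integral_ising)
  also have "\<dots> = mean (\<lambda>\<sigma>. if P \<sigma> then 1 else 0)"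
    unfolding mean_def by (rule cexp_cong) (auto simp: indicator_def dest: cl_cube)
  finally show ?thesis .
qed

end

subsection \<open>Binomial randomization\<close>

text \<open>On the half line \<open>x^2 / 2 - ln (cosh x)\<close> has the derivative
  \<open>x - tanh x\<close>, which is nonnegative.\<close>

lemma cosh_le_exp: "cosh x \<le> exp (x\<^sup>2 / 2)" for x :: real
proof -
  have *: "ln (cosh x) \<le> x\<^sup>2 / 2" if "0 \<le> x" for x :: real
  proof -
    have "0\<^sup>2 / 2 - ln (cosh 0) \<le> x\<^sup>2 / 2 - ln (cosh x)"
    proof (rule DERIV_nonneg_imp_nondecreasing[OF that])
      fix t :: real assume t: "0 \<le> t"
      have "((\<lambda>t. t\<^sup>2 / 2 - ln (cosh t)) has_real_derivative t - tanh t) (at t)"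
        unfolding tanh_def using cosh_real_pos[of t]
        by (auto intro!: derivative_eq_intros)
      moreover have "tanh t \<le> t"
      proof -
        have "\<bar>tanh t - tanh 0\<bar> \<le> \<bar>t - 0\<bar>" by (rule tanh_Lipschitz)
        then show ?thesis using t unfolding tanh_0 by linarith
      qed
      ultimately show "\<exists>y. ((\<lambda>t. t\<^sup>2 / 2 - ln (cosh t)) has_real_derivative y) (at t) \<and> 0 \<le> y"
        by (intro exI[of _ "t - tanh t"]) auto
    qed
    then show ?thesis by simp
  qed
  have "ln (cosh x) \<le> x\<^sup>2 / 2" using *[of x] *[of "- x"] by (cases "0 \<le> x") auto
  then have "exp (ln (cosh x)) \<le> exp (x\<^sup>2 / 2)" by (subst exp_le_cancel_iff)
  then show ?thesis using cosh_real_pos[of x] by (subst (asm) exp_ln)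
qed

text \<open>
  The average of \<open>P\<close> independent signs of mean \<open>y\<close> takes the value \<open>bval P s\<close> with probability \<open>bwt P y s\<close>,
  where \<open>s\<close> is the number of positive signs.
\<close>

definition bval :: "nat \<Rightarrow> nat \<Rightarrow> real" where
  "bval P s = 2 * real s / real P - 1"

definition bwt :: "nat \<Rightarrow> real \<Rightarrow> nat \<Rightarrow> real" where
  "bwt P y s = Bernstein P s ((1 + y) / 2)"

lemma bwt_nonneg: "\<bar>y\<bar> \<le> 1 \<Longrightarrow> 0 \<le> bwt P y s"
  unfolding bwt_def by (rule Bernstein_nonneg) (auto simp: abs_le_iff)

lemma bwt_0: "s \<le> P \<Longrightarrow> bwt P 0 s = real (P choose s) / 2 ^ P"
  by (simp add: bwt_def Bernstein_def power_divide flip: power_add)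

lemma sum_bwt [simp]: "(\<Sum>s\<le>P. bwt P y s) = 1"
  by (simp add: bwt_def)

lemma sum_bwt_bval: "P \<ge> 1 \<Longrightarrow> (\<Sum>s\<le>P. bwt P y s * bval P s) = y"
proof -
  assume P: "P \<ge> 1"
  have "(\<Sum>s\<le>P. bwt P y s * bval P s) = (2 / real P) * (\<Sum>s\<le>P. real s * bwt P y s) - (\<Sum>s\<le>P. bwt P y s)"
    unfolding sum_distrib_left sum_subtractf[symmetric]
    by (intro sum.cong refl) (simp add: bval_def algebra_simps)
  also have "(\<Sum>s\<le>P. real s * bwt P y s) = real P * ((1 + y) / 2)"
    unfolding bwt_def by (rule sum_k_Bernstein)
  finally show ?thesis using P by (simp add: field_simps)
qed

lemma sum_bwt_bval2: "P \<ge> 1 \<Longrightarrow> (\<Sum>s\<le>P. bwt P y s * (bval P s * bval P s)) = y\<^sup>2 + (1 - y\<^sup>2) / real P"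
proof -
  assume P: "P \<ge> 1"
  have 1: "(\<Sum>s\<le>P. real s * bwt P y s) = real P * ((1 + y) / 2)"
    unfolding bwt_def by (rule sum_k_Bernstein)
  have 2: "(\<Sum>s\<le>P. real s * (real s - 1) * bwt P y s) = real P * (real P - 1) * ((1 + y) / 2)\<^sup>2"
    unfolding bwt_def by (rule sum_kk_Bernstein)
  have "(\<Sum>s\<le>P. bwt P y s * (bval P s * bval P s)) =
      (4 / (real P)\<^sup>2) * (\<Sum>s\<le>P. real s * (real s - 1) * bwt P y s)
      + (4 / (real P)\<^sup>2 - 4 / real P) * (\<Sum>s\<le>P. real s * bwt P y s) + (\<Sum>s\<le>P. bwt P y s)"
    unfolding sum_distrib_left sum.distrib[symmetric]
    by (intro sum.cong refl) (use P in \<open>simp add: bval_def field_simps power2_eq_square\<close>)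
  also have "\<dots> = y\<^sup>2 + (1 - y\<^sup>2) / real P"
    unfolding 1 2 using P by (simp add: field_simps power2_eq_square)
  finally show ?thesis .
qed

text \<open>One plus the chi-square divergence from the fair to the biased binomial law; by the
  binomial theorem it is the \<open>P\<close>-th power of its value for a single sign.\<close>

lemma sum_bwt_chi: "(\<Sum>s\<le>P. (bwt P y s)\<^sup>2 / bwt P 0 s) = (1 + y\<^sup>2) ^ P"
proof -
  define q where "q = (1 + y) / 2"
  have "(\<Sum>s\<le>P. (bwt P y s)\<^sup>2 / bwt P 0 s) = (\<Sum>s\<le>P. 2 ^ P * (real (P choose s) * (q\<^sup>2) ^ s * ((1 - q)\<^sup>2) ^ (P - s)))"
  proof (rule sum.cong[OF refl])
    fix s assume s: "s \<in> {..P}"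
    then have "real (P choose s) > 0" by simp
    then show "(bwt P y s)\<^sup>2 / bwt P 0 s = 2 ^ P * (real (P choose s) * (q\<^sup>2) ^ s * ((1 - q)\<^sup>2) ^ (P - s))"
      using s by (simp add: bwt_0) (simp add: bwt_def Bernstein_def q_def[symmetric] power2_eq_square power_mult_distrib)
  qed
  also have "\<dots> = 2 ^ P * (q\<^sup>2 + (1 - q)\<^sup>2) ^ P"
    by (simp add: sum_distrib_left[symmetric] binomial_ring)
  also have "\<dots> = (2 * (q\<^sup>2 + (1 - q)\<^sup>2)) ^ P" by (simp only: power_mult_distrib)
  also have "2 * (q\<^sup>2 + (1 - q)\<^sup>2) = 1 + y\<^sup>2" by (simp add: q_def power2_eq_square field_simps)
  finally show ?thesis .
qed

lemma sum_bwt_exp: "P \<ge> 1 \<Longrightarrow> (\<Sum>s\<le>P. bwt P 0 s * exp (a * bval P s)) \<le> exp (a\<^sup>2 / (2 * real P))"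
proof -
  assume P: "P \<ge> 1"
  let ?u = "exp (a / real P) / 2" and ?v = "exp (- a / real P) / 2"
  have "(\<Sum>s\<le>P. bwt P 0 s * exp (a * bval P s)) = (\<Sum>s\<le>P. real (P choose s) * ?u ^ s * ?v ^ (P - s))"
  proof (rule sum.cong[OF refl])
    fix s assume "s \<in> {..P}"
    then have s: "s \<le> P" by simp
    have "a * bval P s = real s * (a / real P) + real (P - s) * (- a / real P)"
      using P s by (simp add: bval_def of_nat_diff field_simps)
    then have "exp (a * bval P s) = exp (a / real P) ^ s * exp (- a / real P) ^ (P - s)"
      by (simp only: exp_add exp_of_nat_mult)
    then show "bwt P 0 s * exp (a * bval P s) = real (P choose s) * ?u ^ s * ?v ^ (P - s)"
      using s by (simp add: bwt_0 power_divide flip: power_add)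
  qed
  also have "\<dots> = cosh (a / real P) ^ P" by (simp add: binomial_ring[symmetric] cosh_field_def add_divide_distrib)
  also have "\<dots> \<le> exp ((a / real P)\<^sup>2 / 2) ^ P"
    using cosh_real_pos[of "a / real P"] by (intro power_mono cosh_le_exp less_imp_le)
  also have "\<dots> = exp (a\<^sup>2 / (2 * real P))"
    using P by (simp add: exp_of_nat_mult[symmetric] power2_eq_square)
  finally show ?thesis .
qed

text \<open>Independent binomial counts indexed by \<open>C\<close>, where \<open>y c\<close> is the
  mean of the normalized value at \<open>c\<close>.\<close>

definition rexp :: "nat \<Rightarrow> 'c set \<Rightarrow> ('c \<Rightarrow> real) \<Rightarrow> (('c \<Rightarrow> nat) \<Rightarrow> real) \<Rightarrow> real" where
  "rexp P C y g = (\<Sum>w\<in>C \<rightarrow>\<^sub>E {..P}. (\<Prod>c\<in>C. bwt P (y c) (w c)) * g w)"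

abbreviation rexp0 :: "nat \<Rightarrow> 'c set \<Rightarrow> (('c \<Rightarrow> nat) \<Rightarrow> real) \<Rightarrow> real" where
  "rexp0 P C \<equiv> rexp P C (\<lambda>_. 0)"

lemma rexp_prod:
  assumes "finite C"
  shows "rexp P C y (\<lambda>w. \<Prod>c\<in>C. g c (w c)) = (\<Prod>c\<in>C. \<Sum>s\<le>P. bwt P (y c) s * g c s)"
  unfolding rexp_def by (subst prod_sum_PiE) (auto simp: assms prod.distrib)

lemma rexp_add: "rexp P C y (\<lambda>w. f w + g w) = rexp P C y f + rexp P C y g"
  by (simp add: rexp_def sum.distrib distrib_left)

lemma rexp_cmult: "rexp P C y (\<lambda>w. a * g w) = a * rexp P C y g"
  by (simp add: rexp_def sum_distrib_left mult.left_commute)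

lemma rexp_diff: "rexp P C y (\<lambda>w. f w - g w) = rexp P C y f - rexp P C y g"
  using rexp_add[of P C y f "\<lambda>w. (-1) * g w"] by (simp only: rexp_cmult) simp

lemma rexp_sum: "rexp P C y (\<lambda>w. \<Sum>i\<in>A. f i w) = (\<Sum>i\<in>A. rexp P C y (f i))"
  unfolding rexp_def sum_distrib_left by (rule sum.swap)

lemma rexp_swap: "rexp P C y (\<lambda>w. rexp Q D z (\<lambda>\<eta>. f w \<eta>)) = rexp Q D z (\<lambda>\<eta>. rexp P C y (\<lambda>w. f w \<eta>))"
  unfolding rexp_def sum_distrib_left by (subst sum.swap) (simp add: mult.left_commute)

lemma rexp_const [simp]: "finite C \<Longrightarrow> rexp P C y (\<lambda>_. a) = a"
proof -
  assume C: "finite C"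
  have "rexp P C y (\<lambda>_. 1) = 1" using rexp_prod[OF C, of P y "\<lambda>_ _. 1"] by simp
  then show ?thesis using rexp_cmult[of P C y a "\<lambda>_. 1"] by simp
qed

lemma rexp_mono:
  assumes "\<And>c. c \<in> C \<Longrightarrow> \<bar>y c\<bar> \<le> 1" "\<And>w. w \<in> C \<rightarrow>\<^sub>E {..P} \<Longrightarrow> f w \<le> g w"
  shows "rexp P C y f \<le> rexp P C y g"
  unfolding rexp_def using assms by (intro sum_mono mult_left_mono prod_nonneg) (auto intro: bwt_nonneg)

lemma rexp_cong:
  assumes "\<And>w. w \<in> C \<rightarrow>\<^sub>E {..P} \<Longrightarrow> f w = g w"
  shows "rexp P C y f = rexp P C y g"
  unfolding rexp_def using assms by (intro sum.cong) auto

text \<open>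
  The chi-square divergence between the biased and the unbiased law turns expectations under the
  former into expectations under the latter.
\<close>

lemma rexp_change_of_measure:
  assumes C: "finite C"
  shows "(rexp P C y \<psi>)\<^sup>2 \<le> exp (real P * (\<Sum>c\<in>C. (y c)\<^sup>2)) * rexp0 P C (\<lambda>w. (\<psi> w)\<^sup>2)"
proof -
  let ?S = "C \<rightarrow>\<^sub>E {..P}"
  define w0 where "w0 w = (\<Prod>c\<in>C. bwt P 0 (w c))" for w
  define w1 where "w1 w = (\<Prod>c\<in>C. bwt P (y c) (w c))" for w
  have w0: "w0 w > 0" if "w \<in> ?S" for w
    unfolding w0_def using that by (intro prod_pos) (auto simp: PiE_iff bwt_0)
  have "(rexp P C y \<psi>)\<^sup>2 = (\<Sum>w\<in>?S. (w1 w / sqrt (w0 w)) * (sqrt (w0 w) * \<psi> w))\<^sup>2"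
    unfolding rexp_def w1_def[symmetric] using w0
    by (intro arg_cong[where f = "\<lambda>x. x\<^sup>2"] sum.cong refl) (auto simp: less_le)
  also have "\<dots> \<le> (\<Sum>w\<in>?S. (w1 w / sqrt (w0 w))\<^sup>2) * (\<Sum>w\<in>?S. (sqrt (w0 w) * \<psi> w)\<^sup>2)"
    by (rule Cauchy_Schwarz_ineq_sum)
  also have "(\<Sum>w\<in>?S. (w1 w / sqrt (w0 w))\<^sup>2) = (\<Sum>w\<in>?S. \<Prod>c\<in>C. (bwt P (y c) (w c))\<^sup>2 / bwt P 0 (w c))"
    using w0 by (intro sum.cong refl)
      (auto simp: power_divide less_imp_le w1_def w0_def prod_power_distrib prod_dividef)
  also have "\<dots> = (\<Prod>c\<in>C. \<Sum>s\<le>P. (bwt P (y c) s)\<^sup>2 / bwt P 0 s)"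
    using C by (subst prod_sum_PiE) auto
  also have "\<dots> = (\<Prod>c\<in>C. (1 + (y c)\<^sup>2) ^ P)" by (simp add: sum_bwt_chi)
  also have "(\<Sum>w\<in>?S. (sqrt (w0 w) * \<psi> w)\<^sup>2) = rexp0 P C (\<lambda>w. (\<psi> w)\<^sup>2)"
    unfolding rexp_def w0_def[symmetric] using w0 by (intro sum.cong refl) (simp add: power_mult_distrib less_imp_le)
  also have "(\<Prod>c\<in>C. (1 + (y c)\<^sup>2) ^ P) * rexp0 P C (\<lambda>w. (\<psi> w)\<^sup>2)
     \<le> exp (real P * (\<Sum>c\<in>C. (y c)\<^sup>2)) * rexp0 P C (\<lambda>w. (\<psi> w)\<^sup>2)"
  proof (rule mult_right_mono)
    have "(\<Prod>c\<in>C. (1 + (y c)\<^sup>2) ^ P) \<le> (\<Prod>c\<in>C. exp ((y c)\<^sup>2) ^ P)"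
      by (intro prod_mono conjI power_mono exp_ge_add_one_self) auto
    also have "\<dots> = exp (real P * (\<Sum>c\<in>C. (y c)\<^sup>2))"
      using C by (simp add: exp_sum exp_of_nat_mult prod_power_distrib)
    finally show "(\<Prod>c\<in>C. (1 + (y c)\<^sup>2) ^ P) \<le> exp (real P * (\<Sum>c\<in>C. (y c)\<^sup>2))" .
    have "rexp0 P C (\<lambda>_. 0) \<le> rexp0 P C (\<lambda>w. (\<psi> w)\<^sup>2)" by (rule rexp_mono) auto
    then show "0 \<le> rexp0 P C (\<lambda>w. (\<psi> w)\<^sup>2)" by (simp add: rexp_def)
  qed
  finally show ?thesis .
qed

lemma rexp_Jensen_exp:
  assumes C: "finite C" and y: "\<And>c. c \<in> C \<Longrightarrow> \<bar>y c\<bar> \<le> 1"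
  shows "exp (rexp P C y g) \<le> rexp P C y (\<lambda>w. exp (g w))"
proof -
  define m where "m = rexp P C y g"
  have "rexp P C y (\<lambda>w. exp m * (1 - m) + exp m * g w) \<le> rexp P C y (\<lambda>w. exp (g w))"
  proof (rule rexp_mono[OF y])
    fix w
    have "exp m * (1 + (g w - m)) \<le> exp m * exp (g w - m)" by (intro mult_left_mono exp_ge_add_one_self) simp
    also have "\<dots> = exp (g w)" by (simp flip: exp_add)
    finally show "exp m * (1 - m) + exp m * g w \<le> exp (g w)" by (simp add: algebra_simps)
  qed
  moreover have "rexp P C y (\<lambda>w. exp m * (1 - m) + exp m * g w) = exp m * (1 - m) + exp m * m"
    using C by (simp only: rexp_add rexp_cmult rexp_const m_def)
  ultimately show ?thesis by (simp add: m_def[symmetric] algebra_simps)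
qed

text \<open>A variational inequality of Donsker-Varadhan type: a biased mean is paid for by an
  unbiased exponential moment. The factor 2 is the square from Cauchy-Schwarz.\<close>

lemma rexp_exp_change_of_measure:
  assumes C: "finite C" and y: "\<And>c. c \<in> C \<Longrightarrow> \<bar>y c\<bar> \<le> 1"
  shows "exp (2 * rexp P C y g) \<le> exp (real P * (\<Sum>c\<in>C. (y c)\<^sup>2)) * rexp0 P C (\<lambda>w. exp (2 * g w))"
proof -
  have "exp (2 * rexp P C y g) = (exp (rexp P C y g))\<^sup>2" by (simp add: exp_double)
  also have "\<dots> \<le> (rexp P C y (\<lambda>w. exp (g w)))\<^sup>2" by (intro power_mono rexp_Jensen_exp C y) auto
  also have "\<dots> \<le> exp (real P * (\<Sum>c\<in>C. (y c)\<^sup>2)) * rexp0 P C (\<lambda>w. (exp (g w))\<^sup>2)"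
    by (rule rexp_change_of_measure[OF C])
  finally show ?thesis by (simp add: exp_double)
qed

lemma rexp_square_le:
  assumes C: "finite C" and y: "\<And>c. c \<in> C \<Longrightarrow> \<bar>y c\<bar> \<le> 1"
  shows "(rexp P C y g)\<^sup>2 \<le> rexp P C y (\<lambda>w. (g w)\<^sup>2)"
proof -
  define m where "m = rexp P C y g"
  have "rexp P C y (\<lambda>_. 0) \<le> rexp P C y (\<lambda>w. (g w - m)\<^sup>2)" by (rule rexp_mono[OF y]) auto
  also have "(\<lambda>w. (g w - m)\<^sup>2) = (\<lambda>w. (g w)\<^sup>2 - 2 * m * g w + m\<^sup>2)" by (auto simp: power2_eq_square algebra_simps)
  also have "rexp P C y (\<lambda>w. (g w)\<^sup>2 - 2 * m * g w + m\<^sup>2) = rexp P C y (\<lambda>w. (g w)\<^sup>2) - m\<^sup>2"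
    using C by (simp add: rexp_add rexp_diff rexp_cmult m_def[symmetric] power2_eq_square)
  finally show ?thesis using C by (simp add: m_def)
qed

lemma rexp_power_le:
  assumes C: "finite C" and y: "\<And>c. c \<in> C \<Longrightarrow> \<bar>y c\<bar> \<le> 1" and "0 \<le> rexp P C y g"
  shows "rexp P C y g ^ (2 ^ j) \<le> rexp P C y (\<lambda>w. g w ^ (2 ^ j))"
proof (induction j)
  case (Suc j)
  have "rexp P C y g ^ (2 ^ Suc j) = (rexp P C y g ^ (2 ^ j))\<^sup>2" by (simp only: power_mult[symmetric] power_Suc2)
  also have "\<dots> \<le> (rexp P C y (\<lambda>w. g w ^ (2 ^ j)))\<^sup>2" using Suc assms by (intro power_mono) auto
  also have "\<dots> \<le> rexp P C y (\<lambda>w. (g w ^ (2 ^ j))\<^sup>2)" by (rule rexp_square_le[OF C y])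
  also have "(\<lambda>w. (g w ^ (2 ^ j))\<^sup>2) = (\<lambda>w. g w ^ (2 ^ Suc j))" by (simp only: power_mult[symmetric] power_Suc2)
  finally show ?case .
qed simp

lemma rexp_coordinate:
  assumes C: "finite C" and c: "c \<in> C" and P: "P \<ge> 1"
  shows "rexp P C y (\<lambda>w. bval P (w c)) = y c"
proof -
  have "rexp P C y (\<lambda>w. bval P (w c)) = rexp P C y (\<lambda>w. \<Prod>d\<in>C. if d = c then bval P (w d) else 1)"
    using C c by (intro rexp_cong) simp
  also have "\<dots> = (\<Prod>d\<in>C. \<Sum>s\<le>P. bwt P (y d) s * (if d = c then bval P s else 1))"
    by (rule rexp_prod[OF C, where g = "\<lambda>d s. if d = c then bval P s else 1"])
  also have "\<dots> = (\<Prod>d\<in>C. if d = c then y d else 1)"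
    by (intro prod.cong refl) (simp add: sum_bwt_bval[OF P])
  finally show ?thesis using C c by simp
qed

lemma rexp_mgf:
  assumes C: "finite C" and P: "P \<ge> 1"
  shows "rexp0 P C (\<lambda>w. exp (\<Sum>c\<in>C. a c * bval P (w c))) \<le> exp ((\<Sum>c\<in>C. (a c)\<^sup>2) / (2 * real P))"
proof -
  have "rexp0 P C (\<lambda>w. exp (\<Sum>c\<in>C. a c * bval P (w c))) = rexp0 P C (\<lambda>w. \<Prod>c\<in>C. exp (a c * bval P (w c)))"
    using C by (simp add: exp_sum)
  also have "\<dots> = (\<Prod>c\<in>C. \<Sum>s\<le>P. bwt P 0 s * exp (a c * bval P s))"
    by (rule rexp_prod[OF C, where g = "\<lambda>c s. exp (a c * bval P s)"])
  also have "\<dots> \<le> (\<Prod>c\<in>C. exp ((a c)\<^sup>2 / (2 * real P)))"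
    by (intro prod_mono conjI sum_bwt_exp P sum_nonneg mult_nonneg_nonneg bwt_nonneg) auto
  also have "\<dots> = exp ((\<Sum>c\<in>C. (a c)\<^sup>2) / (2 * real P))" using C by (simp add: exp_sum sum_divide_distrib)
  finally show ?thesis .
qed

text \<open>Biasing the signs towards \<open>v / |v|\<close> gives the linear form the mean
  \<open>|v|\<close>. Since this direction is a unit vector, removing the bias costs exactly
  \<open>exp P\<close>.\<close>

lemma norm_power_le_rexp:
  assumes C: "finite C" and P: "P \<ge> 1"
  shows "(\<Sum>c\<in>C. (v c)\<^sup>2) ^ (2 ^ j) \<le> exp (real P) * rexp0 P C (\<lambda>w. (\<Sum>c\<in>C. v c * bval P (w c)) ^ (2 ^ Suc j))"
proof -
  define g where "g w = (\<Sum>c\<in>C. v c * bval P (w c))" for w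
  define r where "r = L2_set v C"
  have r2: "r\<^sup>2 = (\<Sum>c\<in>C. (v c)\<^sup>2)" by (simp add: r_def L2_set_def sum_nonneg)
  have nn: "0 \<le> rexp0 P C (\<lambda>w. g w ^ (2 ^ Suc j))"
  proof -
    have "rexp0 P C (\<lambda>_. 0) \<le> rexp0 P C (\<lambda>w. g w ^ (2 ^ Suc j))"
      by (rule rexp_mono) (auto simp: zero_le_even_power)
    then show ?thesis by (simp add: rexp_def)
  qed
  show ?thesis
  proof (cases "r = 0")
    case True
    then have "(\<Sum>c\<in>C. (v c)\<^sup>2) = 0" using r2 by simp
    then show ?thesis using nn by (simp add: g_def zero_power)
  next
    case False
    then have r: "r > 0" by (simp add: r_def less_le)
    define y where "y c = v c / r" for c
    have sy: "(\<Sum>c\<in>C. (y c)\<^sup>2) = 1" using r by (simp add: y_def power_divide sum_divide_distrib[symmetric] r2[symmetric])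
    have y: "\<bar>y c\<bar> \<le> 1" if "c \<in> C" for c
      using member_le_sum[OF that, of "\<lambda>c. (y c)\<^sup>2"] C by (simp add: sy abs_square_le_1)
    have "rexp P C y g = (\<Sum>c\<in>C. v c * y c)"
      unfolding g_def rexp_sum rexp_cmult by (intro sum.cong refl) (simp add: rexp_coordinate[OF C _ P])
    also have "\<dots> = (\<Sum>c\<in>C. (v c)\<^sup>2) / r" by (simp add: y_def sum_divide_distrib power2_eq_square)
    also have "\<dots> = r" unfolding r2[symmetric] using r by (simp add: power2_eq_square)
    finally have e: "rexp P C y g = r" .
    have "(\<Sum>c\<in>C. (v c)\<^sup>2) ^ (2 ^ j) = (r ^ (2 ^ j))\<^sup>2" by (simp add: r2[symmetric] power_mult[symmetric] mult.commute)
    also have "\<dots> \<le> (rexp P C y (\<lambda>w. g w ^ (2 ^ j)))\<^sup>2"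
      using rexp_power_le[OF C y, where P = P and g = g and j = j] e r by (intro power_mono) auto
    also have "\<dots> \<le> exp (real P * (\<Sum>c\<in>C. (y c)\<^sup>2)) * rexp0 P C (\<lambda>w. (g w ^ (2 ^ j))\<^sup>2)"
      by (rule rexp_change_of_measure[OF C])
    also have "(\<lambda>w. (g w ^ (2 ^ j))\<^sup>2) = (\<lambda>w. g w ^ (2 ^ Suc j))" by (simp only: power_mult[symmetric] power_Suc2)
    finally show ?thesis by (simp add: sy g_def)
  qed
qed

subsection \<open>Norms of contracted tensors\<close>

text \<open>Distinct blocks read distinct coordinates, so the factors are independent and only means
  appear.\<close>

lemma rexp_block_prod:
  assumes I: "finite I" "\<And>J. J \<in> I \<Longrightarrow> finite (T J)" and P: "P \<ge> 1"
    and a: "\<And>J. J \<in> I \<Longrightarrow> a J \<in> T J"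
  shows "rexp P (Sigma I T) y (\<lambda>w. \<Prod>J\<in>I. bval P (w (J, a J))) = (\<Prod>J\<in>I. y (J, a J))"
proof -
  have C: "finite (Sigma I T)" using I by auto
  let ?g = "\<lambda>c s. if snd c = a (fst c) then bval P s else 1"
  have "rexp P (Sigma I T) y (\<lambda>w. \<Prod>J\<in>I. bval P (w (J, a J))) = rexp P (Sigma I T) y (\<lambda>w. \<Prod>c\<in>Sigma I T. ?g c (w c))"
  proof (rule rexp_cong)
    fix w
    have "(\<Prod>c\<in>Sigma I T. ?g c (w c)) = (\<Prod>J\<in>I. \<Prod>j\<in>T J. if j = a J then bval P (w (J, j)) else 1)"
      using I by (subst prod.Sigma) (auto intro!: prod.cong)
    also have "\<dots> = (\<Prod>J\<in>I. bval P (w (J, a J)))"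
      using I a by (intro prod.cong refl) (simp add: prod.delta')
    finally show "(\<Prod>J\<in>I. bval P (w (J, a J))) = (\<Prod>c\<in>Sigma I T. ?g c (w c))" ..
  qed
  also have "\<dots> = (\<Prod>c\<in>Sigma I T. \<Sum>s\<le>P. bwt P (y c) s * ?g c s)" by (rule rexp_prod[OF C])
  also have "\<dots> = (\<Prod>c\<in>Sigma I T. if snd c = a (fst c) then y c else 1)"
    by (intro prod.cong refl) (simp add: sum_bwt_bval[OF P])
  also have "\<dots> = (\<Prod>J\<in>I. \<Prod>j\<in>T J. if j = a J then y (J, j) else 1)"
    using I by (subst prod.Sigma) (auto intro!: prod.cong)
  also have "\<dots> = (\<Prod>J\<in>I. y (J, a J))"
    using I a by (intro prod.cong refl) (simp add: prod.delta')
  finally show ?thesis .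
qed

text \<open>Within a block the two factors are independent unless they read the same coordinate, in
  which case a variance of at most \<open>1 / P\<close> is added.\<close>

lemma rexp_block_prod2:
  assumes I: "finite I" "\<And>J. J \<in> I \<Longrightarrow> finite (T J)" and P: "P \<ge> 1"
    and a: "\<And>J. J \<in> I \<Longrightarrow> a J \<in> T J" and b: "\<And>J. J \<in> I \<Longrightarrow> b J \<in> T J"
  shows "rexp P (Sigma I T) y (\<lambda>w. \<Prod>J\<in>I. bval P (w (J, a J)) * bval P (w (J, b J)))
    = (\<Prod>J\<in>I. y (J, a J) * y (J, b J) + (if a J = b J then (1 - (y (J, a J))\<^sup>2) / real P else 0))"
proof -
  have C: "finite (Sigma I T)" using I by auto
  let ?g = "\<lambda>c s. (if snd c = a (fst c) then bval P s else 1) * (if snd c = b (fst c) then bval P s else 1)"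
  let ?m = "\<lambda>c. \<Sum>s\<le>P. bwt P (y c) s * ?g c s"
  have "rexp P (Sigma I T) y (\<lambda>w. \<Prod>J\<in>I. bval P (w (J, a J)) * bval P (w (J, b J)))
     = rexp P (Sigma I T) y (\<lambda>w. \<Prod>c\<in>Sigma I T. ?g c (w c))"
  proof (rule rexp_cong)
    fix w
    have "(\<Prod>c\<in>Sigma I T. ?g c (w c)) = (\<Prod>J\<in>I. \<Prod>j\<in>T J. (if j = a J then bval P (w (J, j)) else 1) * (if j = b J then bval P (w (J, j)) else 1))"
      using I by (subst prod.Sigma) (auto intro!: prod.cong)
    also have "\<dots> = (\<Prod>J\<in>I. bval P (w (J, a J)) * bval P (w (J, b J)))"
      using I a b by (intro prod.cong refl) (simp add: prod.delta' prod.distrib)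
    finally show "(\<Prod>J\<in>I. bval P (w (J, a J)) * bval P (w (J, b J))) = (\<Prod>c\<in>Sigma I T. ?g c (w c))" ..
  qed
  also have "\<dots> = (\<Prod>c\<in>Sigma I T. ?m c)" by (rule rexp_prod[OF C])
  also have "\<dots> = (\<Prod>J\<in>I. \<Prod>j\<in>T J. ?m (J, j))"
    using I by (subst prod.Sigma) (auto intro!: prod.cong)
  also have "\<dots> = (\<Prod>J\<in>I. y (J, a J) * y (J, b J) + (if a J = b J then (1 - (y (J, a J))\<^sup>2) / real P else 0))"
  proof (rule prod.cong[OF refl])
    fix J assume J: "J \<in> I"
    have fT: "finite (T J)" and aJ: "a J \<in> T J" and bJ: "b J \<in> T J" using I a b J by auto
    show "(\<Prod>j\<in>T J. ?m (J, j)) = y (J, a J) * y (J, b J) + (if a J = b J then (1 - (y (J, a J))\<^sup>2) / real P else 0)"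
    proof (cases "a J = b J")
      case True
      have "(\<Prod>j\<in>T J. ?m (J, j)) = (\<Prod>j\<in>T J. if j = a J then (y (J, j))\<^sup>2 + (1 - (y (J, j))\<^sup>2) / real P else 1)"
        by (intro prod.cong refl) (simp add: True sum_bwt_bval2[OF P])
      then show ?thesis using True fT aJ by (simp add: prod.delta' power2_eq_square)
    next
      case False
      have "(\<Prod>j\<in>T J. ?m (J, j)) = (\<Prod>j\<in>T J. (if j = a J then y (J, j) else 1) * (if j = b J then y (J, j) else 1))"
        by (intro prod.cong refl) (use False in \<open>auto simp: sum_bwt_bval[OF P]\<close>)
      then show ?thesis using False fT aJ bJ by (simp add: prod.delta' prod.distrib)
    qed
  qed
  finally show ?thesis .
qed

lemma sum_pairs_same_fibre:
  fixes f :: "'a \<Rightarrow> real"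
  assumes X: "finite X" and Z: "finite Z" "\<And>q. q \<in> X \<Longrightarrow> r q \<in> Z"
  shows "(\<Sum>q\<in>X. \<Sum>q'\<in>X. if r q = r q' then f q * f q' * V (r q) else 0)
    = (\<Sum>z\<in>Z. V z * (\<Sum>q\<in>{q\<in>X. r q = z}. f q)\<^sup>2)"
proof -
  have "(\<Sum>z\<in>Z. V z * (\<Sum>q\<in>{q\<in>X. r q = z}. f q)\<^sup>2)
    = (\<Sum>z\<in>Z. \<Sum>q\<in>X. \<Sum>q'\<in>X. if r q = z \<and> r q' = z then f q * f q' * V z else 0)"
  proof (rule sum.cong[OF refl])
    fix z
    have "(\<Sum>q\<in>{q\<in>X. r q = z}. f q) = (\<Sum>q\<in>X. if r q = z then f q else 0)"
      using X by (simp add: sum.inter_filter)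
    then have "V z * (\<Sum>q\<in>{q\<in>X. r q = z}. f q)\<^sup>2 = V z * (\<Sum>q\<in>X. \<Sum>q'\<in>X. (if r q = z then f q else 0) * (if r q' = z then f q' else 0))"
      by (simp add: power2_eq_square sum_product)
    also have "\<dots> = (\<Sum>q\<in>X. \<Sum>q'\<in>X. if r q = z \<and> r q' = z then f q * f q' * V z else 0)"
      unfolding sum_distrib_left by (intro sum.cong refl) auto
    finally show "V z * (\<Sum>q\<in>{q\<in>X. r q = z}. f q)\<^sup>2 = (\<Sum>q\<in>X. \<Sum>q'\<in>X. if r q = z \<and> r q' = z then f q * f q' * V z else 0)" .
  qed
  also have "\<dots> = (\<Sum>q\<in>X. \<Sum>q'\<in>X. \<Sum>z\<in>Z. if r q = z \<and> r q' = z then f q * f q' * V z else 0)"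
    by (subst sum.swap, intro sum.cong refl, subst sum.swap, rule refl)
  also have "\<dots> = (\<Sum>q\<in>X. \<Sum>q'\<in>X. if r q = r q' then f q * f q' * V (r q) else 0)"
  proof (intro sum.cong refl)
    fix q q' assume q: "q \<in> X" "q' \<in> X"
    have "(\<Sum>z\<in>Z. if r q = z \<and> r q' = z then f q * f q' * V z else 0) = (\<Sum>z\<in>Z. if z = r q then (if r q = r q' then f q * f q' * V z else 0) else 0)"
      by (intro sum.cong refl) auto
    also have "\<dots> = (if r q = r q' then f q * f q' * V (r q) else 0)"
      using Z q by simp
    finally show "(\<Sum>z\<in>Z. if r q = z \<and> r q' = z then f q * f q' * V z else 0) = (if r q = r q' then f q * f q' * V (r q) else 0)" .
  qed
  finally show ?thesis ..
qed

section \<open>Partition norms as suprema of multilinear forms\<close>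

definition unit_arrays :: "nat \<Rightarrow> nat set set \<Rightarrow> (nat set \<Rightarrow> (nat \<Rightarrow> nat) \<Rightarrow> real) set" where
  "unit_arrays n I = {x. \<forall>J\<in>I. L2_set (x J) (J \<rightarrow>\<^sub>E {1..n}) \<le> 1}"

definition multiform :: "nat \<Rightarrow> nat \<Rightarrow> nat set set \<Rightarrow> ((nat \<Rightarrow> nat) \<Rightarrow> real) \<Rightarrow> (nat set \<Rightarrow> (nat \<Rightarrow> nat) \<Rightarrow> real) \<Rightarrow> real" where
  "multiform n k I A x = (\<Sum>\<iota>\<in>{1..k} \<rightarrow>\<^sub>E {1..n}. A \<iota> * (\<Prod>J\<in>I. x J (restrict \<iota> J)))"

lemma partition_norm_eq: "partition_norm n k I A = (SUP x\<in>unit_arrays n I. multiform n k I A x)"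
  by (simp add: partition_norm_def unit_arrays_def multiform_def)

lemma finite_multi [simp]: "finite K \<Longrightarrow> finite (K \<rightarrow>\<^sub>E {m..n::nat})"
  by (intro finite_PiE) auto

lemma partition_facts:
  assumes "I \<in> partitions k"
  shows "finite I" "J \<in> I \<Longrightarrow> J \<subseteq> {1..k}" "J \<in> I \<Longrightarrow> finite J" "J \<in> I \<Longrightarrow> J \<noteq> {}" "\<Union>I = {1..k}"
    "disjoint I" "card I \<le> k"
proof -
  have p: "partition_on {1..k} I" using assms by (simp add: partitions_def)
  show f: "finite I" using p finite_elements[of "{1..k}"] by simp
  show U: "\<Union>I = {1..k}" using p by (simp add: partition_on_def)
  then show s: "J \<in> I \<Longrightarrow> J \<subseteq> {1..k}" for J by auto
  then show fJ: "J \<in> I \<Longrightarrow> finite J" for J using finite_subset by blast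
  show ne: "J \<in> I \<Longrightarrow> J \<noteq> {}" for J using p by (auto simp: partition_on_def)
  show d: "disjoint I" using p by (simp add: partition_on_def)
  have "card (\<Union>I) = (\<Sum>J\<in>I. card J)"
    using fJ d by (intro card_Union_disjoint) (auto simp: disjoint_def pairwise_def disjnt_def)
  moreover have "(\<Sum>J\<in>I. 1) \<le> (\<Sum>J\<in>I. card J)"
    by (intro sum_mono) (use fJ ne in \<open>simp add: Suc_le_eq card_gt_0_iff\<close>)
  ultimately show "card I \<le> k" by (simp add: U)
qed

lemma unit_array_entry:
  assumes "x \<in> unit_arrays n I" "J \<in> I" "finite J" "j \<in> J \<rightarrow>\<^sub>E {1..n}"
  shows "\<bar>x J j\<bar> \<le> 1"
proof -
  have "\<bar>x J j\<bar> \<le> L2_set (x J) (J \<rightarrow>\<^sub>E {1..n})"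
    using member_le_L2_set[of "J \<rightarrow>\<^sub>E {1..n}" j "\<lambda>j. \<bar>x J j\<bar>"] assms by (simp add: L2_set_def)
  then show ?thesis using assms by (auto simp: unit_arrays_def intro: order.trans)
qed

lemma restrict_multi: "\<iota> \<in> K \<rightarrow>\<^sub>E N \<Longrightarrow> J \<subseteq> K \<Longrightarrow> restrict \<iota> J \<in> J \<rightarrow>\<^sub>E N"
  by (auto simp: PiE_iff)

lemma multiform_le_norm:
  assumes I: "I \<in> partitions k" and x: "x \<in> unit_arrays n I"
  shows "multiform n k I A x \<le> partition_norm n k I A"
  unfolding partition_norm_eq
proof (rule cSUP_upper[OF x])
  have "multiform n k I A x \<le> (\<Sum>\<iota>\<in>{1..k} \<rightarrow>\<^sub>E {1..n}. \<bar>A \<iota>\<bar>)" if x: "x \<in> unit_arrays n I" for x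
    unfolding multiform_def
  proof (rule sum_mono)
    fix \<iota> assume \<iota>: "\<iota> \<in> {1..k} \<rightarrow>\<^sub>E {1..n}"
    have "\<bar>\<Prod>J\<in>I. x J (restrict \<iota> J)\<bar> \<le> 1"
      unfolding abs_prod using partition_facts[OF I] \<iota>
      by (intro prod_le_1 conjI unit_array_entry[OF x] restrict_multi[OF \<iota>]) auto
    then have "\<bar>A \<iota> * (\<Prod>J\<in>I. x J (restrict \<iota> J))\<bar> \<le> \<bar>A \<iota>\<bar>"
      unfolding abs_mult by (intro mult_left_le) auto
    then show "A \<iota> * (\<Prod>J\<in>I. x J (restrict \<iota> J)) \<le> \<bar>A \<iota>\<bar>" by linarith
  qed
  then show "bdd_above (multiform n k I A ` unit_arrays n I)" by (intro bdd_aboveI2)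
qed

text \<open>These are the partitions that occur in the variance of a randomized form:
  \<open>S\<close> collects the blocks contributing a variance, and they are glued to the contracted
  index \<open>Suc k\<close>.\<close>

definition join_blocks :: "nat \<Rightarrow> nat set set \<Rightarrow> nat set set \<Rightarrow> nat set set" where
  "join_blocks k I S = insert (insert (Suc k) (\<Union>S)) (I - S)"

lemma join_blocks_fresh:
  assumes "I \<in> partitions k"
  shows "insert (Suc k) (\<Union>S) \<notin> I - S"
  using partition_facts(2)[OF assms] by (metis DiffD1 atLeastAtMost_iff insertI1 not_less_eq_eq order_refl subset_iff)

lemma join_blocks_partition:
  assumes I: "I \<in> partitions k" and S: "S \<subseteq> I"
  shows "join_blocks k I S \<in> partitions (Suc k)"
proof -
  note f = partition_facts[OF I]
  have dj: "J \<inter> J' = {}" if "J \<in> I" "J' \<in> I" "J \<noteq> J'" for J J'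
    using f(6) that by (auto simp: disjoint_def)
  have fresh: "Suc k \<notin> J" if "J \<in> I" for J using f(2)[OF that] by auto
  have "\<Union>(join_blocks k I S) = insert (Suc k) (\<Union>I)"
    using S by (auto simp: join_blocks_def)
  then have U: "\<Union>(join_blocks k I S) = {1..Suc k}" using f(5) by auto
  have ne: "{} \<notin> join_blocks k I S" using f(4) by (auto simp: join_blocks_def)
  have D: "J \<inter> J' = {}" if JJ: "J \<in> join_blocks k I S" "J' \<in> join_blocks k I S" "J \<noteq> J'" for J J'
  proof -
    have key: "insert (Suc k) (\<Union>S) \<inter> L = {}" if "L \<in> I - S" for L
      using that S dj fresh by blast
    show ?thesis using JJ key dj unfolding join_blocks_def by blast
  qed
  show ?thesis
    unfolding partitions_def partition_on_def disjoint_def using U ne D by auto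
qed

lemma join_blocks_card:
  assumes I: "I \<in> partitions k" and S: "S \<subseteq> I"
  shows "card (join_blocks k I S) + card S = card I + 1"
proof -
  have fin: "finite I" by (rule partition_facts[OF I])
  then have "card (join_blocks k I S) = Suc (card (I - S))"
    unfolding join_blocks_def using join_blocks_fresh[OF I] by (intro card_insert_disjoint) auto
  moreover have "card (I - S) + card S = card I"
    using fin S by (metis card_Diff_subset card_mono finite_subset le_add_diff_inverse2)
  ultimately show ?thesis by simp
qed

text \<open>Duality for the Euclidean norm: the normalized vector of fibre sums is itself an
  admissible array for the merged block, and the form evaluated there equals the norm of that
  vector.\<close>

lemma multiform_sum_squares_le:
  assumes I: "I \<in> partitions k" and S: "S \<subseteq> I" and x: "x \<in> unit_arrays n I"
    and U: "U = insert (Suc k) (\<Union>S)" and D: "partition_norm n (Suc k) (join_blocks k I S) A \<le> D" "0 \<le> D"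
  shows "(\<Sum>z\<in>U \<rightarrow>\<^sub>E {1..n}. (\<Sum>q\<in>{q \<in> {1..Suc k} \<rightarrow>\<^sub>E {1..n}. restrict q U = z}. A q * (\<Prod>J\<in>I - S. x J (restrict q J)))\<^sup>2) \<le> D\<^sup>2"
proof -
  let ?X = "{1..Suc k} \<rightarrow>\<^sub>E {1..n}" and ?Z = "U \<rightarrow>\<^sub>E {1..n}"
  note f = partition_facts[OF I]
  define F where "F q = A q * (\<Prod>J\<in>I - S. x J (restrict q J))" for q
  define c where "c z = (\<Sum>q\<in>{q \<in> ?X. restrict q U = z}. F q)" for z
  define r where "r = L2_set c ?Z"
  have r2: "r\<^sup>2 = (\<Sum>z\<in>?Z. (c z)\<^sup>2)" by (simp add: r_def L2_set_def sum_nonneg)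
  have UK: "U \<subseteq> {1..Suc k}" unfolding U using S f(2) by fastforce
  have finU: "finite U" using UK finite_subset by blast
  have Ufresh: "U \<notin> I - S" unfolding U by (rule join_blocks_fresh[OF I])
  have "r \<le> D"
  proof (cases "r = 0")
    case False
    then have r: "r > 0" by (simp add: r_def less_le)
    define y where "y J = (if J = U then (\<lambda>z. c z / r) else x J)" for J
    have "L2_set (\<lambda>z. c z / r) ?Z = 1"
    proof -
      have "(\<Sum>z\<in>?Z. (c z / r)\<^sup>2) = (\<Sum>z\<in>?Z. (c z)\<^sup>2) / r\<^sup>2" by (simp add: power_divide sum_divide_distrib)
      also have "\<dots> = 1" unfolding r2[symmetric] using r by simp
      finally show ?thesis by (simp add: L2_set_def)
    qed
    then have y: "y \<in> unit_arrays n (join_blocks k I S)"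
      using x by (auto simp: unit_arrays_def join_blocks_def U[symmetric] y_def)
    have "multiform n (Suc k) (join_blocks k I S) A y = (\<Sum>q\<in>?X. F q * (c (restrict q U) / r))"
      unfolding multiform_def
    proof (rule sum.cong[OF refl])
      fix q
      have "(\<Prod>J\<in>join_blocks k I S. y J (restrict q J)) = y U (restrict q U) * (\<Prod>J\<in>I - S. y J (restrict q J))"
        unfolding join_blocks_def U[symmetric] using f(1) Ufresh by (intro prod.insert) auto
      also have "(\<Prod>J\<in>I - S. y J (restrict q J)) = (\<Prod>J\<in>I - S. x J (restrict q J))"
        by (intro prod.cong refl) (use Ufresh in \<open>auto simp: y_def\<close>)
      finally have pe: "(\<Prod>J\<in>join_blocks k I S. y J (restrict q J)) = y U (restrict q U) * (\<Prod>J\<in>I - S. x J (restrict q J))" .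
      have "y U (restrict q U) = c (restrict q U) / r" by (simp add: y_def)
      then show "A q * (\<Prod>J\<in>join_blocks k I S. y J (restrict q J)) = F q * (c (restrict q U) / r)"
        unfolding pe F_def by (simp only: mult_ac)
    qed
    also have "\<dots> = (\<Sum>z\<in>?Z. \<Sum>q\<in>{q \<in> ?X. restrict q U = z}. F q * (c (restrict q U) / r))"
      by (rule sum.group[symmetric]) (use finU UK restrict_multi in auto)
    also have "\<dots> = (\<Sum>z\<in>?Z. c z * (c z / r))"
    proof (rule sum.cong[OF refl])
      fix z
      have "(\<Sum>q\<in>{q \<in> ?X. restrict q U = z}. F q * (c (restrict q U) / r)) = (\<Sum>q\<in>{q \<in> ?X. restrict q U = z}. F q * (c z / r))"
        by (rule sum.cong) auto
      then show "(\<Sum>q\<in>{q \<in> ?X. restrict q U = z}. F q * (c (restrict q U) / r)) = c z * (c z / r)"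
        by (simp add: sum_distrib_right[symmetric] c_def[of z] del: times_divide_eq_right)
    qed
    also have "\<dots> = r\<^sup>2 / r" unfolding r2 by (simp add: sum_divide_distrib power2_eq_square)
    also have "\<dots> = r" using r by (simp add: power2_eq_square)
    finally have "multiform n (Suc k) (join_blocks k I S) A y = r" .
    then show ?thesis
      using multiform_le_norm[OF join_blocks_partition[OF I S] y, of A] D by simp
  qed (use D in simp)
  then have "r\<^sup>2 \<le> D\<^sup>2" by (intro power_mono) (auto simp: r_def)
  then show ?thesis unfolding r2 c_def F_def .
qed

lemma sum_rotate: "(\<Sum>a\<in>A. \<Sum>b\<in>B. \<Sum>c\<in>C. f a b c) = (\<Sum>c\<in>C. \<Sum>a\<in>A. \<Sum>b\<in>B. f a b c)"
proof -
  have "(\<Sum>a\<in>A. \<Sum>b\<in>B. \<Sum>c\<in>C. f a b c) = (\<Sum>a\<in>A. \<Sum>c\<in>C. \<Sum>b\<in>B. f a b c)"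
    by (intro sum.cong refl sum.swap)
  then show ?thesis using sum.swap[of "\<lambda>a c. \<Sum>b\<in>B. f a b c" C A] by simp
qed

lemma sum_multi_Suc:
  fixes F :: "(nat \<Rightarrow> nat) \<Rightarrow> real"
  shows "(\<Sum>q\<in>{1..Suc k} \<rightarrow>\<^sub>E N. F q) = (\<Sum>\<iota>\<in>{1..k} \<rightarrow>\<^sub>E N. \<Sum>i\<in>N. F (\<iota>(Suc k := i)))"
proof -
  have e: "{1..Suc k} = insert (Suc k) {1..k}" by auto
  have "(\<Sum>q\<in>{1..Suc k} \<rightarrow>\<^sub>E N. F q) = (\<Sum>(i, \<iota>)\<in>N \<times> ({1..k} \<rightarrow>\<^sub>E N). F (\<iota>(Suc k := i)))"
  proof -
    have "inj_on (\<lambda>(y, g). g(Suc k := y)) (N \<times> ({1..k} \<rightarrow>\<^sub>E N))" by (rule inj_combinator) simp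
    then show ?thesis unfolding e PiE_insert_eq by (simp add: sum.reindex case_prod_unfold)
  qed
  also have "\<dots> = (\<Sum>i\<in>N. \<Sum>\<iota>\<in>{1..k} \<rightarrow>\<^sub>E N. F (\<iota>(Suc k := i)))"
    by (simp add: sum.cartesian_product)
  also have "\<dots> = (\<Sum>\<iota>\<in>{1..k} \<rightarrow>\<^sub>E N. \<Sum>i\<in>N. F (\<iota>(Suc k := i)))" by (rule sum.swap)
  finally show ?thesis .
qed

section \<open>Contraction of a tensor with a random direction\<close>

definition contract :: "nat \<Rightarrow> nat \<Rightarrow> ((nat \<Rightarrow> nat) \<Rightarrow> real) \<Rightarrow> (nat \<Rightarrow> real) \<Rightarrow> (nat \<Rightarrow> nat) \<Rightarrow> real" where
  "contract n k A \<theta> \<iota> = (\<Sum>i\<in>{1..n}. \<theta> i * A (\<iota>(Suc k := i)))"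

text \<open>Coefficient vector of the contracted form as a linear function of the direction; its
  squared length is the variance proxy.\<close>

definition slot :: "nat \<Rightarrow> nat \<Rightarrow> nat set set \<Rightarrow> ((nat \<Rightarrow> nat) \<Rightarrow> real) \<Rightarrow> (nat set \<Rightarrow> (nat \<Rightarrow> nat) \<Rightarrow> real) \<Rightarrow> nat \<Rightarrow> real" where
  "slot n k I A u i = (\<Sum>\<iota>\<in>{1..k} \<rightarrow>\<^sub>E {1..n}. A (\<iota>(Suc k := i)) * (\<Prod>J\<in>I. u J (restrict \<iota> J)))"

lemma multiform_contract: "multiform n k I (contract n k A \<theta>) u = (\<Sum>i\<in>{1..n}. slot n k I A u i * \<theta> i)"
  unfolding multiform_def contract_def slot_def sum_distrib_right
  by (subst sum.swap) (simp add: mult_ac)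

abbreviation rarray :: "nat \<Rightarrow> (nat set \<times> (nat \<Rightarrow> nat) \<Rightarrow> nat) \<Rightarrow> nat set \<Rightarrow> (nat \<Rightarrow> nat) \<Rightarrow> real" where
  "rarray p w J j \<equiv> bval p (w (J, j))"

abbreviation acoords :: "nat \<Rightarrow> nat set set \<Rightarrow> (nat set \<times> (nat \<Rightarrow> nat)) set" where
  "acoords n I \<equiv> Sigma I (\<lambda>J. J \<rightarrow>\<^sub>E {1..n})"

lemma rexp_multiform:
  assumes I: "I \<in> partitions k" and p: "p \<ge> 1"
  shows "rexp p (acoords n I) (\<lambda>(J, j). x J j) (\<lambda>w. multiform n k I A (rarray p w)) = multiform n k I A x"
  unfolding multiform_def rexp_sum rexp_cmult
proof (intro sum.cong refl)
  fix \<iota> assume \<iota>: "\<iota> \<in> {1..k} \<rightarrow>\<^sub>E {1..n}"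
  have "rexp p (acoords n I) (\<lambda>(J, j). x J j) (\<lambda>w. \<Prod>J\<in>I. bval p (w (J, restrict \<iota> J))) = (\<Prod>J\<in>I. (\<lambda>(J, j). x J j) (J, restrict \<iota> J))"
    by (rule rexp_block_prod) (use partition_facts[OF I] p restrict_multi[OF \<iota>] in auto)
  then show "A \<iota> * rexp p (acoords n I) (\<lambda>(J, j). x J j) (\<lambda>w. \<Prod>J\<in>I. bval p (w (J, restrict \<iota> J))) = A \<iota> * (\<Prod>J\<in>I. x J (restrict \<iota> J))"
    by simp
qed

text \<open>Squaring produces pairs of multi-indices with equal last entry, in which each block
  contributes a product of means plus, on agreement, a variance. Expanding the product,
  \<open>S\<close> is the set of blocks that contribute variances: the pair agrees on the merged
  block, whose norm bounds the sum, and each variance gives \<open>1 / p\<close>.\<close>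

lemma rexp_slot_squares:
  assumes I: "I \<in> partitions k" and p: "p \<ge> 1" and x: "x \<in> unit_arrays n I"
    and D: "\<And>S. S \<subseteq> I \<Longrightarrow> partition_norm n (Suc k) (join_blocks k I S) A \<le> D S" "\<And>S. S \<subseteq> I \<Longrightarrow> 0 \<le> D S"
  shows "rexp p (acoords n I) (\<lambda>(J, j). x J j) (\<lambda>w. \<Sum>i\<in>{1..n}. (slot n k I A (rarray p w) i)\<^sup>2)
    \<le> (\<Sum>S\<in>Pow I. (D S)\<^sup>2 / real p ^ card S)"
proof -
  let ?X = "{1..Suc k} \<rightarrow>\<^sub>E {1..n}" and ?E = "rexp p (acoords n I) (\<lambda>(J, j). x J j)"
  note f = partition_facts[OF I]
  have J: "J \<subseteq> {1..k}" "J \<subseteq> {1..Suc k}" "Suc k \<notin> J" if "J \<in> I" for J using f(2)[OF that] by force+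
  have finX: "finite ?X" by simp
  define v where "v J j = (1 - (x J j)\<^sup>2) / real p" for J j
  have v: "0 \<le> v J j" "v J j \<le> 1 / real p" if "J \<in> I" "j \<in> J \<rightarrow>\<^sub>E {1..n}" for J j
  proof -
    have "\<bar>x J j\<bar> \<le> 1" by (rule unit_array_entry[OF x that(1) f(3)[OF that(1)] that(2)])
    then have "(x J j)\<^sup>2 \<le> 1" by (simp add: abs_square_le_1)
    then show "0 \<le> v J j" "v J j \<le> 1 / real p" using p by (auto simp: v_def divide_right_mono)
  qed
  let ?same = "\<lambda>U q q'. restrict q U = restrict q' U"
  let ?t = "\<lambda>q q'. q (Suc k) = q' (Suc k)"
  have sq: "(\<Sum>i\<in>{1..n}. (slot n k I A u i)\<^sup>2) = (\<Sum>q\<in>?X. \<Sum>q'\<in>?X. (if ?t q q' then A q * A q' else 0) * (\<Prod>J\<in>I. u J (restrict q J) * u J (restrict q' J)))" for u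
  proof -
    have sl: "slot n k I A u i = (\<Sum>q\<in>{q\<in>?X. q (Suc k) = i}. A q * (\<Prod>J\<in>I. u J (restrict q J)))" if i: "i \<in> {1..n}" for i
    proof -
      have res: "restrict (\<iota>(Suc k := l)) J = restrict \<iota> J" if "J \<in> I" for \<iota> :: "nat \<Rightarrow> nat" and J l
        using J(3)[OF that] by (auto simp: restrict_def)
      have "(\<Sum>q\<in>{q\<in>?X. q (Suc k) = i}. A q * (\<Prod>J\<in>I. u J (restrict q J))) = (\<Sum>q\<in>?X. if q (Suc k) = i then A q * (\<Prod>J\<in>I. u J (restrict q J)) else 0)"
        by (rule sum.inter_filter[OF finX])
      also have "\<dots> = (\<Sum>\<iota>\<in>{1..k} \<rightarrow>\<^sub>E {1..n}. \<Sum>l\<in>{1..n}. if l = i then A (\<iota>(Suc k := l)) * (\<Prod>J\<in>I. u J (restrict (\<iota>(Suc k := l)) J)) else 0)"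
        unfolding sum_multi_Suc by simp
      also have "\<dots> = slot n k I A u i"
        unfolding slot_def using i by (intro sum.cong refl) (simp add: res)
      finally show ?thesis ..
    qed
    have "(\<Sum>i\<in>{1..n}. (slot n k I A u i)\<^sup>2) = (\<Sum>i\<in>{1..n}. 1 * (\<Sum>q\<in>{q\<in>?X. q (Suc k) = i}. A q * (\<Prod>J\<in>I. u J (restrict q J)))\<^sup>2)"
      by (intro sum.cong refl) (simp add: sl)
    also have "\<dots> = (\<Sum>q\<in>?X. \<Sum>q'\<in>?X. if ?t q q' then (A q * (\<Prod>J\<in>I. u J (restrict q J))) * (A q' * (\<Prod>J\<in>I. u J (restrict q' J))) * 1 else 0)"
      by (rule sum_pairs_same_fibre[OF finX, symmetric]) (auto simp: PiE_iff)
    also have "\<dots> = (\<Sum>q\<in>?X. \<Sum>q'\<in>?X. (if ?t q q' then A q * A q' else 0) * (\<Prod>J\<in>I. u J (restrict q J) * u J (restrict q' J)))"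
      by (intro sum.cong refl) (simp add: prod.distrib mult_ac)
    finally show ?thesis .
  qed
  have "?E (\<lambda>w. \<Sum>i\<in>{1..n}. (slot n k I A (rarray p w) i)\<^sup>2)
     = (\<Sum>q\<in>?X. \<Sum>q'\<in>?X. (if ?t q q' then A q * A q' else 0) * ?E (\<lambda>w. \<Prod>J\<in>I. bval p (w (J, restrict q J)) * bval p (w (J, restrict q' J))))"
    unfolding sq rexp_sum rexp_cmult ..
  also have "\<dots> = (\<Sum>q\<in>?X. \<Sum>q'\<in>?X. \<Sum>S\<in>Pow I. if ?same (insert (Suc k) (\<Union>S)) q q'
      then (A q * (\<Prod>J\<in>I - S. x J (restrict q J))) * (A q' * (\<Prod>J\<in>I - S. x J (restrict q' J))) * (\<Prod>J\<in>S. v J (restrict q J)) else 0)"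
  proof (intro sum.cong refl)
    fix q q' assume q: "q \<in> ?X" "q' \<in> ?X"
    let ?\<beta> = "\<lambda>J. if restrict q J = restrict q' J then v J (restrict q J) else 0"
    let ?\<alpha> = "\<lambda>J. x J (restrict q J) * x J (restrict q' J)"
    have "?E (\<lambda>w. \<Prod>J\<in>I. bval p (w (J, restrict q J)) * bval p (w (J, restrict q' J))) =
      (\<Prod>J\<in>I. (\<lambda>(J, j). x J j) (J, restrict q J) * (\<lambda>(J, j). x J j) (J, restrict q' J) +
         (if restrict q J = restrict q' J then (1 - ((\<lambda>(J, j). x J j) (J, restrict q J))\<^sup>2) / real p else 0))"
      by (rule rexp_block_prod2) (use f p J restrict_multi[OF q(1)] restrict_multi[OF q(2)] in auto)
    also have "\<dots> = (\<Prod>J\<in>I. ?\<beta> J + ?\<alpha> J)" by (intro prod.cong refl) (simp add: v_def)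
    also have "\<dots> = (\<Sum>S\<in>Pow I. (\<Prod>J\<in>S. ?\<beta> J) * (\<Prod>J\<in>I - S. ?\<alpha> J))" using f(1) by (rule prod_add)
    finally have 1: "(if ?t q q' then A q * A q' else 0) * ?E (\<lambda>w. \<Prod>J\<in>I. bval p (w (J, restrict q J)) * bval p (w (J, restrict q' J)))
      = (\<Sum>S\<in>Pow I. (if ?t q q' then A q * A q' else 0) * ((\<Prod>J\<in>S. ?\<beta> J) * (\<Prod>J\<in>I - S. ?\<alpha> J)))"
      by (simp add: sum_distrib_left)
    show "(if ?t q q' then A q * A q' else 0) * ?E (\<lambda>w. \<Prod>J\<in>I. bval p (w (J, restrict q J)) * bval p (w (J, restrict q' J)))
      = (\<Sum>S\<in>Pow I. if ?same (insert (Suc k) (\<Union>S)) q q'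
      then (A q * (\<Prod>J\<in>I - S. x J (restrict q J))) * (A q' * (\<Prod>J\<in>I - S. x J (restrict q' J))) * (\<Prod>J\<in>S. v J (restrict q J)) else 0)"
      unfolding 1
    proof (intro sum.cong refl)
      fix S assume S: "S \<in> Pow I"
      have finS: "finite S" using S f(1) finite_subset by auto
      have agree: "restrict q L = restrict q' L \<longleftrightarrow> (\<forall>i\<in>L. q i = q' i)" for L
        by (auto simp: restrict_def fun_eq_iff)
      have same: "?same (insert (Suc k) (\<Union>S)) q q' \<longleftrightarrow> ?t q q' \<and> (\<forall>J\<in>S. restrict q J = restrict q' J)"
        unfolding agree by auto
      have \<beta>: "(\<Prod>J\<in>S. ?\<beta> J) = (if \<forall>J\<in>S. restrict q J = restrict q' J then \<Prod>J\<in>S. v J (restrict q J) else 0)"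
        using finS by (auto simp: prod_zero_iff)
      show "(if ?t q q' then A q * A q' else 0) * ((\<Prod>J\<in>S. ?\<beta> J) * (\<Prod>J\<in>I - S. ?\<alpha> J)) =
        (if ?same (insert (Suc k) (\<Union>S)) q q'
      then (A q * (\<Prod>J\<in>I - S. x J (restrict q J))) * (A q' * (\<Prod>J\<in>I - S. x J (restrict q' J))) * (\<Prod>J\<in>S. v J (restrict q J)) else 0)"
        unfolding same \<beta> by (simp add: prod.distrib mult_ac)
    qed
  qed
  also have "\<dots> = (\<Sum>S\<in>Pow I. \<Sum>q\<in>?X. \<Sum>q'\<in>?X. if ?same (insert (Suc k) (\<Union>S)) q q'
      then (A q * (\<Prod>J\<in>I - S. x J (restrict q J))) * (A q' * (\<Prod>J\<in>I - S. x J (restrict q' J))) * (\<Prod>J\<in>S. v J (restrict q J)) else 0)"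
    by (rule sum_rotate)
  also have "\<dots> \<le> (\<Sum>S\<in>Pow I. (D S)\<^sup>2 / real p ^ card S)"
  proof (rule sum_mono)
    fix S assume "S \<in> Pow I"
    then have S: "S \<subseteq> I" by simp
    define U where "U = insert (Suc k) (\<Union>S)"
    have UK: "U \<subseteq> {1..Suc k}" using S J(2) by (auto simp: U_def)
    have finU: "finite U" using UK finite_subset by blast
    have finS: "finite S" using S f(1) finite_subset by auto
    let ?F = "\<lambda>q. A q * (\<Prod>J\<in>I - S. x J (restrict q J))"
    let ?V = "\<lambda>z. \<Prod>J\<in>S. v J (restrict z J)"
    have rr: "restrict (restrict q U) J = restrict q J" if "J \<in> S" for q :: "nat \<Rightarrow> nat" and J
      using that by (auto simp: restrict_def U_def fun_eq_iff)
    have "(\<Sum>q\<in>?X. \<Sum>q'\<in>?X. if ?same U q q' then ?F q * ?F q' * (\<Prod>J\<in>S. v J (restrict q J)) else 0)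
      = (\<Sum>q\<in>?X. \<Sum>q'\<in>?X. if ?same U q q' then ?F q * ?F q' * ?V (restrict q U) else 0)"
    proof -
      have "(\<Prod>J\<in>S. v J (restrict q J)) = ?V (restrict q U)" for q :: "nat \<Rightarrow> nat"
        by (intro prod.cong refl) (simp only: rr)
      then show ?thesis by (simp only:)
    qed
    also have "\<dots> = (\<Sum>z\<in>U \<rightarrow>\<^sub>E {1..n}. ?V z * (\<Sum>q\<in>{q \<in> ?X. restrict q U = z}. ?F q)\<^sup>2)"
      by (rule sum_pairs_same_fibre) (use finU UK restrict_multi in auto)
    also have "\<dots> \<le> (\<Sum>z\<in>U \<rightarrow>\<^sub>E {1..n}. (1 / real p ^ card S) * (\<Sum>q\<in>{q \<in> ?X. restrict q U = z}. ?F q)\<^sup>2)"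
    proof (intro sum_mono mult_right_mono)
      fix z assume z: "z \<in> U \<rightarrow>\<^sub>E {1..n}"
      have "?V z \<le> (\<Prod>J\<in>S. 1 / real p)"
      proof (intro prod_mono conjI)
        fix L assume L: "L \<in> S"
        have "restrict z L \<in> L \<rightarrow>\<^sub>E {1..n}" using L by (intro restrict_multi[OF z]) (auto simp: U_def)
        then show "0 \<le> v L (restrict z L)" "v L (restrict z L) \<le> 1 / real p" using v L S by auto
      qed
      then show "?V z \<le> 1 / real p ^ card S" by (simp add: power_one_over)
    qed simp
    also have "\<dots> \<le> (1 / real p ^ card S) * (D S)\<^sup>2"
      unfolding sum_distrib_left[symmetric]
      by (intro mult_left_mono multiform_sum_squares_le[OF I S x U_def D(1)[OF S] D(2)[OF S]]) simp
    finally show "(\<Sum>q\<in>?X. \<Sum>q'\<in>?X. if ?same (insert (Suc k) (\<Union>S)) q q'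
      then ?F q * ?F q' * (\<Prod>J\<in>S. v J (restrict q J)) else 0) \<le> (D S)\<^sup>2 / real p ^ card S"
      by (simp add: U_def)
  qed
  finally show ?thesis .
qed

text \<open>Under the root, the first 2 is for the two signs in \<open>Y\<close>,
  \<open>2 ^ k\<close> for the subsets of the partition, and in \<open>exp (k + 2)\<close> the
  \<open>k\<close> is the cost of the change of measure and the 2 that of the penalty.\<close>

definition LC :: "nat \<Rightarrow> real" where "LC k = sqrt (2 * 2 ^ k * exp (real k + 2))"

lemma LC_pos: "LC k > 0" by (simp add: LC_def)

lemma power_le_exp: "0 \<le> t \<Longrightarrow> t ^ N \<le> exp (real N * t)" for t :: real
proof -
  assume t: "0 \<le> t"
  have "t \<le> exp t" using exp_ge_add_one_self[of t] by linarith
  then have "t ^ N \<le> exp t ^ N" using t by (intro power_mono)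
  then show ?thesis by (simp add: exp_of_nat_mult)
qed

text \<open>For arrays randomized around \<open>x\<close>, the exponent \<open>g\<close> has mean at
  least \<open>s * l * m e x - q\<close>. The change of measure thus bounds \<open>m e x\<close> by
  \<open>Y e\<close>, in which \<open>x\<close> no longer occurs, so the supremum is free; it
  remains to average \<open>Y\<close> over the direction.\<close>

theorem contraction_moment:
  assumes I: "I \<in> partitions k" and p: "p \<ge> 1" and B: "B > 0"
    and H: "\<And>L. L \<in> partitions (Suc k) \<Longrightarrow> sqrt (real p) ^ card L * partition_norm n (Suc k) L A \<le> B"
  shows "rexp0 p {1..n} (\<lambda>e. (sqrt (real p) ^ (card I + 1) *
      \<bar>partition_norm n k I (contract n k A (\<lambda>i. bval p (e i)))\<bar>) ^ (2 * p)) \<le> (LC k * B) ^ (2 * p)"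
proof -
  define q where "q = real p"
  have q: "q \<ge> 1" using p by (simp add: q_def)
  define C where "C = acoords n I"
  note f = partition_facts[OF I]
  have finC: "finite C" unfolding C_def using f by auto
  define cI where "cI = card I + 1"
  \<comment> \<open>Bound for the mean of \<open>R\<close>: merging the blocks in \<open>S\<close>
    lowers the power of \<open>q\<close> available from the hypothesis by \<open>card S\<close>, and
    the variances restore exactly that power.\<close>
  define Q where "Q = 2 ^ k * B\<^sup>2 / q ^ cI"
  have Q: "Q > 0" using B q by (simp add: Q_def)
  \<comment> \<open>Tuned so that the mean penalty \<open>l^2 / q * Q\<close> is \<open>q\<close>,
    the same order as the cost of the change of measure.\<close>
  define l where "l = q / sqrt Q"
  have l2: "l\<^sup>2 / q * Q = q" using Q q by (simp add: l_def power_divide power2_eq_square)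
  define R where "R w = (\<Sum>i\<in>{1..n}. (slot n k I A (rarray p w) i)\<^sup>2)" for w
  define th where "th e i = bval p (e i)" for e :: "nat \<Rightarrow> nat" and i
  define m where "m e u = multiform n k I (contract n k A (th e)) u" for e u
  \<comment> \<open>Twice the penalty is the bound \<open>(2 * l)^2 * R / (2 * q)\<close> of
    \<open>rexp_mgf\<close> for the log-moment of \<open>2 * s * l * m\<close>, so
    \<open>exp (2 * g)\<close> has mean at most 1 over \<open>e\<close>.\<close>
  define g where "g s e w = s * l * m e (rarray p w) - l\<^sup>2 / q * R w" for s e w
  \<comment> \<open>Both signs are included because the modulus of the form is to be
    bounded.\<close>
  define Y where "Y e = rexp0 p C (\<lambda>w. exp (2 * g 1 e w)) + rexp0 p C (\<lambda>w. exp (2 * g (-1) e w))" for e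
  have ER: "rexp p C (\<lambda>(J, j). x J j) R \<le> Q" if x: "x \<in> unit_arrays n I" for x
  proof -
    define D where "D S = B / sqrt q ^ (cI - card S)" for S :: "nat set set"
    have "rexp p C (\<lambda>(J, j). x J j) R \<le> (\<Sum>S\<in>Pow I. (D S)\<^sup>2 / real p ^ card S)"
      unfolding C_def R_def
    proof (rule rexp_slot_squares[OF I p x])
      fix S assume S: "S \<subseteq> I"
      have "card (join_blocks k I S) = cI - card S" using join_blocks_card[OF I S] by (simp add: cI_def)
      then have "sqrt q ^ (cI - card S) * partition_norm n (Suc k) (join_blocks k I S) A \<le> B"
        using H[OF join_blocks_partition[OF I S]] by (simp add: q_def)
      then show "partition_norm n (Suc k) (join_blocks k I S) A \<le> D S"
        using q by (simp add: D_def field_simps)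
      show "0 \<le> D S" using B q by (simp add: D_def)
    qed
    also have "\<dots> = (\<Sum>S\<in>Pow I. B\<^sup>2 / q ^ cI)"
    proof (rule sum.cong[OF refl])
      fix S assume "S \<in> Pow I"
      then have "card S \<le> card I" using f(1) by (simp add: card_mono)
      then have e: "(cI - card S) + card S = cI" by (simp add: cI_def)
      have "(sqrt q ^ (cI - card S))\<^sup>2 = q ^ (cI - card S)"
        using q by (metis order.trans power_commutes power_even_eq power_mult real_sqrt_pow2 zero_le_one mult.commute)
      then have "(D S)\<^sup>2 / real p ^ card S = B\<^sup>2 / (q ^ (cI - card S) * q ^ card S)"
        by (simp add: D_def power_divide q_def)
      then show "(D S)\<^sup>2 / real p ^ card S = B\<^sup>2 / q ^ cI" by (simp add: power_add[symmetric] e)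
    qed
    also have "\<dots> = 2 ^ card I * (B\<^sup>2 / q ^ cI)" using f(1) by (simp add: card_Pow)
    also have "\<dots> \<le> 2 ^ k * (B\<^sup>2 / q ^ cI)"
      using f(7) q B by (intro mult_right_mono power_increasing) auto
    finally show ?thesis by (simp add: Q_def)
  qed
  have nn: "0 \<le> rexp0 p C (\<lambda>w. exp (2 * g s e w))" for s e
    using rexp_mono[of C "\<lambda>_. 0" p "\<lambda>_. 0" "\<lambda>w. exp (2 * g s e w)"] finC by simp
  have key: "\<bar>m e x\<bar> ^ (2 * p) \<le> Q ^ p * exp (q * (real k + 2)) * Y e" if x: "x \<in> unit_arrays n I" for x e
  proof -
    let ?y = "\<lambda>(J, j). x J j"
    have y1: "\<bar>?y c\<bar> \<le> 1" if "c \<in> C" for c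
      using that unit_array_entry[OF x] f(3) by (auto simp: C_def)
    have "(\<Sum>c\<in>C. (?y c)\<^sup>2) = (\<Sum>J\<in>I. \<Sum>j\<in>J \<rightarrow>\<^sub>E {1..n}. (x J j)\<^sup>2)"
      unfolding C_def using f by (subst sum.Sigma) (auto intro!: sum.cong)
    also have "\<dots> \<le> (\<Sum>J\<in>I. 1)"
    proof (rule sum_mono)
      fix J assume "J \<in> I"
      then have "L2_set (x J) (J \<rightarrow>\<^sub>E {1..n}) \<le> 1" using x by (simp add: unit_arrays_def)
      then show "(\<Sum>j\<in>J \<rightarrow>\<^sub>E {1..n}. (x J j)\<^sup>2) \<le> 1" by (simp add: L2_set_def)
    qed
    also have "\<dots> \<le> real k" using f(7) by simp
    finally have sy: "(\<Sum>c\<in>C. (?y c)\<^sup>2) \<le> real k" .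
    have one: "exp (2 * (s * l * m e x)) \<le> exp (q * (real k + 2)) * rexp0 p C (\<lambda>w. exp (2 * g s e w))" for s
    proof -
      have "rexp p C ?y (g s e) = s * l * m e x - l\<^sup>2 / q * rexp p C ?y R"
        unfolding g_def rexp_diff rexp_cmult m_def C_def rexp_multiform[OF I p] ..
      moreover have "l\<^sup>2 / q * rexp p C ?y R \<le> l\<^sup>2 / q * Q"
        using ER[OF x] q by (intro mult_left_mono) auto
      ultimately have "2 * (s * l * m e x) \<le> 2 * q + 2 * rexp p C ?y (g s e)" using l2 by simp
      then have "exp (2 * (s * l * m e x)) \<le> exp (2 * q) * exp (2 * rexp p C ?y (g s e))"
        by (simp flip: exp_add)
      also have "\<dots> \<le> exp (2 * q) * (exp (q * (\<Sum>c\<in>C. (?y c)\<^sup>2)) * rexp0 p C (\<lambda>w. exp (2 * g s e w)))"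
        unfolding q_def by (intro mult_left_mono rexp_exp_change_of_measure finC y1) auto
      also have "\<dots> \<le> exp (2 * q) * (exp (q * real k) * rexp0 p C (\<lambda>w. exp (2 * g s e w)))"
        using sy q nn by (intro mult_left_mono mult_right_mono) auto
      also have "\<dots> = exp (q * (real k + 2)) * rexp0 p C (\<lambda>w. exp (2 * g s e w))"
        by (simp add: algebra_simps exp_add)
      finally show ?thesis .
    qed
    have "exp (2 * (l * \<bar>m e x\<bar>)) \<le> exp (q * (real k + 2)) * Y e"
    proof -
      obtain s where s: "\<bar>m e x\<bar> = s * m e x" "s = 1 \<or> s = -1" using that[of 1] that[of "-1"] by (cases "0 \<le> m e x") auto
      have "exp (2 * (l * \<bar>m e x\<bar>)) \<le> exp (q * (real k + 2)) * rexp0 p C (\<lambda>w. exp (2 * g s e w))"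
        using one[of s] by (simp add: s(1) mult_ac)
      also have "\<dots> \<le> exp (q * (real k + 2)) * Y e" unfolding Y_def using nn s(2) by (intro mult_left_mono) auto
      finally show ?thesis .
    qed
    moreover have "(\<bar>m e x\<bar> / sqrt Q) ^ (2 * p) \<le> exp (2 * (l * \<bar>m e x\<bar>))"
    proof -
      have "real (2 * p) * (\<bar>m e x\<bar> / sqrt Q) = 2 * (l * \<bar>m e x\<bar>)" by (simp add: l_def q_def)
      then show ?thesis using power_le_exp[of "\<bar>m e x\<bar> / sqrt Q" "2 * p"] Q by simp
    qed
    moreover have "(\<bar>m e x\<bar> / sqrt Q) ^ (2 * p) = \<bar>m e x\<bar> ^ (2 * p) / Q ^ p"
      using Q by (simp add: power_divide power_mult)
    ultimately have "\<bar>m e x\<bar> ^ (2 * p) / Q ^ p \<le> exp (q * (real k + 2)) * Y e" by linarith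
    then show ?thesis using Q by (simp add: field_simps)
  qed
  have norm: "\<bar>partition_norm n k I (contract n k A (th e))\<bar> ^ (2 * p) \<le> Q ^ p * exp (q * (real k + 2)) * Y e" for e
  proof -
    define W where "W = Q ^ p * exp (q * (real k + 2)) * Y e"
    define U where "U = root (2 * p) W"
    let ?F = "unit_arrays n I"
    have z: "(\<lambda>_ _. 0) \<in> ?F" by (simp add: unit_arrays_def L2_set_def)
    have W: "0 \<le> W" unfolding W_def by (rule order.trans[OF _ key[OF z]]) simp
    have le: "\<bar>m e x\<bar> \<le> U" if "x \<in> ?F" for x
    proof -
      have "root (2 * p) (\<bar>m e x\<bar> ^ (2 * p)) \<le> U"
        unfolding U_def W_def using p key[OF that] by (intro real_root_le_mono) auto
      then show ?thesis using p by (simp add: real_root_power_cancel)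
    qed
    have bdd: "bdd_above (m e ` ?F)" by (rule bdd_aboveI2[where M = U]) (use le in \<open>auto simp: abs_le_iff\<close>)
    have "(SUP x\<in>?F. m e x) \<le> U" using z le by (intro cSUP_least) (auto simp: abs_le_iff)
    moreover have "- U \<le> (SUP x\<in>?F. m e x)"
      using cSUP_upper[OF z bdd] le[OF z] by linarith
    ultimately have "\<bar>partition_norm n k I (contract n k A (th e))\<bar> \<le> U"
      unfolding partition_norm_eq m_def by linarith
    then have "\<bar>partition_norm n k I (contract n k A (th e))\<bar> ^ (2 * p) \<le> U ^ (2 * p)" by (intro power_mono) auto
    also have "\<dots> = W" unfolding U_def using p W by (intro real_root_pow_pos2) auto
    finally show ?thesis by (simp add: W_def)
  qed
  have EY: "rexp0 p {1..n} (\<lambda>e. rexp0 p C (\<lambda>w. exp (2 * g s e w))) \<le> 1" if s: "s\<^sup>2 = 1" for s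
  proof -
    have "rexp0 p {1..n} (\<lambda>e. exp (2 * g s e w)) \<le> 1" for w
    proof -
      define v where "v i = slot n k I A (rarray p w) i" for i
      have "exp (2 * g s e w) = exp (- (2 * (l\<^sup>2 / q * R w))) * exp (\<Sum>i\<in>{1..n}. (2 * s * l * v i) * bval p (e i))" for e
        unfolding g_def m_def multiform_contract th_def v_def exp_add[symmetric]
        by (simp add: sum_distrib_left algebra_simps)
      then have "rexp0 p {1..n} (\<lambda>e. exp (2 * g s e w)) = exp (- (2 * (l\<^sup>2 / q * R w))) * rexp0 p {1..n} (\<lambda>e. exp (\<Sum>i\<in>{1..n}. (2 * s * l * v i) * bval p (e i)))"
        by (simp add: rexp_cmult)
      also have "\<dots> \<le> exp (- (2 * (l\<^sup>2 / q * R w))) * exp ((\<Sum>i\<in>{1..n}. (2 * s * l * v i)\<^sup>2) / (2 * real p))"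
        by (intro mult_left_mono rexp_mgf p) auto
      also have "(\<Sum>i\<in>{1..n}. (2 * s * l * v i)\<^sup>2) = 4 * l\<^sup>2 * R w"
        by (simp add: R_def v_def power_mult_distrib s sum_distrib_left)
      also have "exp (- (2 * (l\<^sup>2 / q * R w))) * exp (4 * l\<^sup>2 * R w / (2 * real p)) = 1"
        by (simp add: exp_add[symmetric] q_def)
      finally show ?thesis .
    qed
    then have "rexp0 p C (\<lambda>w. rexp0 p {1..n} (\<lambda>e. exp (2 * g s e w))) \<le> rexp0 p C (\<lambda>_. 1)"
      by (intro rexp_mono) auto
    then show ?thesis using finC by (subst rexp_swap) simp
  qed
  have "rexp0 p {1..n} (\<lambda>e. (sqrt q ^ cI * \<bar>partition_norm n k I (contract n k A (th e))\<bar>) ^ (2 * p))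
    \<le> rexp0 p {1..n} (\<lambda>e. (2 ^ k * B\<^sup>2 * exp (real k + 2)) ^ p * Y e)"
  proof (rule rexp_mono)
    fix e
    have e1: "(sqrt q ^ cI) ^ (2 * p) = (q ^ cI) ^ p"
    proof -
      have "(sqrt q ^ cI)\<^sup>2 = (sqrt q ^ 2) ^ cI" by (simp only: power_mult[symmetric] mult.commute)
      then show ?thesis using q by (simp add: power_mult)
    qed
    have "(sqrt q ^ cI * \<bar>partition_norm n k I (contract n k A (th e))\<bar>) ^ (2 * p)
      = (q ^ cI) ^ p * \<bar>partition_norm n k I (contract n k A (th e))\<bar> ^ (2 * p)"
      by (simp only: power_mult_distrib e1)
    also have "\<dots> \<le> (q ^ cI) ^ p * (Q ^ p * exp (q * (real k + 2)) * Y e)"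
      using q by (intro mult_left_mono norm) auto
    also have "\<dots> = (q ^ cI * Q) ^ p * exp (real k + 2) ^ p * Y e"
      by (simp add: power_mult_distrib q_def exp_of_nat_mult[symmetric])
    also have "q ^ cI * Q = 2 ^ k * B\<^sup>2" using q by (simp add: Q_def)
    finally show "(sqrt q ^ cI * \<bar>partition_norm n k I (contract n k A (th e))\<bar>) ^ (2 * p) \<le> (2 ^ k * B\<^sup>2 * exp (real k + 2)) ^ p * Y e"
      by (simp add: power_mult_distrib)
  qed auto
  also have "\<dots> = (2 ^ k * B\<^sup>2 * exp (real k + 2)) ^ p * rexp0 p {1..n} Y" by (rule rexp_cmult)
  also have "\<dots> \<le> (2 ^ k * B\<^sup>2 * exp (real k + 2)) ^ p * 2 ^ p"
  proof (rule mult_left_mono)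
    have "rexp0 p {1..n} Y \<le> 1 + 1" unfolding Y_def rexp_add by (intro add_mono EY) auto
    also have "(1 + 1 :: real) \<le> 2 ^ p" using power_increasing[OF p, of "2::real"] by simp
    finally show "rexp0 p {1..n} Y \<le> 2 ^ p" .
  qed auto
  also have "\<dots> = (LC k * B) ^ (2 * p)"
  proof -
    have "(LC k * B)\<^sup>2 = 2 ^ k * B\<^sup>2 * exp (real k + 2) * 2" by (simp add: LC_def power_mult_distrib)
    then show ?thesis by (simp only: power_mult power_mult_distrib[symmetric])
  qed
  finally show ?thesis by (simp add: q_def cI_def th_def[abs_def])
qed

subsection \<open>Moments of functions of bounded degree\<close>

lemma finite_partitions [simp]: "finite (partitions k)"
  unfolding partitions_def by (rule finitely_many_partition_on) simp

lemma power_sum_le_card: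
  fixes u :: "'a \<Rightarrow> real"
  assumes A: "finite A" and u: "\<And>a. a \<in> A \<Longrightarrow> 0 \<le> u a" and N: "N \<ge> 1"
  shows "(\<Sum>a\<in>A. u a) ^ N \<le> real (card A) ^ N * (\<Sum>a\<in>A. u a ^ N)"
proof (cases "A = {}")
  case False
  define M where "M = Max (u ` A)"
  have M: "u a \<le> M" if "a \<in> A" for a using A that by (simp add: M_def)
  have "M \<in> u ` A" unfolding M_def using A False by (intro Max_in) auto
  then obtain b where b: "b \<in> A" "M = u b" by blast
  have "(\<Sum>a\<in>A. u a) \<le> real (card A) * M" using sum_bounded_above[of A u M] M by simp
  then have "(\<Sum>a\<in>A. u a) ^ N \<le> (real (card A) * M) ^ N"
    using u by (intro power_mono sum_nonneg)
  also have "\<dots> = real (card A) ^ N * u b ^ N" by (simp add: power_mult_distrib b)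
  also have "\<dots> \<le> real (card A) ^ N * (\<Sum>a\<in>A. u a ^ N)"
    using A u b by (intro mult_left_mono member_le_sum) auto
  finally show ?thesis .
qed (use N in \<open>simp add: power_0_left\<close>)

lemma power_add_le_add_power:
  fixes a b :: real
  assumes "0 \<le> a" "0 \<le> b" "N \<ge> 1"
  shows "a ^ N + b ^ N \<le> (a + b) ^ N"
proof -
  obtain r where r: "N = Suc r" using assms by (cases N) auto
  have "a * a ^ r + b * b ^ r \<le> a * (a + b) ^ r + b * (a + b) ^ r"
    using assms by (intro add_mono mult_left_mono power_mono) auto
  then show ?thesis by (simp add: r distrib_right)
qed

lemma even_power_add_le:
  fixes a b :: real
  assumes "even N"
  shows "(a + b) ^ N \<le> 2 ^ N * (a ^ N + b ^ N)"
proof -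
  have "(a + b) ^ N = \<bar>a + b\<bar> ^ N" using assms by (simp add: power_even_abs)
  also have "\<dots> \<le> (2 * max \<bar>a\<bar> \<bar>b\<bar>) ^ N" by (intro power_mono) auto
  also have "\<dots> = 2 ^ N * (max \<bar>a\<bar> \<bar>b\<bar>) ^ N" by (simp add: power_mult_distrib)
  also have "(max \<bar>a\<bar> \<bar>b\<bar>) ^ N \<le> a ^ N + b ^ N"
    using assms by (auto simp: max_def power_even_abs zero_le_even_power)
  finally show ?thesis by simp
qed

section \<open>Iterated discrete derivatives\<close>

definition nablaD :: "nat \<Rightarrow> ((nat \<Rightarrow> real) \<Rightarrow> real) \<Rightarrow> (nat \<Rightarrow> real) \<Rightarrow> (nat \<Rightarrow> nat) \<Rightarrow> real" where
  "nablaD k F x \<iota> = foldr (\<lambda>j. dif (\<iota> j)) [1..<Suc k] F x"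

lemma nablaD_0 [simp]: "nablaD 0 F x \<iota> = F x"
  by (simp add: nablaD_def)

lemma nablaD_Suc: "nablaD (Suc k) F x \<iota> = nablaD k (dif (\<iota> (Suc k)) F) x \<iota>"
  by (simp add: nablaD_def)

lemma nablaD_cong:
  assumes "\<And>j. 1 \<le> j \<Longrightarrow> j \<le> k \<Longrightarrow> \<iota> j = \<iota>' j"
  shows "nablaD k F x \<iota> = nablaD k F x \<iota>'"
proof -
  have "foldr (\<lambda>j. dif (\<iota> j)) [1..<Suc k] F = foldr (\<lambda>j. dif (\<iota>' j)) [1..<Suc k] F"
    by (rule foldr_cong) (use assms in \<open>auto simp: less_Suc_eq_le\<close>)
  then show ?thesis by (simp only: nablaD_def)
qed

text \<open>\<open>foldr\<close> applies the last index innermost, so fixing it means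
  differentiating \<open>F\<close> first; entries outside \<open>{1..k}\<close> are never
  read.\<close>

lemma nablaD_upd: "nablaD (Suc k) F x (\<iota>(Suc k := i)) = nablaD k (dif i F) x \<iota>"
  unfolding nablaD_Suc by (simp, rule nablaD_cong) auto

lemma dif_sum': "dif i (\<lambda>x. \<Sum>j\<in>A. c j * u j x) = (\<lambda>x. \<Sum>j\<in>A. c j * dif i (u j) x)"
  by (rule ext) (rule dif_sum)

lemma nablaD_sum: "nablaD k (\<lambda>x. \<Sum>j\<in>A. c j * u j x) x \<iota> = (\<Sum>j\<in>A. c j * nablaD k (u j) x \<iota>)"
  by (induction k arbitrary: u) (simp_all add: nablaD_Suc dif_sum')

text \<open>Without blocks the supremum is over a constant, so this norm is the signed entry at the
  only multi-index. This is why absolute values are put around the norms of contracted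
  tensors.\<close>

lemma partition_norm_0: "partition_norm n 0 {} A = A (\<lambda>_. undefined)"
  by (simp add: partition_norm_def)

lemma partitions_0: "partitions 0 = {{}}"
  by (auto simp: partitions_def partition_on_def)

text \<open>The order \<open>k = 0\<close> is included because the mean of a directional derivative
  must be bounded as well. \<open>Suc\<close> and the summand 1 account for the extra term
  \<open>B\<close> in \<open>S e\<close>.\<close>

definition TT :: "nat \<Rightarrow> real" where
  "TT m = real (Suc (card (SIGMA k:{..m}. partitions k))) * (1 + (\<Sum>(k, I)\<in>(SIGMA k:{..m}. partitions k). LC k))"

text \<open>One step contributes \<open>sqrt M\<close> from \<open>moment_bound\<close>, a 2 from
  \<open>exp p \<le> 4 ^ p\<close>, the factor \<open>2 * (1 + ...)\<close> from splitting a
  directional derivative into mean and deviation, and \<open>TT\<close> from the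
  contractions.\<close>

fun CC :: "real \<Rightarrow> nat \<Rightarrow> real" where
  "CC M 0 = 1"
| "CC M (Suc m) = 2 * sqrt M * (2 * (1 + CC M m * 2 ^ m)) * TT m"

lemma TT_pos: "TT m > 0"
proof -
  have "0 \<le> (\<Sum>(k, I)\<in>(SIGMA k:{..m}. partitions k). LC k)" using LC_pos by (intro sum_nonneg) (auto simp: less_imp_le)
  then show ?thesis unfolding TT_def by (intro mult_pos_pos) (simp_all del: card_SigmaI)
qed

lemma CC_pos: "M > 0 \<Longrightarrow> CC M m > 0"
  by (induction m) (simp_all add: TT_pos add_pos_pos)

section \<open>Induction on the degree\<close>

context ising_model
begin

abbreviation mnabla :: "nat \<Rightarrow> ((nat \<Rightarrow> real) \<Rightarrow> real) \<Rightarrow> (nat \<Rightarrow> nat) \<Rightarrow> real" where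
  "mnabla k F \<iota> \<equiv> mean (\<lambda>x. nablaD k F x \<iota>)"

definition direc :: "((nat \<Rightarrow> real) \<Rightarrow> real) \<Rightarrow> (nat \<Rightarrow> real) \<Rightarrow> (nat \<Rightarrow> real) \<Rightarrow> real" where
  "direc F \<theta> x = (\<Sum>i\<in>{1..n}. \<theta> i * dif i F x)"

text \<open>The contracted index is the one differentiated first, so linearity suffices and no
  differences have to be interchanged.\<close>

lemma mnabla_direc: "mnabla k (direc F \<theta>) = contract n k (mnabla (Suc k) F) \<theta>"
  unfolding contract_def direc_def[abs_def] nablaD_sum nablaD_upd mean_def cexp_sum cexp_cmult ..

lemma rexp_mean_swap: "rexp p C y (\<lambda>\<omega>. mean (\<lambda>x. f \<omega> x)) = mean (\<lambda>x. rexp p C y (\<lambda>\<omega>. f \<omega> x))"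
  unfolding mean_def rexp_def[of p C y] cexp_sum cexp_cmult ..

text \<open>
  One step of the iteration: the Euclidean norm of the gradient is replaced by a random directional
  derivative, to which the claim of one degree less applies.
\<close>

lemma direc_moment:
  fixes j m :: nat
  defines "p \<equiv> 2 ^ Suc j :: nat"
  assumes B: "B > 0"
    and H: "\<And>k I. k \<in> {1..Suc m} \<Longrightarrow> I \<in> partitions k \<Longrightarrow> sqrt (real p) ^ card I * partition_norm n k I (mnabla k F) \<le> B"
    and K: "K > 0"
    and IH: "\<And>\<theta> B'. B' > 0 \<Longrightarrow>
        (\<And>k I. k \<in> {1..m} \<Longrightarrow> I \<in> partitions k \<Longrightarrow> sqrt (real (2 * p)) ^ card I * partition_norm n k I (mnabla k (direc F \<theta>)) \<le> B') \<Longrightarrow>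
        mean (\<lambda>x. (direc F \<theta> x - mean (direc F \<theta>)) ^ (2 * p)) \<le> (K * B') ^ (2 * p)"
  shows "rexp0 p {1..n} (\<lambda>e. mean (\<lambda>x. direc F (\<lambda>i. bval p (e i)) x ^ (2 * p)))
    \<le> (2 * (1 + K * 2 ^ m) * TT m * B / sqrt (real p)) ^ (2 * p)"
proof -
  define s where "s = sqrt (real p)"
  have p1: "p \<ge> 1" by (simp add: p_def)
  have s: "s \<ge> 1" using p1 by (simp add: s_def)
  define Ix where "Ix = (SIGMA k:{..m}. partitions k)"
  have finIx: "finite Ix" by (simp add: Ix_def)
  define g where "g c e = s ^ (card (snd c) + 1) * \<bar>partition_norm n (fst c) (snd c) (contract n (fst c) (mnabla (Suc (fst c)) F) (\<lambda>i. bval p (e i)))\<bar>" for c and e :: "nat \<Rightarrow> nat"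
  have g0: "0 \<le> g c e" for c e using s by (simp add: g_def)
  \<comment> \<open>The summand \<open>B\<close> keeps this positive, as the induction hypothesis
    requires.\<close>
  define S where "S e = B + (\<Sum>c\<in>Ix. g c e)" for e
  have S: "S e > 0" for e unfolding S_def using B g0 by (intro add_pos_nonneg sum_nonneg)
  have gS: "g c e \<le> S e" if "c \<in> Ix" for c e
    using member_le_sum[OF that, of "\<lambda>c. g c e"] finIx g0 B unfolding S_def by fastforce
  have pt: "mean (\<lambda>x. direc F (\<lambda>i. bval p (e i)) x ^ (2 * p)) \<le> (2 * (1 + K * 2 ^ m) * (S e / s)) ^ (2 * p)" for e
  proof -
    define \<theta> where "\<theta> i = bval p (e i)" for i
    define a where "a = mean (direc F \<theta>)"
    have geq: "g (k, I) e = s ^ (card I + 1) * \<bar>partition_norm n k I (mnabla k (direc F \<theta>))\<bar>" for k I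
      by (simp add: g_def mnabla_direc \<theta>_def[abs_def])
    \<comment> \<open>The mean of the directional derivative is its tensor of order 0, so it is
      bounded like the other contractions.\<close>
    have "(0, {}) \<in> Ix" by (simp add: Ix_def partitions_0)
    then have "s * \<bar>a\<bar> \<le> S e"
      using gS[of "(0, {})" e] unfolding geq by (simp add: partition_norm_0 a_def)
    then have a: "\<bar>a\<bar> \<le> S e / s" using s by (simp add: field_simps)
    have dev: "mean (\<lambda>x. (direc F \<theta> x - a) ^ (2 * p)) \<le> (K * (2 ^ m * (S e / s))) ^ (2 * p)"
      unfolding a_def
    proof (rule IH)
      show "0 < 2 ^ m * (S e / s)" using S s by simp
      fix k I assume k: "k \<in> {1..m}" and I: "I \<in> partitions k"
      then have "(k, I) \<in> Ix" by (simp add: Ix_def)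
      then have "s ^ (card I + 1) * \<bar>partition_norm n k I (mnabla k (direc F \<theta>))\<bar> \<le> S e"
        using gS geq by metis
      then have 1: "s ^ card I * \<bar>partition_norm n k I (mnabla k (direc F \<theta>))\<bar> \<le> S e / s"
        using s by (simp add: field_simps)
      \<comment> \<open>The induction hypothesis works at exponent \<open>2 * p\<close>, the
        available bounds at \<open>p\<close>; the loss is at most \<open>2 ^ m\<close>.\<close>
      have "sqrt 2 ^ card I \<le> 2 ^ card I" by (intro power_mono real_le_lsqrt) auto
      also have "\<dots> \<le> (2::real) ^ m" using partition_facts(7)[OF I] k by (intro power_increasing) auto
      finally have 2: "sqrt 2 ^ card I \<le> 2 ^ m" .
      have "sqrt (real (2 * p)) ^ card I * partition_norm n k I (mnabla k (direc F \<theta>))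
        \<le> sqrt (real (2 * p)) ^ card I * \<bar>partition_norm n k I (mnabla k (direc F \<theta>))\<bar>"
        by (intro mult_left_mono) auto
      also have "\<dots> = sqrt 2 ^ card I * (s ^ card I * \<bar>partition_norm n k I (mnabla k (direc F \<theta>))\<bar>)"
        by (simp add: s_def real_sqrt_mult power_mult_distrib mult.assoc)
      also have "\<dots> \<le> 2 ^ m * (S e / s)"
        using 1 2 s by (intro mult_mono) auto
      finally show "sqrt (real (2 * p)) ^ card I * partition_norm n k I (mnabla k (direc F \<theta>)) \<le> 2 ^ m * (S e / s)" .
    qed
    have "mean (\<lambda>x. direc F \<theta> x ^ (2 * p)) = mean (\<lambda>x. ((direc F \<theta> x - a) + a) ^ (2 * p))" by simp
    also have "\<dots> \<le> mean (\<lambda>x. 2 ^ (2 * p) * ((direc F \<theta> x - a) ^ (2 * p) + a ^ (2 * p)))"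
      unfolding mean_def by (intro cexp_mono ref even_power_add_le) simp
    also have "\<dots> = 2 ^ (2 * p) * (mean (\<lambda>x. (direc F \<theta> x - a) ^ (2 * p)) + a ^ (2 * p))"
      unfolding mean_def cexp_cmult cexp_add by simp
    also have "\<dots> \<le> 2 ^ (2 * p) * ((K * (2 ^ m * (S e / s))) ^ (2 * p) + (S e / s) ^ (2 * p))"
    proof (intro mult_left_mono add_mono dev)
      have "a ^ (2 * p) = \<bar>a\<bar> ^ (2 * p)" by (simp add: power_even_abs)
      also have "\<dots> \<le> (S e / s) ^ (2 * p)" using a by (intro power_mono) auto
      finally show "a ^ (2 * p) \<le> (S e / s) ^ (2 * p)" .
    qed simp
    also have "\<dots> \<le> 2 ^ (2 * p) * (K * (2 ^ m * (S e / s)) + S e / s) ^ (2 * p)"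
      using K S[of e] s p1 by (intro mult_left_mono power_add_le_add_power) auto
    also have "\<dots> = (2 * (1 + K * 2 ^ m) * (S e / s)) ^ (2 * p)"
      unfolding power_mult_distrib[symmetric] by (simp add: algebra_simps add_divide_distrib)
    finally show ?thesis unfolding \<theta>_def[abs_def] .
  qed
  have gm: "rexp0 p {1..n} (\<lambda>e. g c e ^ (2 * p)) \<le> (LC (fst c) * B) ^ (2 * p)" if "c \<in> Ix" for c
    unfolding g_def s_def
    by (rule contraction_moment) (use that p1 B H in \<open>auto simp: Ix_def\<close>)
  define N where "N = real (Suc (card Ix))"
  have Sm: "rexp0 p {1..n} (\<lambda>e. S e ^ (2 * p)) \<le> (TT m * B) ^ (2 * p)"
  proof -
    have "rexp0 p {1..n} (\<lambda>e. S e ^ (2 * p)) \<le> rexp0 p {1..n} (\<lambda>e. N ^ (2 * p) * (B ^ (2 * p) + (\<Sum>c\<in>Ix. g c e ^ (2 * p))))"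
    proof (rule rexp_mono)
      fix e
      \<comment> \<open>\<open>None\<close> carries the term \<open>B\<close>, so that one power
        inequality covers all \<open>Suc (card Ix)\<close> terms.\<close>
      define u where "u c = (case c of None \<Rightarrow> B | Some c \<Rightarrow> g c e)" for c
      let ?A = "insert None (Some ` Ix)"
      have sumu: "(\<Sum>c\<in>?A. h (u c)) = h B + (\<Sum>c\<in>Ix. h (g c e))" for h :: "real \<Rightarrow> real"
        using finIx by (subst sum.insert) (auto simp: u_def sum.reindex)
      have "(\<Sum>c\<in>?A. u c) ^ (2 * p) \<le> real (card ?A) ^ (2 * p) * (\<Sum>c\<in>?A. u c ^ (2 * p))"
        using finIx B g0 p1 by (intro power_sum_le_card) (auto simp: u_def)
      moreover have "card ?A = Suc (card Ix)" using finIx by (subst card_insert_disjoint) (auto simp: card_image)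
      ultimately show "S e ^ (2 * p) \<le> N ^ (2 * p) * (B ^ (2 * p) + (\<Sum>c\<in>Ix. g c e ^ (2 * p)))"
        using sumu[of "\<lambda>t. t"] sumu[of "\<lambda>t. t ^ (2 * p)"] unfolding S_def N_def by simp
    qed auto
    also have "\<dots> = N ^ (2 * p) * (B ^ (2 * p) + (\<Sum>c\<in>Ix. rexp0 p {1..n} (\<lambda>e. g c e ^ (2 * p))))"
      unfolding rexp_cmult rexp_add rexp_sum by simp
    also have "\<dots> \<le> N ^ (2 * p) * (B ^ (2 * p) + (\<Sum>c\<in>Ix. (LC (fst c) * B) ^ (2 * p)))"
      by (intro mult_left_mono add_left_mono sum_mono gm) (auto simp: N_def)
    also have "\<dots> \<le> N ^ (2 * p) * (B + (\<Sum>c\<in>Ix. LC (fst c) * B)) ^ (2 * p)"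
    proof (rule mult_left_mono)
      have nn: "0 \<le> LC (fst c) * B" for c :: "nat \<times> nat set set" using LC_pos B by (simp add: less_imp_le)
      have "(\<Sum>c\<in>A. (LC (fst c) * B) ^ (2 * p)) \<le> (\<Sum>c\<in>A. LC (fst c) * B) ^ (2 * p)" if "finite A" for A :: "(nat \<times> nat set set) set"
        using that
      proof induction
        case (insert c A)
        have "(LC (fst c) * B) ^ (2 * p) + (\<Sum>c\<in>A. LC (fst c) * B) ^ (2 * p) \<le> (LC (fst c) * B + (\<Sum>c\<in>A. LC (fst c) * B)) ^ (2 * p)"
          using nn p1 by (intro power_add_le_add_power sum_nonneg) auto
        then show ?case using insert by simp
      qed simp
      then have "B ^ (2 * p) + (\<Sum>c\<in>Ix. (LC (fst c) * B) ^ (2 * p)) \<le> B ^ (2 * p) + (\<Sum>c\<in>Ix. LC (fst c) * B) ^ (2 * p)"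
        using finIx by simp
      also have "\<dots> \<le> (B + (\<Sum>c\<in>Ix. LC (fst c) * B)) ^ (2 * p)"
        using B nn p1 by (intro power_add_le_add_power sum_nonneg) auto
      finally show "B ^ (2 * p) + (\<Sum>c\<in>Ix. (LC (fst c) * B) ^ (2 * p)) \<le> (B + (\<Sum>c\<in>Ix. LC (fst c) * B)) ^ (2 * p)" .
    qed (simp add: N_def)
    also have "\<dots> = (TT m * B) ^ (2 * p)"
    proof -
      define L where "L = (\<Sum>(k, I)\<in>Ix. LC k)"
      have "(\<Sum>c\<in>Ix. LC (fst c) * B) = L * B" by (simp add: L_def sum_distrib_right case_prod_unfold)
      moreover have "TT m = N * (1 + L)" by (simp add: TT_def N_def L_def Ix_def del: card_SigmaI)
      ultimately show ?thesis unfolding power_mult_distrib[symmetric] by (simp add: algebra_simps)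
    qed
    finally show ?thesis .
  qed
  have "rexp0 p {1..n} (\<lambda>e. mean (\<lambda>x. direc F (\<lambda>i. bval p (e i)) x ^ (2 * p)))
    \<le> rexp0 p {1..n} (\<lambda>e. (2 * (1 + K * 2 ^ m) / s) ^ (2 * p) * S e ^ (2 * p))"
    by (rule rexp_mono) (use pt in \<open>auto simp: power_mult_distrib[symmetric]\<close>)
  also have "\<dots> = (2 * (1 + K * 2 ^ m) / s) ^ (2 * p) * rexp0 p {1..n} (\<lambda>e. S e ^ (2 * p))"
    by (rule rexp_cmult)
  also have "\<dots> \<le> (2 * (1 + K * 2 ^ m) / s) ^ (2 * p) * (TT m * B) ^ (2 * p)"
    using Sm by (intro mult_left_mono) (auto simp: zero_le_even_power)
  also have "\<dots> = (2 * (1 + K * 2 ^ m) * TT m * B / s) ^ (2 * p)"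
    unfolding power_mult_distrib[symmetric] by (simp add: mult.assoc)
  finally show ?thesis by (simp add: s_def)
qed

text \<open>The exponent is left free in the induction, since the step at \<open>p\<close> uses the
  smaller degree at \<open>2 * p\<close>. The factor \<open>p\<close> of \<open>moment_bound\<close>
  meets the \<open>1 / p\<close> in \<open>B0\<close>, so the constant does not depend on
  \<open>j\<close>.\<close>

theorem polynomial_moment:
  fixes j m :: nat
  assumes "B > 0"
    and "\<And>\<iota> x. (\<And>i. i \<in> {1..Suc m} \<Longrightarrow> \<iota> i \<in> {1..n}) \<Longrightarrow> x \<in> cube n \<Longrightarrow> nablaD (Suc m) F x \<iota> = 0"
    and "\<And>k I. k \<in> {1..m} \<Longrightarrow> I \<in> partitions k \<Longrightarrow>
        sqrt (real (2 ^ Suc j)) ^ card I * partition_norm n k I (mnabla k F) \<le> B"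
  shows "mean (\<lambda>x. (F x - mean F) ^ (2 ^ Suc j)) \<le> (CC MC m * B) ^ (2 ^ Suc j)"
  using assms
proof (induction m arbitrary: j F B)
  case (0 j F B)
  define f where "f x = F x - mean F" for x
  have f0: "cexp {1..n} f ref = 0" unfolding f_def by (simp add: cexp_diff mean_def)
  \<comment> \<open>The gradient vanishes on the cube, so any positive value is a valid bound; this
    one turns \<open>moment_bound\<close> into the claim.\<close>
  define B0 where "B0 = B\<^sup>2 / (MC * 2 ^ Suc j)"
  have B0: "B0 > 0" using 0(1) MC_pos by (simp add: B0_def)
  have "cexp {1..n} (\<lambda>\<tau>. grad {1..n} f \<tau> ^ (2 ^ j)) ref = cexp {1..n} (\<lambda>_. 0) ref"
  proof (rule cexp_cong)
    fix \<tau> assume "\<tau> \<in> cl {1..n} ref"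
    then have \<tau>: "\<tau> \<in> cube n" by (rule cl_cube)
    have "dif i f \<tau> = 0" if "i \<in> {1..n}" for i
      using 0(2)[of "\<lambda>_. i" \<tau>] that \<tau> by (simp add: nablaD_Suc dif_def f_def)
    then show "grad {1..n} f \<tau> ^ (2 ^ j) = 0" by (simp add: grad_def zero_power)
  qed
  then have "cexp {1..n} (\<lambda>\<tau>. grad {1..n} f \<tau> ^ (2 ^ j)) ref \<le> B0 ^ (2 ^ j)" using B0 by simp
  then have "cexp {1..n} (\<lambda>\<tau>. f \<tau> ^ (2 ^ Suc j)) ref \<le> (MC * 2 ^ Suc j * B0) ^ (2 ^ j)"
    by (intro moment_bound B0 f0) auto
  also have "MC * 2 ^ Suc j * B0 = B\<^sup>2" using MC_pos by (simp add: B0_def)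
  finally show ?case by (simp add: f_def mean_def power_mult)
next
  case (Suc m j F B)
  define p where "p = (2 ^ Suc j :: nat)"
  define f where "f x = F x - mean F" for x
  have f0: "cexp {1..n} f ref = 0" unfolding f_def by (simp add: cexp_diff mean_def)
  define K where "K = CC MC m"
  have K: "K > 0" using MC_pos by (simp add: K_def CC_pos)
  define X where "X = 2 * (1 + K * 2 ^ m) * TT m * B"
  have X: "X > 0" using K TT_pos Suc.prems(1) by (simp add: X_def add_pos_pos)
  have gradf: "grad {1..n} f x = (\<Sum>i\<in>{1..n}. (dif i F x)\<^sup>2)" for x
    by (simp add: grad_def dif_def f_def)
  have step: "rexp0 p {1..n} (\<lambda>e. mean (\<lambda>x. direc F (\<lambda>i. bval p (e i)) x ^ (2 * p)))
    \<le> (2 * (1 + K * 2 ^ m) * TT m * B / sqrt (real p)) ^ (2 * p)"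
    unfolding p_def
  proof (rule direc_moment[OF Suc.prems(1) Suc.prems(3) K])
    fix \<theta> B' assume B': "B' > 0"
      and h: "\<And>k I. k \<in> {1..m} \<Longrightarrow> I \<in> partitions k \<Longrightarrow>
        sqrt (real (2 * 2 ^ Suc j)) ^ card I * partition_norm n k I (mnabla k (direc F \<theta>)) \<le> B'"
    have "mean (\<lambda>x. (direc F \<theta> x - mean (direc F \<theta>)) ^ (2 ^ Suc (Suc j))) \<le> (CC MC m * B') ^ (2 ^ Suc (Suc j))"
    proof (rule Suc.IH[OF B'])
      fix \<iota> x assume \<iota>: "\<And>i. i \<in> {1..Suc m} \<Longrightarrow> \<iota> i \<in> {1..n}" and x: "x \<in> cube n"
      have "nablaD (Suc m) (direc F \<theta>) x \<iota> = (\<Sum>i\<in>{1..n}. \<theta> i * nablaD (Suc (Suc m)) F x (\<iota>(Suc (Suc m) := i)))"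
        unfolding direc_def[abs_def] nablaD_sum nablaD_upd ..
      also have "\<dots> = (\<Sum>i\<in>{1..n}. \<theta> i * 0)"
        by (intro sum.cong refl arg_cong2[where f = "(*)"] Suc.prems(2) x) (use \<iota> in auto)
      finally show "nablaD (Suc m) (direc F \<theta>) x \<iota> = 0" by simp
    next
      fix k I assume "k \<in> {1..m}" "I \<in> partitions k"
      from h[OF this] show "sqrt (real (2 ^ Suc (Suc j))) ^ card I * partition_norm n k I (mnabla k (direc F \<theta>)) \<le> B'"
        by simp
    qed
    then show "mean (\<lambda>x. (direc F \<theta> x - mean (direc F \<theta>)) ^ (2 * 2 ^ Suc j)) \<le> (K * B') ^ (2 * 2 ^ Suc j)"
      by (simp add: K_def)
  qed
  \<comment> \<open>Doubling \<open>X\<close> pays for the factor \<open>exp p \<le> 4 ^ p\<close>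
    of the change of measure.\<close>
  define B0 where "B0 = (2 * X)\<^sup>2 / real p"
  have p0: "real p > 0" by (simp add: p_def)
  have B0: "B0 > 0" using X p0 by (simp add: B0_def)
  \<comment> \<open>The gradient moment of order \<open>2 ^ j\<close> is raised by Jensen to order
    \<open>p = 2 ^ Suc j\<close>, because \<open>direc_moment\<close> couples \<open>p\<close> signs
    with moments of order \<open>2 * p\<close>.\<close>
  let ?Y = "cexp {1..n} (\<lambda>\<tau>. grad {1..n} f \<tau> ^ (2 ^ j)) ref"
  have "?Y\<^sup>2 \<le> cexp {1..n} (\<lambda>\<tau>. (grad {1..n} f \<tau> ^ (2 ^ j))\<^sup>2) ref" by (rule cexp_square_le[OF ref])
  also have "\<dots> = mean (\<lambda>\<tau>. grad {1..n} f \<tau> ^ (2 ^ Suc j))" by (simp only: mean_def power_mult[symmetric] power_Suc2)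
  also have "\<dots> \<le> mean (\<lambda>x. exp (real p) * rexp0 p {1..n} (\<lambda>e. direc F (\<lambda>i. bval p (e i)) x ^ (2 * p)))"
    unfolding mean_def
  proof (rule cexp_mono[OF ref])
    fix x
    have "(\<Sum>i\<in>{1..n}. (dif i F x)\<^sup>2) ^ (2 ^ Suc j) \<le> exp (real p) * rexp0 p {1..n} (\<lambda>e. (\<Sum>i\<in>{1..n}. dif i F x * bval p (e i)) ^ (2 ^ Suc (Suc j)))"
      by (rule norm_power_le_rexp) (auto simp: p_def)
    then show "grad {1..n} f x ^ (2 ^ Suc j) \<le> exp (real p) * rexp0 p {1..n} (\<lambda>e. direc F (\<lambda>i. bval p (e i)) x ^ (2 * p))"
      unfolding gradf direc_def p_def by (simp add: mult.commute)
  qed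
  also have "\<dots> = exp (real p) * rexp0 p {1..n} (\<lambda>e. mean (\<lambda>x. direc F (\<lambda>i. bval p (e i)) x ^ (2 * p)))"
    unfolding rexp_mean_swap by (simp add: mean_def cexp_cmult)
  also have "\<dots> \<le> exp (real p) * (X / sqrt (real p)) ^ (2 * p)"
    using step by (intro mult_left_mono) (auto simp: X_def)
  also have "\<dots> \<le> 4 ^ p * (X / sqrt (real p)) ^ (2 * p)"
  proof (rule mult_right_mono)
    have "exp (real p) = exp 1 ^ p" by (simp flip: exp_of_nat_mult)
    also have "\<dots> \<le> 4 ^ p" using exp_le by (intro power_mono) auto
    finally show "exp (real p) \<le> 4 ^ p" .
  qed (simp add: zero_le_even_power)
  also have "\<dots> = B0 ^ p"
    using p0 by (simp add: B0_def power_mult power_divide power_mult_distrib)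
  also have "\<dots> = (B0 ^ (2 ^ j))\<^sup>2" by (simp only: p_def power_mult[symmetric] power_Suc2)
  finally have "?Y \<le> B0 ^ (2 ^ j)" by (rule power2_le_imp_le) (use B0 in simp)
  then have main: "cexp {1..n} (\<lambda>\<tau>. f \<tau> ^ (2 ^ Suc j)) ref \<le> (MC * 2 ^ Suc j * B0) ^ (2 ^ j)"
    by (intro moment_bound B0 f0) auto
  have "MC * 2 ^ Suc j * B0 = (sqrt MC * (2 * X))\<^sup>2"
    using p0 MC_pos by (simp add: B0_def p_def power_mult_distrib)
  also have "sqrt MC * (2 * X) = CC MC (Suc m) * B"
    by (simp add: X_def K_def)
  finally have e: "MC * 2 ^ Suc j * B0 = (CC MC (Suc m) * B)\<^sup>2" .
  have "cexp {1..n} (\<lambda>\<tau>. f \<tau> ^ (2 ^ Suc j)) ref \<le> (CC MC (Suc m) * B) ^ (2 ^ Suc j)"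
    using main unfolding e by (simp only: power_mult[symmetric] power_Suc)
  then show ?case by (simp only: f_def mean_def)
qed

end

subsection \<open>Tetrahedral polynomials and tail bounds\<close>

text \<open>Affine interpolation from the values at 1 and -1, demanded for all real
  \<open>s\<close>: it lets derivatives on the whole space be read off from differences.\<close>

definition multiaffine :: "((nat \<Rightarrow> real) \<Rightarrow> real) \<Rightarrow> bool" where
  "multiaffine F \<longleftrightarrow> (\<forall>x i s. F (x(i := s)) = (F (x(i := 1)) + F (x(i := -1))) / 2 + s * dif i F x)"

lemma partial_deriv_multiaffine:
  assumes "multiaffine F"
  shows "partial_deriv i F = dif i F"
proof
  fix x
  have "(\<lambda>s. F (x(i := s))) = (\<lambda>s. (F (x(i := 1)) + F (x(i := -1))) / 2 + s * dif i F x)"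
    using assms unfolding multiaffine_def by blast
  moreover have "((\<lambda>s. (F (x(i := 1)) + F (x(i := -1))) / 2 + s * dif i F x) has_real_derivative dif i F x) (at (x i))"
    by (auto intro!: derivative_eq_intros)
  ultimately show "partial_deriv i F x = dif i F x"
    unfolding partial_deriv_def by (simp add: DERIV_imp_deriv)
qed

lemma multiaffine_dif:
  assumes F: "multiaffine F"
  shows "multiaffine (dif j F)"
  unfolding multiaffine_def
proof (intro allI)
  fix x i s
  show "dif j F (x(i := s)) = (dif j F (x(i := 1)) + dif j F (x(i := -1))) / 2 + s * dif i (dif j F) x"
  proof (cases "i = j")
    case True
    then show ?thesis by (simp add: dif_def[of j "dif j F"])
  next
    case False
    then have tw: "x(i := a, j := b) = x(j := b, i := a)" for a b by (simp add: fun_upd_twist)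
    have e: "F (y(i := s)) = (F (y(i := 1)) + F (y(i := -1))) / 2 + s * dif i F y" for y
      using F unfolding multiaffine_def by blast
    have "dif j F (x(i := s)) = (F (x(j := 1, i := s)) - F (x(j := -1, i := s))) / 2"
      by (simp add: dif_def tw)
    also have "\<dots> = (dif j F (x(i := 1)) + dif j F (x(i := -1))) / 2 + s * dif i (dif j F) x"
      unfolding e[of "x(j := 1)"] e[of "x(j := -1)"] by (simp add: dif_def tw field_simps)
    finally show ?thesis .
  qed
qed

lemma multiaffine_sum:
  assumes "\<And>j. j \<in> A \<Longrightarrow> multiaffine (u j)"
  shows "multiaffine (\<lambda>x. \<Sum>j\<in>A. c j * u j x)"
  unfolding multiaffine_def
proof (intro allI)
  fix x i s
  have "(\<Sum>j\<in>A. c j * u j (x(i := s))) = (\<Sum>j\<in>A. c j * ((u j (x(i := 1)) + u j (x(i := -1))) / 2 + s * dif i (u j) x))"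
    using assms unfolding multiaffine_def by (intro sum.cong refl) metis
  also have "\<dots> = ((\<Sum>j\<in>A. c j * u j (x(i := 1))) + (\<Sum>j\<in>A. c j * u j (x(i := -1)))) / 2 + s * (\<Sum>j\<in>A. c j * dif i (u j) x)"
    by (simp add: sum.distrib[symmetric] sum_distrib_left sum_divide_distrib algebra_simps)
  finally show "(\<Sum>j\<in>A. c j * u j (x(i := s))) = ((\<Sum>j\<in>A. c j * u j (x(i := 1))) + (\<Sum>j\<in>A. c j * u j (x(i := -1)))) / 2 + s * dif i (\<lambda>x. \<Sum>j\<in>A. c j * u j x) x"
    unfolding dif_sum .
qed

lemma prod_fun_upd:
  fixes x :: "nat \<Rightarrow> real"
  assumes "finite A"
  shows "(\<Prod>l\<in>A. (x(i := s)) l) = (if i \<in> A then s * (\<Prod>l\<in>A - {i}. x l) else (\<Prod>l\<in>A. x l))"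
proof (cases "i \<in> A")
  case True
  have "(\<Prod>l\<in>A - {i}. (x(i := s)) l) = (\<Prod>l\<in>A - {i}. x l)" by (intro prod.cong) auto
  then show ?thesis using prod.remove[OF assms True, of "x(i := s)"] True by simp
qed (auto intro: prod.cong)

lemma dif_prod:
  assumes "finite A"
  shows "dif i (\<lambda>x. \<Prod>l\<in>A. x l) = (if i \<in> A then (\<lambda>x. \<Prod>l\<in>A - {i}. x l) else (\<lambda>_. 0))"
  unfolding dif_def prod_fun_upd[OF assms] by auto

lemma multiaffine_prod: "finite A \<Longrightarrow> multiaffine (\<lambda>x. \<Prod>l\<in>A. x l)"
  by (simp only: multiaffine_def prod_fun_upd dif_prod) auto

lemma nabla_multiaffine:
  assumes "multiaffine F"
  shows "nabla k F x \<iota> = nablaD k F x \<iota>"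
proof -
  have "foldr (\<lambda>j. partial_deriv (\<iota> j)) xs F = foldr (\<lambda>j. dif (\<iota> j)) xs F \<and> multiaffine (foldr (\<lambda>j. dif (\<iota> j)) xs F)" for xs
    by (induction xs) (simp_all add: assms partial_deriv_multiaffine multiaffine_dif)
  then show ?thesis by (simp only: nabla_def nablaD_def)
qed

lemma nablaD_zero: "nablaD k (\<lambda>_. 0) x \<iota> = 0"
  using nablaD_sum[of k "\<lambda>_. 0" "\<lambda>_ _. 0" "{}" x \<iota>] by simp

text \<open>A difference removes its factor from the monomial or, if that factor is absent,
  annihilates it; this covers repeated indices too.\<close>

lemma nablaD_prod_eq_0:
  assumes "finite A" "card A < k"
  shows "nablaD k (\<lambda>x. \<Prod>l\<in>A. x l) x \<iota> = 0"
  using assms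
proof (induction k arbitrary: A)
  case (Suc k)
  show ?case
  proof (cases "\<iota> (Suc k) \<in> A")
    case True
    moreover have "card A > 0" using True Suc.prems by (auto simp: card_gt_0_iff)
    ultimately show ?thesis
      unfolding nablaD_Suc dif_prod[OF Suc.prems(1)] using Suc.prems by (simp add: Suc.IH card_Diff_singleton)
  next
    case False
    then show ?thesis unfolding nablaD_Suc dif_prod[OF Suc.prems(1)] by (simp add: nablaD_zero)
  qed
qed simp

lemma tetrahedral_eval:
  assumes "tetrahedral n p"
  shows "mpoly_eval p = (\<lambda>x. \<Sum>m\<in>Poly_Mapping.keys p. Poly_Mapping.lookup p m * (\<Prod>i\<in>Poly_Mapping.keys m. x i))"
  unfolding mpoly_eval_def
proof (intro ext sum.cong refl arg_cong2[where f = "(*)"] prod.cong)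
  fix x :: "nat \<Rightarrow> real" and m i
  assume m: "m \<in> Poly_Mapping.keys p" and i: "i \<in> Poly_Mapping.keys m"
  then have "Poly_Mapping.lookup m i \<noteq> 0" by (simp add: Poly_Mapping.in_keys_iff)
  moreover have "Poly_Mapping.lookup m i \<le> 1" using assms m by (simp add: tetrahedral_def)
  ultimately have "Poly_Mapping.lookup m i = 1" by simp
  then show "x i ^ Poly_Mapping.lookup m i = x i" by simp
qed

lemma multiaffine_mpoly:
  assumes "tetrahedral n p"
  shows "multiaffine (mpoly_eval p)"
  unfolding tetrahedral_eval[OF assms] by (intro multiaffine_sum multiaffine_prod) simp

lemma nablaD_mpoly_eq_0:
  assumes t: "tetrahedral n p" and d: "mpoly_degree p < k"
  shows "nablaD k (mpoly_eval p) x \<iota> = 0"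
proof -
  have "nablaD k (\<lambda>x. \<Prod>i\<in>Poly_Mapping.keys m. x i) x \<iota> = 0" if m: "m \<in> Poly_Mapping.keys p" for m
  proof (rule nablaD_prod_eq_0)
    have "card (Poly_Mapping.keys m) = (\<Sum>i\<in>Poly_Mapping.keys m. 1)" by simp
    also have "\<dots> \<le> (\<Sum>i\<in>Poly_Mapping.keys m. Poly_Mapping.lookup m i)"
      by (intro sum_mono) (simp add: Poly_Mapping.in_keys_iff Suc_le_eq)
    also have "\<dots> \<le> mpoly_degree p" unfolding mpoly_degree_def using m by (intro Max_ge) auto
    finally show "card (Poly_Mapping.keys m) < k" using d by simp
  qed simp
  then show ?thesis unfolding tetrahedral_eval[OF t] nablaD_sum by simp
qed

lemma dyadic_below:
  fixes y :: real
  assumes "2 \<le> y"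
  shows "\<exists>j. 2 ^ Suc j \<le> y \<and> y < 2 * 2 ^ Suc j"
proof -
  define N where "N = nat \<lfloor>y\<rfloor>"
  have N: "real N \<le> y" "y < real N + 1" "2 \<le> N" using assms by (auto simp: N_def le_nat_iff le_floor_iff)
  obtain m where m: "2 ^ m \<le> N" "N < 2 ^ (m + 1)"
    using ex_power_ivl1[of 2 N] N(3) by auto
  have "m \<noteq> 0" using m N(3) by (cases m) auto
  then obtain j where j: "m = Suc j" by (cases m) auto
  have "real (2 ^ m) \<le> real N" using m(1) by (simp only: of_nat_le_iff)
  moreover have "real N + 1 \<le> real (2 ^ (m + 1))" using m(2) by (metis Suc_leI add.commute of_nat_Suc of_nat_le_iff)
  ultimately have "2 ^ Suc j \<le> y \<and> y < 2 * 2 ^ Suc j" using N j by simp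
  then show ?thesis by blast
qed

section \<open>From moments to tails\<close>

context ising_model
begin

lemma moment_tail:
  assumes t: "t > 0" and M: "mean (\<lambda>x. f x ^ p) \<le> (t / exp 1) ^ p" and p: "even p"
  shows "mean (\<lambda>x. if \<bar>f x\<bar> \<ge> t then 1 else 0) \<le> exp (- real p)"
proof -
  have "mean (\<lambda>x. if \<bar>f x\<bar> \<ge> t then 1 else 0) \<le> mean (\<lambda>x. f x ^ p / t ^ p)"
    unfolding mean_def
  proof (rule cexp_mono[OF ref])
    fix x
    have "t ^ p \<le> \<bar>f x\<bar> ^ p" if "\<bar>f x\<bar> \<ge> t" using that t by (intro power_mono) auto
    then show "(if \<bar>f x\<bar> \<ge> t then 1 else 0) \<le> f x ^ p / t ^ p"
      using t p by (auto simp: power_even_abs zero_le_even_power)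
  qed
  also have "\<dots> = mean (\<lambda>x. f x ^ p) / t ^ p" by (simp add: mean_def cexp_cdiv)
  also have "\<dots> \<le> (t / exp 1) ^ p / t ^ p" using M t by (intro divide_right_mono) auto
  also have "\<dots> = exp (- real p)"
    using t by (simp add: power_divide exp_minus inverse_eq_divide flip: exp_of_nat_mult)
  finally show ?thesis .
qed

text \<open>Markov's inequality at the largest dyadic exponent \<open>p\<close> below
  \<open>b * M\<close>. The choice of \<open>b\<close> makes the \<open>p\<close>-norm at most
  \<open>t / exp 1\<close>, so the probability is at most \<open>exp (- p)\<close>; the 4 leaves
  room for dyadic rounding and for the trivial range.\<close>

theorem polynomial_tail:
  assumes t: "t > 0" and M: "M \<ge> 0" and K: "K \<ge> CC MC d" "K > 0" and b: "b = (1 / (exp 1 * K))\<^sup>2" "b \<le> 1"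
    and deg: "\<And>x \<iota>. nablaD (Suc d) F x \<iota> = 0"
    and H: "\<And>k I. k \<in> {1..d} \<Longrightarrow> I \<in> partitions k \<Longrightarrow> sqrt M ^ card I * partition_norm n k I (mnabla k F) \<le> t"
  shows "mean (\<lambda>x. if \<bar>F x - mean F\<bar> \<ge> t then 1 else 0) \<le> 2 * exp (- (b / 4 * M))"
proof (cases "b * M < 2")
  case True
  have "mean (\<lambda>x. if \<bar>F x - mean F\<bar> \<ge> t then 1 else 0) \<le> mean (\<lambda>_. 1)"
    unfolding mean_def by (intro cexp_mono ref) simp
  also have "\<dots> = 1" by (simp add: mean_def)
  \<comment> \<open>For \<open>b * M < 2\<close> no admissible exponent exists, but then the claimed
    bound is at least 1.\<close>
  also have "1 \<le> 2 * (1 + (- (b / 4 * M)))" using True by (simp add: mult.commute)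
  also have "\<dots> \<le> 2 * exp (- (b / 4 * M))" by (intro mult_left_mono exp_ge_add_one_self) simp
  finally show ?thesis .
next
  case False
  then obtain j where j: "2 ^ Suc j \<le> b * M" "b * M < 2 * 2 ^ Suc j" using dyadic_below[of "b * M"] by auto
  define p where "p = (2 ^ Suc j :: nat)"
  have p: "real p \<le> b * M" "b * M < 2 * real p" using j by (auto simp: p_def)
  have b0: "b > 0" using K by (simp add: b)
  have sb: "sqrt b = 1 / (exp 1 * K)" using K by (simp add: b)
  have "mean (\<lambda>x. (F x - mean F) ^ (2 ^ Suc j)) \<le> (CC MC d * (sqrt b * t)) ^ (2 ^ Suc j)"
  proof (rule polynomial_moment)
    show "0 < sqrt b * t" using b0 t by simp
  next
    fix k I assume k: "k \<in> {1..d}" and I: "I \<in> partitions k"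
    have "card I \<noteq> 0" using partition_facts[OF I] k by auto
    then obtain r where r: "card I = Suc r" by (cases "card I") auto
    let ?N = "partition_norm n k I (mnabla k F)"
    show "sqrt (real (2 ^ Suc j)) ^ card I * ?N \<le> sqrt b * t"
    proof (cases "?N \<ge> 0")
      case True
      have "sqrt (real p) ^ card I * ?N \<le> sqrt (b * M) ^ card I * ?N"
        using p True by (intro mult_right_mono power_mono real_sqrt_le_mono) auto
      also have "\<dots> = sqrt b ^ card I * (sqrt M ^ card I * ?N)" by (simp add: real_sqrt_mult power_mult_distrib)
      also have "\<dots> \<le> sqrt b * t"
      proof (intro mult_mono H k I)
        \<comment> \<open>A partition of a nonempty set has a block, so one factor
          \<open>sqrt b\<close> survives, and it is the one that shrinks \<open>t\<close>.\<close>
        have "sqrt b ^ r \<le> 1" using b0 b(2) by (intro power_le_one) auto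
        then show "sqrt b ^ card I \<le> sqrt b" using b0 by (simp add: r mult_left_le)
      qed (use b0 M True in auto)
      finally show ?thesis by (simp add: p_def)
    next
      case False
      then have "sqrt (real (2 ^ Suc j)) ^ card I * ?N \<le> 0" by (intro mult_nonneg_nonpos) auto
      also have "0 \<le> sqrt b * t" using b0 t by simp
      finally show ?thesis .
    qed
  qed (rule deg)
  also have "\<dots> \<le> (K * (sqrt b * t)) ^ (2 ^ Suc j)"
    using K CC_pos[OF MC_pos, of d] b0 t by (intro power_mono mult_right_mono) auto
  also have "K * (sqrt b * t) = t / exp 1" using K by (simp add: sb)
  finally have "mean (\<lambda>x. if \<bar>F x - mean F\<bar> \<ge> t then 1 else 0) \<le> exp (- real (2 ^ Suc j))"
    by (intro moment_tail t) auto
  also have "\<dots> \<le> exp (- (b / 4 * M))"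
  proof -
    have "b / 4 * M = b * M / 4" by simp
    also have "\<dots> \<le> real p" using p(2) by linarith
    finally show ?thesis by (simp only: p_def exp_le_cancel_iff neg_le_iff_le)
  qed
  also have "\<dots> \<le> 2 * exp (- (b / 4 * M))" by simp
  finally show ?thesis .
qed

end

text \<open>For \<open>N > 0\<close> both sides are raised to the power \<open>c / 2\<close>. For
  \<open>N \<le> 0\<close> the conclusion holds by sign alone, whatever value the quotient
  takes.\<close>

lemma le_ereal_powr_imp:
  assumes t: "t > 0" and c: "c \<noteq> 0" and M: "M \<ge> 0" and le: "ereal M \<le> ereal_powr (ereal t / ereal N) (2 / real c)"
  shows "sqrt M ^ c * N \<le> t"
proof (cases "N > 0")
  case True
  then have "ereal t / ereal N = ereal (t / N)" by simp
  then have "M \<le> (t / N) powr (2 / real c)" using le by (simp add: ereal_powr_def)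
  then have "M powr (real c / 2) \<le> ((t / N) powr (2 / real c)) powr (real c / 2)"
    using M by (intro powr_mono2) auto
  also have "\<dots> = t / N" using c t True by (simp add: powr_powr)
  finally have "M powr (real c / 2) \<le> t / N" .
  moreover have "sqrt M ^ c = M powr (real c / 2)"
    using M c by (cases "M = 0") (simp_all add: powr_half_sqrt[symmetric] powr_powr zero_power flip: powr_realpow)
  ultimately show ?thesis using True by (simp add: pos_le_divide_eq)
next
  case False
  then have "sqrt M ^ c * N \<le> 0" using M by (intro mult_nonneg_nonpos) auto
  then show ?thesis using t by simp
qed

lemma ereal_powr_nonneg: "0 \<le> ereal_powr x p"
  by (simp add: ereal_powr_def)

lemma partitions_nonempty: "k \<ge> 1 \<Longrightarrow> partitions k \<noteq> {}"
  using partition_on_space[of "{1..k}"] by (auto simp: partitions_def)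

text \<open>An infinite exponent occurs when all norms vanish; the bound then holds for every real
  \<open>M\<close> and forces \<open>P \<le> 0\<close>.\<close>

lemma ereal_exp_bound:
  fixes X :: ereal
  assumes c: "c > 0" and X: "0 \<le> X" and P: "\<And>M. 0 \<le> M \<Longrightarrow> ereal M \<le> X \<Longrightarrow> P \<le> 2 * exp (- (c * M))"
  shows "ereal P \<le> 2 * ereal_exp (- (ereal c * X))"
proof (cases X)
  case (real M)
  then have "P \<le> 2 * exp (- (c * M))" using X by (intro P) auto
  then have "ereal P \<le> ereal (2 * exp (- (c * M)))" by simp
  also have "\<dots> = 2 * ereal_exp (- (ereal c * X))" by (simp add: real ereal_exp_def)
  finally show ?thesis .
next
  case PInf
  have "P \<le> 0"
  proof (rule ccontr)
    assume "\<not> P \<le> 0"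
    then have P0: "P > 0" by simp
    \<comment> \<open>At this \<open>M\<close> the bound yields
      \<open>P * exp (2 / P) \<le> 2\<close>, whereas \<open>exp (2 / P) \<ge> 1 + 2 / P\<close>
      makes the left side at least \<open>P + 2\<close>.\<close>
    then have "P \<le> 2 * exp (- (2 / P))" using P[of "2 / P / c"] c PInf by simp
    then have "P * exp (2 / P) \<le> 2 * exp (- (2 / P)) * exp (2 / P)" by (rule mult_right_mono) simp
    then have "P * exp (2 / P) \<le> 2" by (simp add: mult.assoc flip: exp_add)
    moreover have "P * (1 + 2 / P) \<le> P * exp (2 / P)" using P0 by (intro mult_left_mono exp_ge_add_one_self) simp
    ultimately show False using P0 by (simp add: distrib_left)
  qed
  then show ?thesis using c by (simp add: PInf ereal_exp_def)
qed (use X in auto)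

theorem theorem2p2:
  fixes d :: nat and \<alpha> \<rho> :: real
  assumes "d \<ge> 1" and "\<alpha> \<ge> 0" and "\<rho> > 0"
  shows "\<exists>c::real. c > 0 \<and>
    (\<forall>(n::nat) (J :: nat \<Rightarrow> nat \<Rightarrow> real) (h :: nat \<Rightarrow> real).
      n \<ge> 1 \<longrightarrow>
      (\<forall>i\<in>{1..n}. \<forall>j\<in>{1..n}. J i j = J j i) \<longrightarrow>
      (\<forall>i\<in>{1..n}. J i i = 0) \<longrightarrow>
      (MAX i\<in>{1..n}. \<Sum>j\<in>{1..n}. \<bar>J i j\<bar>) \<le> 1 - \<rho> \<longrightarrow>
      (MAX i\<in>{1..n}. \<bar>h i\<bar>) \<le> \<alpha> \<longrightarrow>
      (\<forall>(p :: real_mpoly) (t::real).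
        tetrahedral n p \<longrightarrow> mpoly_degree p = d \<longrightarrow> t > 0 \<longrightarrow>
        (let \<mu> = ising n J h; f = mpoly_eval p in
          ereal (\<P>(\<sigma> in \<mu>. \<bar>f \<sigma> - (\<integral>\<tau>. f \<tau> \<partial>\<mu>)\<bar> \<ge> t))
            \<le> 2 * ereal_exp (- (ereal c *
                (MIN k\<in>{1..d}. MIN \<I>\<in>partitions k.
                  ereal_powr (ereal t / ereal (partition_norm n k \<I> (mean_nabla \<mu> k f)))
                    (2 / real (card \<I>))))))))"
proof -
  \<comment> \<open>The constant must be fixed before a model is given, whereas positivity of
    \<open>MC\<close> is proved only inside the locale. The absolute value and the summand 1 ensure
    \<open>K \<ge> 1\<close> beforehand; \<rho> and tanh (1 + \<alpha>) are the only parameters of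
    \<open>MC\<close>.\<close>
  define K where "K = \<bar>CC (dobrushin.MC \<rho> (tanh (1 + \<alpha>))) d\<bar> + 1"
  define b where "b = (1 / (exp 1 * K))\<^sup>2"
  have K: "K \<ge> 1" by (simp add: K_def)
  have "exp 1 * K \<ge> 1 * (1::real)" using K by (intro mult_mono) auto
  then have b: "b > 0" "b \<le> 1" by (auto simp: b_def intro!: power_le_one)
  show ?thesis
  proof (rule exI[of _ "b / 4"], intro conjI allI impI)
    show "b / 4 > 0" using b by simp
  next
    fix n J h p t
    assume model: "n \<ge> 1" "\<forall>i\<in>{1..n}. \<forall>j\<in>{1..n}. J i j = J j i" "\<forall>i\<in>{1..n}. J i i = 0"
        "(MAX i\<in>{1..n}. \<Sum>j\<in>{1..n}. \<bar>J i j\<bar>) \<le> 1 - \<rho>" "(MAX i\<in>{1..n}. \<bar>h i\<bar>) \<le> \<alpha>"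
      and p: "tetrahedral n p" "mpoly_degree p = d" and t: "t > (0::real)"
    interpret ising_model n J h \<alpha> \<rho> using model assms by unfold_locales auto
    define f where "f = mpoly_eval p"
    have mn: "mean_nabla (ising n J h) k f = mnabla k f" for k
      unfolding mean_nabla_def[abs_def] integral_ising f_def nabla_multiaffine[OF multiaffine_mpoly[OF p(1)]] ..
    define X where "X = (MIN k\<in>{1..d}. MIN \<I>\<in>partitions k.
        ereal_powr (ereal t / ereal (partition_norm n k \<I> (mnabla k f))) (2 / real (card \<I>)))"
    have X0: "0 \<le> X"
      unfolding X_def using assms(1) partitions_nonempty
      by (subst Min_ge_iff; (auto simp: Min_ge_iff ereal_powr_nonneg))
    have X_le: "X \<le> ereal_powr (ereal t / ereal (partition_norm n k I (mnabla k f))) (2 / real (card I))"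
      if "k \<in> {1..d}" "I \<in> partitions k" for k I
      unfolding X_def using that by (intro order.trans[OF Min_le Min_le]) auto
    have "\<P>(\<sigma> in ising n J h. \<bar>f \<sigma> - (\<integral>\<tau>. f \<tau> \<partial>ising n J h)\<bar> \<ge> t) \<le> 2 * exp (- (b / 4 * M))"
      if M: "0 \<le> M" "ereal M \<le> X" for M
      unfolding prob_ising integral_ising
    proof (rule polynomial_tail[OF t M(1)])
      show "CC MC d \<le> K" by (simp add: K_def)
      show "nablaD (Suc d) f x \<iota> = 0" for x \<iota> unfolding f_def using p by (intro nablaD_mpoly_eq_0) auto
      fix k I assume k: "k \<in> {1..d}" and I: "I \<in> partitions k"
      have "card I \<noteq> 0" using partition_facts[OF I] k by auto
      then show "sqrt M ^ card I * partition_norm n k I (mnabla k f) \<le> t"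
        using order.trans[OF M(2) X_le[OF k I]] by (intro le_ereal_powr_imp t M(1))
    qed (use K b in \<open>auto simp: b_def\<close>)
    then have "ereal (\<P>(\<sigma> in ising n J h. \<bar>f \<sigma> - (\<integral>\<tau>. f \<tau> \<partial>ising n J h)\<bar> \<ge> t)) \<le> 2 * ereal_exp (- (ereal (b / 4) * X))"
      using b X0 by (intro ereal_exp_bound) auto
    then show "let \<mu> = ising n J h; f = mpoly_eval p in
          ereal (\<P>(\<sigma> in \<mu>. \<bar>f \<sigma> - (\<integral>\<tau>. f \<tau> \<partial>\<mu>)\<bar> \<ge> t))
            \<le> 2 * ereal_exp (- (ereal (b / 4) *
                (MIN k\<in>{1..d}. MIN \<I>\<in>partitions k.
                  ereal_powr (ereal t / ereal (partition_norm n k \<I> (mean_nabla \<mu> k f)))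
                    (2 / real (card \<I>)))))"
      unfolding Let_def X_def mn[symmetric] unfolding f_def .
  qed
qed

end
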